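(* Let $k$ be a number field, $\omega:\mathfrak{N}_k\to\mathbb{R}$ a strongly additive function with bounded sup-norm, and $(\mathcal{F},H)$ an ordered sequence of ideals in $\mathcal{O}_k$ that is reasonable. For $X\ge 10$ write $$\mu_X:=\frac{1}{\log\log X}\sum_{\mathfrak{p}}\omega(\mathfrak{p})\frac{\#\{\mathfrak{n}\in\mathcal{F}_H(X):\mathfrak{p}\mid\mathfrak{n}\}}{\#\mathcal{F}_H(X)},$$ $$V_X:=\frac{1}{\log\log X}\sum_{\mathfrak{p}}\omega(\mathfrak{p})^2\,\frac{\#\{\mathfrak{n}\in\mathcal{F}_H(X):\mathfrak{p}\mid\mathfrak{n}\}}{\#\mathcal{F}_H(X)}\left(1-\frac{\#\{\mathfrak{n}\in\mathcal{F}_H(X):\mathfrak{p}\mid\mathfrak{n}\}}{\#\mathcal{F}_H(X)}\right).$$ Then the following statements hold. (i) Suppose that $V_X$ converges to some $V>0$ as $X\to\infty$. Then for every interval $I\subseteq\mathbb{R}$, $$\lim_{X\to\infty}\frac{1}{\#\mathcal{F}_H(X)}\cdot\#\left\{\mathfrak{n}\in\mathcal{F}_H(X):\frac{\omega(\mathfrak{n})-\mu_X\log\log X}{\sqrt{V\log\log X}}\in I\right\}=\frac{1}{\sqrt{2\pi}}\int_I e^{-t^2/2}\,dt.$$ (ii) Suppose that $(\mathcal{F},H)$ is reasonable with respect to the well-mixed Bernoulli process $\mathcal{B}$ with data $\Lambda,s_0,S,(\boldsymbol{f}_{\mathfrak{p}}(s))_{\mathfrak{p}\notin S}$. Then the limits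 $\mu=\lim_{X\to\infty}\mu_X$ and $V=\lim_{X\to\infty}V_X$ respectively exist if and only if the following limit formulae for $\mu$ and $V$ respectively exist: $$\mu=\sum_{\lambda\in\Lambda}w_\lambda(\infty)\lim_{X\to\infty}\frac{1}{\log\log X}\sum_{\substack{\mathfrak{p}\notin S\\ \mathrm{N}\mathfrak{p}\le X}}\omega(\mathfrak{p})f_{\mathfrak{p}}^\lambda(s_0),\qquad V=\sum_{\lambda\in\Lambda}w_\lambda(\infty)\lim_{X\to\infty}\frac{1}{\log\log X}\sum_{\substack{\mathfrak{p}\notin S\\ \mathrm{N}\mathfrak{p}\le X}}\omega(\mathfrak{p})^2f_{\mathfrak{p}}^\lambda(s_0),$$ where terms with $w_\lambda(\infty)=0$ are understood to be $0$. (iii) With $\mathcal{B}$ as in (ii), assume that $\mu_X$ and $V_X$ converge to $\mu\in\mathbb{R}$ and $V>0$ respectively as $X\to\infty$, and that $$\sum_{\lambda\in\Lambda}w_\lambda(\infty)\sum_{\substack{\mathfrak{p}\notin S\\ \mathrm{N}\mathfrak{p}\le X}}\omega(\mathfrak{p})f_{\mathfrak{p}}^\lambda(s_0)=\mu\log\log X+o(\sqrt{\log\log X}).$$ Then for every interval $I\subseteq\mathbb{R}$, $$\lim_{X\to\infty}\frac{1}{\#\mathcal{F}_H(X)}\cdot\#\left\{\mathfrak{n}\in\mathcal{F}_H(X):\frac{\omega(\mathfrak{n})-\mu\log\log X}{\sqrt{V\log\log X}}\in I\right\}=\frac{1}{\sqrt{2\pi}}\int_I e^{-t^2/2}\,d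t.$$
   Context: **Conventions.** $\mathcal{O}_k$ is the ring of integers of $k$; $\mathfrak{p}$ always ranges over nonzero prime ideals of $\mathcal{O}_k$, and $\mathrm{N}\mathfrak{p}=[\mathcal{O}_k:\mathfrak{p}]$. $f=O_\star(g)$ or $f\ll_\star g$ means $|f|\le C|g|$ for an (effectively computable) constant $C>0$ depending at most on $\star$ (and on data already fixed). For a tuple $\mathcal{P}=(\mathfrak{p}_1,\dots,\mathfrak{p}_m)$ of primes, $\prod_{\mathfrak{p}\in\mathcal{P}}$ is taken with multiplicity, while $\prod^{\flat}_{\mathfrak{p}\in\mathcal{P}}$ is taken over the distinct primes occurring in $\mathcal{P}$ (without multiplicity). **Additive functions and sequences of ideals.** $\mathfrak{N}_k$ is the set of nonzero ideals of $\mathcal{O}_k$. A function $\omega:\mathfrak{N}_k\to\mathbb{C}$ is strongly additive if $\omega(\mathfrak{n})=\sum_{\mathfrak{p}\mid\mathfrak{n}}\omega(\mathfrak{p})$ for all $\mathfrak{n}$; its sup-norm is $\Vert\omega\Vert_{\sup}=\sup_{\mathfrak{p}}|\omega(\mathfrak{p})|$. A sequence of ideals $\mathcal{F}$ is an indexed subset of $\mathfrak{N}_k$, i.e. a map $\iota:I_{\mathcal{F}}\to\mathfrak{N}_k$ from some index set; counts and sums over $\mathcal{F}$ are over indices (with multiplicity), and a function on $\mathcal{F}$ is a function on $I_{\mathcal{F}}$ that factors through $\iota$. A Northcott height on $\mathcal{F}$ is a function $H:\mathcal{F}\to\mathbb{R}_{>0}$ such that $\mathcal{F}_H(X):=\{\mathfrak{n}\in\mathcal{F}:H(\mathfrak{n})\le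 X\}$ is finite for all $X>0$. Then $(\mathcal{F},H)$ is called an ordered sequence of ideals in $\mathcal{O}_k$. Expressions with denominator $\#\mathcal{F}_H(X)$ are considered for those $X$ with $\mathcal{F}_H(X)$ nonempty. **Tauberian mixtures.** A Tauberian mixture $\mathcal{T}$ over $k$ consists of a finite set $\Lambda$ (of parameters), a real number $s_0>0$, an integer $b\ge 1$, and for each $\lambda\in\Lambda$ a Dirichlet series $D_\lambda(s)$, such that: each $D_\lambda(s)$ converges absolutely for $\mathrm{Re}(s)>s_0$ and continues meromorphically to $\mathrm{Re}(s)\ge s_0$, its only possible singularity there being a pole of order at most $b$ at $s=s_0$; and $\sum_{\lambda\in\Lambda}D_\lambda(s)$ has a pole of order (exactly) $b$ at $s=s_0$. Let $\mathcal{A}_0(\mathcal{T})$ be the algebra of tuples $\boldsymbol{f}(s)=(f^\lambda(s))_{\lambda\in\Lambda}$ of germs of holomorphic functions at $s_0$ (componentwise operations). For $X\ge X_0$, with $X_0\ge 10$ sufficiently large that the denominators below do not vanish, set $$\widehat{\mathbb{E}}_{\mathcal{T},X}[\boldsymbol{f}(s)]:=\frac{\mathrm{Res}_{s=s_0}\big(\sum_{\lambda\in\Lambda}f^\lambda(s)D_\lambda(s)X^s/s\big)}{\mathrm{Res}_{s=s_0}\big(\sum_{\lambda\in\Lambda}D_\lambda(s)X^s/s\big)},\qquad w_\lambda(X):=\frac{\mathrm{Res}_{s=s_0}\big(D_\lambda(s)X^s/s\big)}{\mathrm{Res}_{s=s_0}\big(\sum_{\lambda'\in\Lambda}D_{\lambda'}(s)X^s/s\big)}.$$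 The limits $w_\lambda(\infty):=\lim_{X\to\infty}w_\lambda(X)$ exist; $\Lambda^+:=\{\lambda\in\Lambda:w_\lambda(\infty)\ne 0\}$. For the definition of $X_0$, the residues $\mathrm{Res}_{s=s_0}(D_\lambda(s)X^s/s)$ for those $\lambda$ such that $D_\lambda$ has a pole at $s_0$ are also required to be nonzero for $X\ge X_0$. **Bernoulli processes.** A Bernoulli process $\mathcal{B}$ over $k$ consists of a finite set $S$ of primes of $k$, a Tauberian mixture $\mathcal{T}$ over $k$, a parameter $X_0\ge 10$ large enough that for all $X\ge X_0$ the residue $\mathrm{Res}_{s=s_0}(\sum_{\lambda\in\Lambda}D_\lambda(s)X^s/s)$, and also $\mathrm{Res}_{s=s_0}(D_\lambda(s)X^s/s)$ for every $\lambda$ such that $D_\lambda$ has a pole at $s_0$, are nonzero, and for each prime $\mathfrak{p}\notin S$ an element $\boldsymbol{f}_{\mathfrak{p}}(s)=(f^\lambda_{\mathfrak{p}}(s))_{\lambda\in\Lambda}\in\mathcal{A}_0(\mathcal{T})$. For $X\ge X_0$ and a tuple $\mathcal{P}$ of primes avoiding $S$, the algebraic moment is $\widehat{M}_{\mathcal{B},X}(\mathcal{P}):=\widehat{\mathbb{E}}_{\mathcal{T},X}\big[\prod^{\flat}_{\mathfrak{p}\in\mathcal{P}}\boldsymbol{f}_{\mathfrak{p}}(s)\big]$. $\mathcal{B}$ is well-mixed if (i) for every $\lambda\in\Lambda$ and integer $r\ge 0$, $\frac{d^r}{ds^r}f_{\mathfrak{p}}^\lambda(s)\big|_{s=s_0}\ll_r\frac{(\log\mathrm{N}\mathfrak{p})^r}{\mathrm{N}\mathfrak{p}}$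 (uniformly in $\mathfrak{p}\notin S$); and (ii) there is a constant $\alpha>0$ such that for all $\mathfrak{p}\notin S$ and $\lambda,\lambda'\in\Lambda^+$, $|f_{\mathfrak{p}}^\lambda(s_0)-f_{\mathfrak{p}}^{\lambda'}(s_0)|\ll(\mathrm{N}\mathfrak{p})^{-1-\alpha}$. **Reasonability.** $(\mathcal{F},H)$ is reasonable if: (i) for all sufficiently large $X\ge 10$, all $0<\psi\le 1$ (possibly depending on $X$) and all $\mathfrak{n}\in\mathcal{F}_H(X)$, $\#\{\mathfrak{p}:\mathfrak{p}\mid\mathfrak{n},\ \mathrm{N}\mathfrak{p}>X^\psi\}\ll_{\mathcal{F},H}1/\psi$; and (ii) there is a well-mixed Bernoulli process $\mathcal{B}$ such that for each $m\in\mathbb{N}$ there are constants $A_m,\delta_m>0$ such that for every tuple $\mathcal{P}=(\mathfrak{p}_1,\dots,\mathfrak{p}_m)$ of primes of $k$ avoiding $S$ and every $X\ge X_0$, $$\frac{\#\{\mathfrak{n}\in\mathcal{F}_H(X):\mathfrak{p}_1,\dots,\mathfrak{p}_m\text{ divide }\mathfrak{n}\}}{\#\mathcal{F}_H(X)}=\widehat{M}_{\mathcal{B},X}(\mathcal{P})+O_{\mathcal{F},H,\mathcal{B}}\left(\prod_{\mathfrak{p}\in\mathcal{P}}(\mathrm{N}\mathfrak{p})^{A_m}\cdot\exp\left(-\frac{\log X}{(\log\log X)^{1/2-\delta_m}}\right)\right).$$ In this case $(\mathcal{F},H)$ is said to be reasonable with respect to $\mathcal{B}$. *)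

theory Defs
  imports
    "HOL-Complex_Analysis.Complex_Analysis"
    "HOL-Library.Landau_Symbols"
    "HOL-Algebra.Ideal_Product"
    "HOL-Algebra.QuotRing"
begin

section \<open>Number fields, primes and ideals\<close>

class number_field = field_char_0 +
  assumes finite_degree:
    "\<exists>B. finite B \<and> (\<forall>x. \<exists>c. x = (\<Sum>b\<in>B. of_rat (c b) * b))"

definition ring_of_integers :: "'k::number_field ring" where
  "ring_of_integers =
     \<lparr>carrier = {x. algebraic_int x}, monoid.mult = (*), one = 1, ring.zero = 0, add = (+)\<rparr>"

definition nonzero_ideals :: "'k::number_field set set" where
  "nonzero_ideals = {\<nn>. ideal \<nn> ring_of_integers \<and> \<nn> \<noteq> {0}}"

definition primes :: "'k::number_field set set" where
  "primes = {\<pp>. primeideal \<pp> ring_of_integers \<and> \<pp> \<noteq> {0}}"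

definition ideal_dvd :: "'k::number_field set \<Rightarrow> 'k set \<Rightarrow> bool" where
  "ideal_dvd \<pp> \<nn> \<longleftrightarrow>
     (\<exists>\<aa>. ideal \<aa> ring_of_integers \<and> \<nn> = \<pp> \<cdot>\<^bsub>ring_of_integers\<^esub> \<aa>)"

definition ideal_norm :: "'k::number_field set \<Rightarrow> nat" where
  "ideal_norm \<pp> = card (carrier (ring_of_integers Quot \<pp>))"


section \<open>Additive functions and ordered sequences of ideals\<close>

definition strongly_additive :: "('k::number_field set \<Rightarrow> real) \<Rightarrow> bool" where
  "strongly_additive \<omega> \<longleftrightarrow>
     (\<forall>\<nn>\<in>nonzero_ideals. \<omega> \<nn> = (\<Sum>\<pp>\<in>{\<pp>\<in>primes. ideal_dvd \<pp> \<nn>}. \<omega> \<pp>))"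

definition bounded_sup_norm :: "('k::number_field set \<Rightarrow> real) \<Rightarrow> bool" where
  "bounded_sup_norm \<omega> \<longleftrightarrow> bdd_above ((\<lambda>\<pp>. \<bar>\<omega> \<pp>\<bar>) ` primes)"

record ('i, 'k) ideal_seq =
  indices :: "'i set"
  ideal_at :: "'i \<Rightarrow> 'k set"
  height :: "'i \<Rightarrow> real"

definition seq_upto :: "('i, 'k) ideal_seq \<Rightarrow> real \<Rightarrow> 'i set" where
  "seq_upto \<F> X = {i \<in> indices \<F>. height \<F> i \<le> X}"

text \<open>The second conjunct says that \<open>height\<close> is a function on the sequence, i.e. that it factors
  through \<open>ideal_at\<close>.\<close>

definition ordered_ideal_seq :: "('i, 'k::number_field) ideal_seq \<Rightarrow> bool" where
  "ordered_ideal_seq \<F> \<longleftrightarrow>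
     ideal_at \<F> ` indices \<F> \<subseteq> nonzero_ideals \<and>
     (\<exists>h. \<forall>i\<in>indices \<F>. height \<F> i = h (ideal_at \<F> i)) \<and>
     (\<forall>i\<in>indices \<F>. height \<F> i > 0) \<and>
     (\<forall>X>0. finite (seq_upto \<F> X))"

text \<open>The proportion of members of height at most \<open>X\<close> divisible by all primes in a tuple. It is
  meaningful only if \<open>seq_upto \<F> X\<close> is nonempty.\<close>

definition divisor_freq :: "('i, 'k::number_field) ideal_seq \<Rightarrow> 'k set list \<Rightarrow> real \<Rightarrow> real" where
  "divisor_freq \<F> P X =
     real (card {i \<in> seq_upto \<F> X. \<forall>\<pp>\<in>set P. ideal_dvd \<pp> (ideal_at \<F> i)}) /
     real (card (seq_upto \<F> X))"

text \<open>The sums over all primes have finite support for every \<open>X\<close>.\<close>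

definition norm_mean ::
  "('i, 'k::number_field) ideal_seq \<Rightarrow> ('k set \<Rightarrow> real) \<Rightarrow> real \<Rightarrow> real" where
  "norm_mean \<F> \<omega> X =
     1 / ln (ln X) * (\<Sum>\<^sub>\<infinity>\<pp>\<in>primes. \<omega> \<pp> * divisor_freq \<F> [\<pp>] X)"

definition norm_variance ::
  "('i, 'k::number_field) ideal_seq \<Rightarrow> ('k set \<Rightarrow> real) \<Rightarrow> real \<Rightarrow> real" where
  "norm_variance \<F> \<omega> X =
     1 / ln (ln X) *
     (\<Sum>\<^sub>\<infinity>\<pp>\<in>primes. (\<omega> \<pp>)\<^sup>2 * divisor_freq \<F> [\<pp>] X * (1 - divisor_freq \<F> [\<pp>] X))"


section \<open>Tauberian mixtures\<close>

text \<open>\<open>dseries \<T> l\<close> is the meromorphic continuation of the Dirichlet series \<open>D\<^sub>l\<close>. Its Dirichlet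
  coefficients are determined by it, so they are not recorded. Only the germ of this function on
  the closed half plane matters, and its value at the point \<open>s\<^sub>0\<close> itself is immaterial.
  The order of a pole is \<open>- zorder\<close>.\<close>

record 'l mixture =
  params :: "'l set"
  abscissa :: real
  pole_order :: nat
  dseries :: "'l \<Rightarrow> complex \<Rightarrow> complex"

definition tauberian_mixture :: "'l mixture \<Rightarrow> bool" where
  "tauberian_mixture \<T> \<longleftrightarrow>
     (let \<Lambda> = params \<T>; s0 = abscissa \<T>; b = pole_order \<T>; D = dseries \<T> in
      finite \<Lambda> \<and> s0 > 0 \<and> b \<ge> 1 \<and>
      (\<forall>l\<in>\<Lambda>.
         (\<exists>a :: nat \<Rightarrow> complex. \<forall>s. Re s > s0 \<longrightarrow>
            summable (\<lambda>n. norm (a (Suc n) / of_nat (Suc n) powr s)) \<and>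
            D l s = (\<Sum>n. a (Suc n) / of_nat (Suc n) powr s)) \<and>
         D l meromorphic_on {s. Re s \<ge> s0} \<and>
         D l analytic_on {s. Re s \<ge> s0} - {of_real s0} \<and>
         (is_pole (D l) (of_real s0) \<longrightarrow> - zorder (D l) (of_real s0) \<le> int b)) \<and>
      is_pole (\<lambda>s. \<Sum>l\<in>\<Lambda>. D l s) (of_real s0) \<and>
      - zorder (\<lambda>s. \<Sum>l\<in>\<Lambda>. D l s) (of_real s0) = int b)"

definition param_residue :: "'l mixture \<Rightarrow> 'l \<Rightarrow> real \<Rightarrow> complex" where
  "param_residue \<T> l X =
     residue (\<lambda>s. dseries \<T> l s * of_real X powr s / s) (of_real (abscissa \<T>))"

definition total_residue :: "'l mixture \<Rightarrow> real \<Rightarrow> complex" where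
  "total_residue \<T> X =
     residue (\<lambda>s. (\<Sum>l\<in>params \<T>. dseries \<T> l s) * of_real X powr s / s) (of_real (abscissa \<T>))"

definition mixture_expectation ::
  "'l mixture \<Rightarrow> real \<Rightarrow> ('l \<Rightarrow> complex \<Rightarrow> complex) \<Rightarrow> complex" where
  "mixture_expectation \<T> X f =
     residue (\<lambda>s. (\<Sum>l\<in>params \<T>. f l s * dseries \<T> l s) * of_real X powr s / s)
       (of_real (abscissa \<T>)) / total_residue \<T> X"

definition weight :: "'l mixture \<Rightarrow> 'l \<Rightarrow> real \<Rightarrow> complex" where
  "weight \<T> l X = param_residue \<T> l X / total_residue \<T> X"

definition weight_lim :: "'l mixture \<Rightarrow> 'l \<Rightarrow> complex" where
  "weight_lim \<T> l = Lim at_top (weight \<T> l)"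

definition positive_params :: "'l mixture \<Rightarrow> 'l set" where
  "positive_params \<T> = {l \<in> params \<T>. weight_lim \<T> l \<noteq> 0}"


section \<open>Bernoulli processes\<close>

text \<open>The germs \<open>f\<^sub>\<pp>\<^sup>l\<close> at \<open>s\<^sub>0\<close> are represented by functions analytic at \<open>s\<^sub>0\<close>.\<close>

record ('l, 'k) bernoulli =
  bad_primes :: "'k set set"
  mixture_of :: "'l mixture"
  threshold :: real
  germ_at :: "'k set \<Rightarrow> 'l \<Rightarrow> complex \<Rightarrow> complex"

definition good_primes :: "('l, 'k::number_field) bernoulli \<Rightarrow> 'k set set" where
  "good_primes \<B> = primes - bad_primes \<B>"

abbreviation centre :: "('l, 'k) bernoulli \<Rightarrow> complex" where
  "centre \<B> \<equiv> of_real (abscissa (mixture_of \<B>))"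

definition bernoulli_process :: "('l, 'k::number_field) bernoulli \<Rightarrow> bool" where
  "bernoulli_process \<B> \<longleftrightarrow>
     finite (bad_primes \<B>) \<and> bad_primes \<B> \<subseteq> primes \<and>
     tauberian_mixture (mixture_of \<B>) \<and>
     threshold \<B> \<ge> 10 \<and>
     (\<forall>X\<ge>threshold \<B>. total_residue (mixture_of \<B>) X \<noteq> 0) \<and>
     (\<forall>X\<ge>threshold \<B>. \<forall>l\<in>params (mixture_of \<B>).
        is_pole (dseries (mixture_of \<B>) l) (centre \<B>) \<longrightarrow>
        param_residue (mixture_of \<B>) l X \<noteq> 0) \<and>
     (\<forall>\<pp>\<in>good_primes \<B>. \<forall>l\<in>params (mixture_of \<B>).
        germ_at \<B> \<pp> l analytic_on {centre \<B>})"

text \<open>The product over \<open>set P\<close> takes each prime of the tuple once.\<close>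

definition algebraic_moment ::
  "('l, 'k::number_field) bernoulli \<Rightarrow> real \<Rightarrow> 'k set list \<Rightarrow> complex" where
  "algebraic_moment \<B> X P =
     mixture_expectation (mixture_of \<B>) X (\<lambda>l s. \<Prod>\<pp>\<in>set P. germ_at \<B> \<pp> l s)"

definition well_mixed :: "('l, 'k::number_field) bernoulli \<Rightarrow> bool" where
  "well_mixed \<B> \<longleftrightarrow>
     (\<forall>r. \<exists>C>0. \<forall>l\<in>params (mixture_of \<B>). \<forall>\<pp>\<in>good_primes \<B>.
        norm ((deriv ^^ r) (germ_at \<B> \<pp> l) (centre \<B>))
          \<le> C * (ln (real (ideal_norm \<pp>)) ^ r / real (ideal_norm \<pp>))) \<and>
     (\<exists>\<alpha>>0. \<exists>C>0. \<forall>\<pp>\<in>good_primes \<B>.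
        \<forall>l\<in>positive_params (mixture_of \<B>). \<forall>l'\<in>positive_params (mixture_of \<B>).
        norm (germ_at \<B> \<pp> l (centre \<B>) - germ_at \<B> \<pp> l' (centre \<B>))
          \<le> C * real (ideal_norm \<pp>) powr (- 1 - \<alpha>))"


section \<open>Reasonability\<close>

definition few_large_primes :: "('i, 'k::number_field) ideal_seq \<Rightarrow> bool" where
  "few_large_primes \<F> \<longleftrightarrow>
     (\<exists>C>0. \<forall>\<^sub>F X in at_top. \<forall>\<psi>. 0 < \<psi> \<and> \<psi> \<le> 1 \<longrightarrow>
        (\<forall>i\<in>seq_upto \<F> X.
           real (card {\<pp>\<in>primes. ideal_dvd \<pp> (ideal_at \<F> i) \<and> real (ideal_norm \<pp>) > X powr \<psi>})
             \<le> C * (1 / \<psi>)))"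

definition moments_approx ::
  "('i, 'k::number_field) ideal_seq \<Rightarrow> ('l, 'k) bernoulli \<Rightarrow> bool" where
  "moments_approx \<F> \<B> \<longleftrightarrow>
     (\<exists>C>0. \<forall>m. \<exists>A>0. \<exists>\<delta>>0. \<forall>P X.
        length P = m \<and> set P \<subseteq> good_primes \<B> \<and> X \<ge> threshold \<B> \<and> seq_upto \<F> X \<noteq> {} \<longrightarrow>
        norm (of_real (divisor_freq \<F> P X) - algebraic_moment \<B> X P)
          \<le> C * ((\<Prod>\<pp>\<leftarrow>P. real (ideal_norm \<pp>) powr A) *
                 exp (- (ln X / ln (ln X) powr (1/2 - \<delta>)))))"

definition reasonable_wrt ::
  "('i, 'k::number_field) ideal_seq \<Rightarrow> ('l, 'k) bernoulli \<Rightarrow> bool" where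
  "reasonable_wrt \<F> \<B> \<longleftrightarrow>
     few_large_primes \<F> \<and> bernoulli_process \<B> \<and> well_mixed \<B> \<and> moments_approx \<F> \<B>"

text \<open>As parameter sets are finite, it is no restriction to take their elements from \<open>nat\<close>.\<close>

definition reasonable :: "('i, 'k::number_field) ideal_seq \<Rightarrow> bool" where
  "reasonable \<F> \<longleftrightarrow> (\<exists>\<B> :: (nat, 'k) bernoulli. reasonable_wrt \<F> \<B>)"


section \<open>The limit laws\<close>

definition prime_sum ::
  "('l, 'k::number_field) bernoulli \<Rightarrow> ('k set \<Rightarrow> real) \<Rightarrow> 'l \<Rightarrow> real \<Rightarrow> complex" where
  "prime_sum \<B> g l X =
     (\<Sum>\<pp>\<in>{\<pp>\<in>good_primes \<B>. real (ideal_norm \<pp>) \<le> X}.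
        of_real (g \<pp>) * germ_at \<B> \<pp> l (centre \<B>))"

definition prime_average ::
  "('l, 'k::number_field) bernoulli \<Rightarrow> ('k set \<Rightarrow> real) \<Rightarrow> 'l \<Rightarrow> real \<Rightarrow> complex" where
  "prime_average \<B> g l X = of_real (1 / ln (ln X)) * prime_sum \<B> g l X"

text \<open>The formula \<open>\<Sum>\<^sub>l w\<^sub>l(\<infinity>) lim\<^sub>X prime_average \<B> g l X\<close> exists if the inner limits exist for
  all \<open>l\<close> of nonzero weight; the remaining terms are 0 by convention.\<close>

definition limit_formula_exists ::
  "('l, 'k::number_field) bernoulli \<Rightarrow> ('k set \<Rightarrow> real) \<Rightarrow> bool" where
  "limit_formula_exists \<B> g \<longleftrightarrow>
     (\<forall>l\<in>positive_params (mixture_of \<B>). \<exists>z. (prime_average \<B> g l \<longlongrightarrow> z) at_top)"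

definition limit_formula ::
  "('l, 'k::number_field) bernoulli \<Rightarrow> ('k set \<Rightarrow> real) \<Rightarrow> complex" where
  "limit_formula \<B> g =
     (\<Sum>l\<in>params (mixture_of \<B>).
        if weight_lim (mixture_of \<B>) l = 0 then 0
        else weight_lim (mixture_of \<B>) l * Lim at_top (prime_average \<B> g l))"

definition gaussian_law ::
  "('i, 'k::number_field) ideal_seq \<Rightarrow> ('k set \<Rightarrow> real) \<Rightarrow> (real \<Rightarrow> real) \<Rightarrow> real \<Rightarrow> bool" where
  "gaussian_law \<F> \<omega> \<mu> V \<longleftrightarrow>
     (\<forall>I. is_interval I \<longrightarrow>
        ((\<lambda>X. 1 / real (card (seq_upto \<F> X)) *
              real (card {i \<in> seq_upto \<F> X.
                (\<omega> (ideal_at \<F> i) - \<mu> X * ln (ln X)) / sqrt (V * ln (ln X)) \<in> I}))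
         \<longlongrightarrow> 1 / sqrt (2 * pi) * (LINT t:I|lborel. exp (- (t\<^sup>2) / 2))) at_top)"

end

theory Submission
  imports Defs "HOL-Probability.Probability" "HOL-Real_Asymp.Real_Asymp"
begin

text \<open>
  Draw a member of height at most \<open>X\<close> at random. Strong additivity makes the value of \<open>\<omega>\<close> at the
  member a sum over primes \<open>p\<close> of \<open>\<omega> p\<close> times the indicator of divisibility by \<open>p\<close>. Apart from a
  bound for the number of large prime divisors, the hypotheses describe these indicators only
  through joint frequencies of boundedly many primes of moderate norm, so the law of the sum is
  found by the method of moments.

  The algebraic side concerns the functional that replaces the true frequencies. Residues at \<open>s\<^sub>0\<close>
  are coefficients of products of power series in \<open>t = s - s\<^sub>0\<close> (\<open>mixture_power_series\<close>), and the
  weighted norm \<open>jet_norm\<close> with radius \<open>1 / ln X\<close> is submultiplicative and controls them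
  (\<open>jet_expectation_bound\<close>). For each parameter, the moments are those of independent Bernoulli
  variables whose success probabilities are power series in \<open>t\<close>. The exponential generating
  function of the centred and normalized sum is therefore a product over primes
  (\<open>generating_function_eq\<close>). A Taylor expansion of each factor (\<open>factor_estimate\<close>) leaves a
  Gaussian factor times an error: a derivative of order \<open>r \<ge> 1\<close> contributes at most a multiple of
  \<open>ln (N p) / (N p ln X)\<close>, whose sum over \<open>N p \<le> X\<close> is bounded by Mertens' theorem and which
  carries a further factor \<open>1 / sqrt (ln ln X)\<close>; and a parameter whose weight tends to 0 contributes
  at most \<open>exp (O (sqrt (ln ln X))) / ln X\<close>. So the generating function tends to \<open>exp (z\<^sup>2 / 2)\<close>
  uniformly on bounded sets (\<open>generating_limit\<close>, \<open>generating_function_uniform\<close>), and its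
  derivatives at 0, which are the moments, converge too (\<open>signed_moments\<close>).

  The arithmetic side transfers this to the true frequencies. Moments up to order \<open>n\<close> may be
  compared as long as only primes of norm at most \<open>X powr \<psi> X\<close> enter, where \<open>\<psi>\<close> depends on \<open>n\<close> and
  \<open>1 / \<psi> X = o (sqrt (ln ln X))\<close> (\<open>truncation_exists\<close>, \<open>moments_transfer\<close>). A member has only
  \<open>O (1 / \<psi> X)\<close> prime divisors of larger norm, so the truncation moves the normalized sum by
  \<open>o (1)\<close>, uniformly in the member. For every \<open>n\<close> the characteristic function is thus within a
  Taylor remainder of order \<open>n\<close> of the Gaussian one, and letting \<open>n\<close> grow proves convergence
  (\<open>char_limit_from_moments\<close>); Levy's theorem turns this into the limit law (\<open>central_limit\<close>).

  The mean and the variance are first moments. For each parameter \<open>l\<close> of nonzero limiting weight,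
  the sum of \<open>g p\<close> times the frequency of \<open>p\<close> over all primes differs from the sum of
  \<open>g p\<close> times the value at \<open>s\<^sub>0\<close> of the germ of \<open>p\<close> and \<open>l\<close> over \<open>N p \<le> X\<close> by
  \<open>o (sqrt (ln ln X))\<close> (\<open>first_moment\<close>).
  This gives the limit formulae, and it shows that the centring in the last part of the theorem
  differs from the true mean by an amount that disappears after normalization.
\<close>


section \<open>Primes of a number field\<close>

definition lin_comb_int :: "('k::number_field \<Rightarrow> int) \<Rightarrow> 'k set \<Rightarrow> 'k" where
  "lin_comb_int c S = (\<Sum>s\<in>S. of_int (c s) * s)"

lemma algebraic_int_closed:
  assumes "cring (ring_of_integers :: 'k::number_field ring)"
  shows "algebraic_int (x::'k) \<Longrightarrow> algebraic_int y \<Longrightarrow> algebraic_int (x + y)"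
    and "algebraic_int (x::'k) \<Longrightarrow> algebraic_int y \<Longrightarrow> algebraic_int (x * y)"
proof -
  interpret cring "ring_of_integers :: 'k ring" by fact
  show "algebraic_int (x::'k) \<Longrightarrow> algebraic_int y \<Longrightarrow> algebraic_int (x + y)"
    using add.m_closed[of x y] by (simp add: ring_of_integers_def)
  show "algebraic_int (x::'k) \<Longrightarrow> algebraic_int y \<Longrightarrow> algebraic_int (x * y)"
    using m_closed[of x y] by (simp add: ring_of_integers_def)
qed

lemma ideal_of_integers_closed:
  assumes "ideal I (ring_of_integers :: 'k::number_field ring)"
  shows "I \<subseteq> {x. algebraic_int x}" "0 \<in> I"
    and "x \<in> I \<Longrightarrow> y \<in> I \<Longrightarrow> x + y \<in> I"
    and "x \<in> I \<Longrightarrow> algebraic_int y \<Longrightarrow> y * x \<in> I"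
proof -
  interpret ideal I "ring_of_integers :: 'k ring" by fact
  show "I \<subseteq> {x. algebraic_int x}" using a_subset by (simp add: ring_of_integers_def)
  show "0 \<in> I" using additive_subgroup.zero_closed[OF is_additive_subgroup] by (simp add: ring_of_integers_def)
  show "x \<in> I \<Longrightarrow> y \<in> I \<Longrightarrow> x + y \<in> I"
    using additive_subgroup.a_closed[OF is_additive_subgroup, of x y] by (simp add: ring_of_integers_def)
  show "x \<in> I \<Longrightarrow> algebraic_int y \<Longrightarrow> y * x \<in> I"
    using I_l_closed[of x y] by (simp add: ring_of_integers_def)
qed

lemma ideal_diff:
  assumes "ideal I (ring_of_integers :: 'k::number_field ring)" "x \<in> I" "y \<in> I"
  shows "x - y \<in> I"
proof -
  have "algebraic_int (-1::'k)" by simp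
  then have "(-1) * y \<in> I" using ideal_of_integers_closed(4)[OF assms(1,3)] by blast
  then show ?thesis using ideal_of_integers_closed(3)[OF assms(1,2), of "-1 * y"] by simp
qed

lemma ideal_sum:
  assumes "ideal I (ring_of_integers :: 'k::number_field ring)" "\<And>s. s \<in> S \<Longrightarrow> f s \<in> I"
  shows "sum f S \<in> I"
  using assms(2) by (induction S rule: infinite_finite_induct)
    (auto intro: ideal_of_integers_closed(2,3)[OF assms(1)])

context
  fixes P :: "'k::number_field set"
  assumes P: "P \<in> primes"
begin

lemma prime_ideal: "ideal P ring_of_integers"
  using P by (simp add: primes_def primeideal_def)

lemma prime_cring: "cring (ring_of_integers :: 'k ring)"
  using P by (simp add: primes_def primeideal_def)

lemma prime_mult_cases:
  assumes "algebraic_int x" "algebraic_int y" "x * y \<in> P"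
  shows "x \<in> P \<or> y \<in> P"
proof -
  interpret primeideal P ring_of_integers using P by (simp add: primes_def)
  show ?thesis using I_prime[of x y] assms by (simp add: ring_of_integers_def)
qed

lemma one_notin_prime: "1 \<notin> P"
proof
  assume 1: "1 \<in> P"
  interpret primeideal P ring_of_integers using P by (simp add: primes_def)
  have "x \<in> P" if "algebraic_int x" for x
    using ideal_of_integers_closed(4)[OF prime_ideal 1 that] by simp
  then have "P = carrier ring_of_integers"
    using ideal_of_integers_closed(1)[OF prime_ideal] by (auto simp: ring_of_integers_def)
  then show False using I_notcarr by simp
qed

end

lemma algebraic_int_poly:
  assumes R: "cring (ring_of_integers :: 'k::number_field ring)" and x: "algebraic_int (x::'k)"
  shows "algebraic_int (poly (map_poly of_int q) x)"
proof (induction q)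
  case (pCons a q)
  then show ?case using algebraic_int_closed[OF R] x by (simp add: map_poly_pCons)
qed simp

text \<open>The constant term of a monic integer polynomial that vanishes at \<open>x\<close> and has least degree is
  a nonzero multiple of \<open>x\<close>.\<close>

lemma ideal_contains_nat:
  assumes R: "cring (ring_of_integers :: 'k::number_field ring)"
    and I: "ideal I (ring_of_integers :: 'k ring)" and "I \<noteq> {0}"
  shows "\<exists>n>0. of_nat n \<in> I"
proof -
  obtain x where x: "x \<in> I" "x \<noteq> 0" using assms(3) ideal_of_integers_closed(2)[OF I] by blast
  have ax: "algebraic_int x" using ideal_of_integers_closed(1)[OF I] x by auto
  let ?Q = "\<lambda>f::int poly. poly (map_poly of_int f) x = 0 \<and> lead_coeff f = 1"
  have "\<exists>f. ?Q f" using ax by (auto simp: algebraic_int_altdef_ipoly)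
  then obtain f where f: "?Q f" and min: "\<And>g. ?Q g \<Longrightarrow> degree f \<le> degree g"
    using ex_has_least_nat[of ?Q _ degree] by blast
  obtain a q where fa: "f = pCons a q" by (cases f)
  have ev: "of_int a + x * poly (map_poly of_int q) x = 0"
    using f by (simp add: fa map_poly_pCons)
  have q0: "q \<noteq> 0" using f fa by (auto simp: map_poly_pCons)
  have a0: "a \<noteq> 0"
  proof
    assume "a = 0"
    then have "?Q q" using ev x f fa q0 by auto
    then show False using min[of q] fa q0 by simp
  qed
  have "poly (map_poly of_int q) x * x \<in> I"
    using ideal_of_integers_closed(4)[OF I x(1) algebraic_int_poly[OF R ax]] .
  moreover have "poly (map_poly of_int q) x * x = of_int (-a)"
    using ev by (simp add: eq_neg_iff_add_eq_0 mult.commute add.commute)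
  ultimately have ma: "of_int (-a) \<in> I" by simp
  have "of_int a = (0::'k) - of_int (-a)" by simp
  then have pa: "of_int a \<in> I" using ideal_diff[OF I ideal_of_integers_closed(2)[OF I] ma] by simp
  have "of_nat (nat \<bar>a\<bar>) \<in> I" using ma pa by (cases "a \<ge> 0") auto
  then show ?thesis using a0 by (intro exI[of _ "nat \<bar>a\<bar>"]) auto
qed

lemma prime_contains_rational_prime:
  assumes P: "(P :: 'k::number_field set) \<in> primes"
  shows "\<exists>p::nat. prime p \<and> of_nat p \<in> P"
proof -
  have "P \<noteq> {0}" using P by (simp add: primes_def)
  then obtain n :: nat where "n > 0" "of_nat n \<in> P"
    using ideal_contains_nat[OF prime_cring[OF P] prime_ideal[OF P]] by blast
  then show ?thesis
  proof (induction n rule: less_induct)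
    case (less n)
    show ?case
    proof (cases "n = 1")
      case True
      then show ?thesis using less one_notin_prime[OF P] by simp
    next
      case False
      then obtain p where p: "prime p" "p dvd n" using prime_factor_nat[of n] by auto
      then obtain m where m: "n = p * m" by auto
      have "of_nat p \<in> P \<or> of_nat m \<in> P"
        using less.prems(2) by (intro prime_mult_cases[OF P]) (auto simp: m)
      moreover have "m < n" "m > 0" using p m less.prems(1) prime_gt_1_nat[of p] by auto
      ultimately show ?thesis using less.IH p(1) by blast
    qed
  qed
qed

definition prime_below :: "'k::number_field set \<Rightarrow> nat" where
  "prime_below P = (SOME p. prime p \<and> of_nat p \<in> P)"

lemma prime_below:
  assumes "P \<in> primes"
  shows "prime (prime_below P)" "of_nat (prime_below P) \<in> P"
  using someI_ex[OF prime_contains_rational_prime[OF assms]] unfolding prime_below_def by auto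

lemma of_int_in_prime_iff:
  assumes P: "P \<in> primes"
  shows "of_int c \<in> P \<longleftrightarrow> int (prime_below P) dvd c"
proof
  assume "int (prime_below P) dvd c"
  then obtain m where "c = int (prime_below P) * m" by auto
  then show "of_int c \<in> P"
    using ideal_of_integers_closed(4)[OF prime_ideal[OF P] prime_below(2)[OF P], of "of_int m"] by (simp add: mult.commute)
next
  assume c: "of_int c \<in> P"
  show "int (prime_below P) dvd c"
  proof (rule ccontr)
    assume "\<not> int (prime_below P) dvd c"
    then have "coprime (int (prime_below P)) c"
      using prime_below(1)[OF P] by (intro prime_imp_coprime) auto
    then obtain u v where uv: "u * int (prime_below P) + v * c = 1"
      using bezout_int[of "int (prime_below P)" c] by auto
    have "of_int u * of_nat (prime_below P) + of_int v * of_int c \<in> P"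
      using ideal_of_integers_closed(3,4)[OF prime_ideal[OF P]] prime_below(2)[OF P] c by simp
    also have "of_int u * of_nat (prime_below P) + of_int v * of_int c =
        of_int (u * int (prime_below P) + v * c)" by simp
    finally show False using one_notin_prime[OF P] uv by simp
  qed
qed

text \<open>Nonzero primes are maximal. For \<open>y \<in> Q - P\<close> consider a monic integer polynomial of least
  degree whose value at \<open>y\<close> lies in \<open>P\<close>; its constant term is a rational integer in \<open>Q\<close>, hence
  in \<open>P\<close>, and cancelling \<open>y\<close> lowers the degree.\<close>

lemma prime_subset_imp_eq:
  assumes P: "P \<in> primes" and Q: "Q \<in> primes" and PQ: "P \<subseteq> Q"
  shows "P = Q"
proof (rule ccontr)
  assume "P \<noteq> Q"
  then obtain y where y: "y \<in> Q" "y \<notin> P" using PQ by auto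
  note R = prime_cring[OF P] and IP = prime_ideal[OF P] and IQ = prime_ideal[OF Q]
  have ay: "algebraic_int y" using ideal_of_integers_closed(1)[OF IQ] y by auto
  let ?Q = "\<lambda>f::int poly. poly (map_poly of_int f) y \<in> P \<and> lead_coeff f = 1"
  have "\<exists>f. ?Q f" using ay ideal_of_integers_closed(2)[OF IP] unfolding algebraic_int_altdef_ipoly by metis
  then obtain f where f: "?Q f" and min: "\<And>g. ?Q g \<Longrightarrow> degree f \<le> degree g"
    using ex_has_least_nat[of ?Q _ degree] by blast
  obtain a q where fa: "f = pCons a q" by (cases f)
  let ?q = "poly (map_poly of_int q) y"
  have ev: "of_int a + y * ?q \<in> P" using f by (simp add: fa map_poly_pCons)
  have q0: "q \<noteq> 0" using f fa one_notin_prime[OF P] by (auto simp: map_poly_pCons)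
  have aq: "algebraic_int ?q" by (rule algebraic_int_poly[OF R ay])
  have "of_int a + y * ?q \<in> Q" using ev PQ by auto
  moreover have "?q * y \<in> Q" by (rule ideal_of_integers_closed(4)[OF IQ y(1) aq])
  ultimately have aQ: "of_int a \<in> Q" using ideal_diff[OF IQ, of "of_int a + y * ?q" "?q * y"] by (simp add: mult.commute)
  have "of_nat (prime_below P) \<in> Q" using prime_below(2)[OF P] PQ by auto
  then have "int (prime_below Q) dvd int (prime_below P)"
    using of_int_in_prime_iff[OF Q, of "int (prime_below P)"] by simp
  then have "prime_below Q = prime_below P"
    using prime_below(1)[OF P] prime_below(1)[OF Q] by (simp add: primes_dvd_imp_eq)
  then have "of_int a \<in> P" using aQ of_int_in_prime_iff[OF P] of_int_in_prime_iff[OF Q] by simp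
  then have "y * ?q \<in> P" using ideal_diff[OF IP ev, of "of_int a"] by simp
  then have "?q \<in> P" using prime_mult_cases[OF P ay aq] y by auto
  then have "?Q q" using f fa q0 by auto
  then show False using min[of q] fa q0 by simp
qed

text \<open>A rational relation is cleared of denominators, and a primitive integer relation is found by
  descent on the sum of the absolute values of the coefficients.\<close>

lemma bounded_independent_sets:
  "\<exists>d>0. \<forall>S :: 'k::number_field set. \<forall>p::int. p > 1 \<longrightarrow> finite S \<longrightarrow> card S > d \<longrightarrow>
     (\<exists>c. lin_comb_int c S = 0 \<and> \<not> (\<forall>s\<in>S. p dvd c s))"
proof -
  obtain B :: "'k set" where B: "finite B" "\<And>x::'k. \<exists>c. x = (\<Sum>b\<in>B. of_rat (c b) * b)"
    using finite_degree by blast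
  interpret V: vector_space "\<lambda>(c::rat) (x::'k). of_rat c * x"
    by unfold_locales (auto simp: of_rat_add of_rat_mult algebra_simps)
  have sp: "x \<in> V.span B" for x
  proof -
    obtain c where "x = (\<Sum>b\<in>B. of_rat (c b) * b)" using B by blast
    then show ?thesis by (metis (no_types, lifting) V.span_sum V.span_scale V.span_base)
  qed
  have "\<exists>c. lin_comb_int c S = 0 \<and> \<not> (\<forall>s\<in>S. p dvd c s)"
    if S: "finite S" "card S > card B + 1" and p: "p > 1" for S :: "'k set" and p :: int
  proof -
    have "\<not> V.independent S"
    proof
      assume "V.independent S"
      then have "card S \<le> card B" using V.independent_span_bound[OF B(1), of S] sp by auto
      then show False using S by simp
    qed
    then obtain u v where u: "(\<Sum>x\<in>S. of_rat (u x) * x) = 0" "v \<in> S" "u v \<noteq> 0"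
      using V.dependent_finite[OF S(1)] by auto
    define q where "q x = snd (quotient_of (u x))" for x
    have q: "q x > 0" for x unfolding q_def by (rule quotient_of_denom_pos')
    define D where "D = (\<Prod>x\<in>S. q x)"
    have D: "D > 0" unfolding D_def using q by (intro prod_pos) auto
    have "\<exists>m. of_rat (u x) * of_int D = (of_int m :: 'k)" if "x \<in> S" for x
    proof -
      have "q x dvd D" unfolding D_def using S that by (intro dvd_prodI) auto
      then obtain e where e: "D = q x * e" by (elim dvdE)
      have "u x = of_int (fst (quotient_of (u x))) / of_int (q x)"
        unfolding q_def by (rule quotient_of_div) simp
      then have "u x * of_int D = of_int (fst (quotient_of (u x)) * e)"
        using q[of x] by (simp add: e nonzero_eq_divide_eq mult.assoc[symmetric])
      then have "of_rat (u x * of_int D) = (of_rat (of_int (fst (quotient_of (u x)) * e)) :: 'k)" by (rule arg_cong)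
      then show ?thesis unfolding of_rat_mult of_rat_of_int_eq by blast
    qed
    then obtain m where m: "\<And>x. x \<in> S \<Longrightarrow> of_rat (u x) * of_int D = (of_int (m x) :: 'k)" by metis
    let ?Q = "\<lambda>c. lin_comb_int c S = 0 \<and> (\<exists>s\<in>S. c s \<noteq> (0::int))"
    have "?Q m"
    proof
      have "lin_comb_int m S = of_int D * (\<Sum>x\<in>S. of_rat (u x) * x)"
        unfolding lin_comb_int_def sum_distrib_left
        by (intro sum.cong refl) (simp add: m[symmetric] mult_ac)
      then show "lin_comb_int m S = 0" using u by simp
      have "of_rat (u v) * of_int D \<noteq> (0::'k)" using u D by simp
      then show "\<exists>s\<in>S. m s \<noteq> 0" using m[OF u(2)] u(2) by force
    qed
    then obtain c where c: "?Q c" and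
      min: "\<And>c'. ?Q c' \<Longrightarrow> (\<Sum>s\<in>S. nat \<bar>c s\<bar>) \<le> (\<Sum>s\<in>S. nat \<bar>c' s\<bar>)"
      using ex_has_least_nat[of ?Q m "\<lambda>c. \<Sum>s\<in>S. nat \<bar>c s\<bar>"] by blast
    have "\<not> (\<forall>s\<in>S. p dvd c s)"
    proof
      assume "\<forall>s\<in>S. p dvd c s"
      then have cd: "\<And>s. s \<in> S \<Longrightarrow> c s = p * (c s div p)" by simp
      have "lin_comb_int c S = of_int p * lin_comb_int (\<lambda>s. c s div p) S"
        unfolding lin_comb_int_def sum_distrib_left
        by (intro sum.cong refl) (metis cd mult.assoc of_int_mult)
      then have 0: "lin_comb_int (\<lambda>s. c s div p) S = 0" using c p by simp
      obtain s where s: "s \<in> S" "c s \<noteq> 0" using c by auto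
      have div0: "c s div p \<noteq> 0" using cd[OF s(1)] s by auto
      have "?Q (\<lambda>s. c s div p)" using 0 s(1) div0 by blast
      moreover have eq: "\<bar>c s\<bar> = p * \<bar>c s div p\<bar>" if "s \<in> S" for s
      proof -
        have "\<bar>c s\<bar> = \<bar>p * (c s div p)\<bar>" using cd[OF that] by simp
        then show ?thesis using p by (simp only: abs_mult)
      qed
      have le: "nat \<bar>c s div p\<bar> \<le> nat \<bar>c s\<bar>" if "s \<in> S" for s
        using eq[OF that] p mult_right_mono[of 1 p "\<bar>c s div p\<bar>"] by (intro nat_mono) linarith
      have "1 * \<bar>c s div p\<bar> < p * \<bar>c s div p\<bar>"
        using p div0 by (intro mult_strict_right_mono) auto
      then have "\<bar>c s div p\<bar> < \<bar>c s\<bar>" using eq[OF s(1)] by linarith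
      then have "(\<Sum>s\<in>S. nat \<bar>c s div p\<bar>) < (\<Sum>s\<in>S. nat \<bar>c s\<bar>)"
        using s le by (intro sum_strict_mono_ex1[OF S(1)]) auto
      ultimately show False using min[of "\<lambda>s. c s div p"] by simp
    qed
    then show ?thesis using c by blast
  qed
  then show ?thesis by (intro exI[of _ "card B + 1"]) auto
qed


text \<open>If \<open>P\<^sub>1, \<dots>, P\<^sub>g\<close> are distinct primes above \<open>p\<close>, choose \<open>x\<^sub>i\<close> in every \<open>P\<^sub>j\<close> with \<open>j \<noteq> i\<close> but not in
  \<open>P\<^sub>i\<close>. Reducing an integral relation between the \<open>x\<^sub>i\<close> modulo \<open>P\<^sub>i\<close> shows that \<open>p\<close> divides its
  \<open>i\<close>-th coefficient. As relations with a coefficient prime to \<open>p\<close> exist once \<open>g\<close> exceeds a bound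
  that depends only on the field, \<open>g\<close> is bounded.\<close>

lemma few_primes_above:
  "\<exists>d>0. \<forall>p. finite {P \<in> primes. prime_below (P :: 'k::number_field set) = p} \<and>
     card {P \<in> primes. prime_below (P :: 'k set) = p} \<le> d"
proof -
  obtain d where d: "d > 0" "\<And>(S :: 'k set) p::int. p > 1 \<Longrightarrow> finite S \<Longrightarrow> card S > d \<Longrightarrow>
     (\<exists>c. lin_comb_int c S = 0 \<and> \<not> (\<forall>s\<in>S. p dvd c s))"
    using bounded_independent_sets by blast
  have "card \<P> \<le> d"
    if fin: "finite \<P>" and sub: "\<P> \<subseteq> {P \<in> primes. prime_below (P :: 'k set) = p}" for \<P> p
  proof (rule ccontr)
    assume big: "\<not> card \<P> \<le> d"
    have pr: "P \<in> primes" "prime_below P = p" if "P \<in> \<P>" for P using sub that by auto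
    have "\<exists>x. algebraic_int x \<and> x \<notin> P \<and> (\<forall>Q\<in>\<P> - {P}. x \<in> Q)" if PP: "P \<in> \<P>" for P
    proof -
      note IP = prime_ideal[OF pr(1)[OF PP]] and R = prime_cring[OF pr(1)[OF PP]]
      have "\<exists>x. algebraic_int x \<and> x \<notin> P \<and> (\<forall>Q\<in>\<Q>. x \<in> Q)"
        if "finite \<Q>" "\<Q> \<subseteq> \<P> - {P}" for \<Q>
        using that
      proof (induction \<Q> rule: finite_induct)
        case empty
        then show ?case using one_notin_prime[OF pr(1)[OF PP]] by (intro exI[of _ 1]) auto
      next
        case (insert Q \<Q>)
        then obtain x where x: "algebraic_int x" "x \<notin> P" "\<forall>Q\<in>\<Q>. x \<in> Q" by auto
        have Q: "Q \<in> primes" "Q \<noteq> P" using insert.prems pr by auto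
        then obtain y where y: "y \<in> Q" "y \<notin> P"
          using prime_subset_imp_eq[OF Q(1) pr(1)[OF PP]] by blast
        have ay: "algebraic_int y" using y ideal_of_integers_closed(1)[OF prime_ideal[OF Q(1)]] by auto
        have "x * y \<notin> P" using prime_mult_cases[OF pr(1)[OF PP] x(1) ay] x y by auto
        moreover have "x * y \<in> Q" using ideal_of_integers_closed(4)[OF prime_ideal[OF Q(1)] y(1) x(1)] .
        moreover have "x * y \<in> Q'" if "Q' \<in> \<Q>" for Q'
        proof -
          have "Q' \<in> primes" using that insert.prems pr by auto
          then show ?thesis
            using ideal_of_integers_closed(4)[OF prime_ideal _ ay, of Q' x] x that by (simp add: mult.commute)
        qed
        ultimately show ?case using algebraic_int_closed(2)[OF R x(1) ay] by blast
      qed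
      then show ?thesis using fin by blast
    qed
    then obtain x where x: "\<And>P. P \<in> \<P> \<Longrightarrow> algebraic_int (x P) \<and> x P \<notin> P \<and> (\<forall>Q\<in>\<P> - {P}. x P \<in> Q)"
      by metis
    have inj: "inj_on x \<P>"
    proof (rule inj_onI)
      fix P Q assume *: "P \<in> \<P>" "Q \<in> \<P>" "x P = x Q"
      show "P = Q" using x[OF *(1)] x[OF *(2)] * by auto
    qed
    obtain P0 where P0: "P0 \<in> \<P>" using big d by (metis all_not_in_conv card.empty le0)
    have p: "prime p" using prime_below(1) pr[OF P0] by metis
    have "card (x ` \<P>) > d" using card_image[OF inj] big by simp
    then obtain c where c: "lin_comb_int c (x ` \<P>) = 0" "\<not> (\<forall>s\<in>x ` \<P>. int p dvd c s)"
      using d(2)[of "int p" "x ` \<P>"] p prime_gt_1_nat fin by auto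
    have "int p dvd c (x P)" if PP: "P \<in> \<P>" for P
    proof -
      note IP = prime_ideal[OF pr(1)[OF PP]]
      have "(\<Sum>Q\<in>\<P>. of_int (c (x Q)) * x Q) = 0"
        using c(1) by (simp add: lin_comb_int_def sum.reindex[OF inj])
      then have "of_int (c (x P)) * x P + (\<Sum>Q\<in>\<P>-{P}. of_int (c (x Q)) * x Q) = 0"
        using fin PP by (simp add: sum.remove)
      then have "of_int (c (x P)) * x P = 0 - (\<Sum>Q\<in>\<P>-{P}. of_int (c (x Q)) * x Q)"
        by (simp add: eq_neg_iff_add_eq_0)
      moreover have "(\<Sum>Q\<in>\<P>-{P}. of_int (c (x Q)) * x Q) \<in> P"
        using x PP by (intro ideal_sum[OF IP] ideal_of_integers_closed(4)[OF IP]) auto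
      ultimately have "of_int (c (x P)) * x P \<in> P"
        using ideal_diff[OF IP ideal_of_integers_closed(2)[OF IP]] by metis
      then have "of_int (c (x P)) \<in> P"
        using prime_mult_cases[OF pr(1)[OF PP], of "of_int (c (x P))" "x P"] x[OF PP] by auto
      then show ?thesis using of_int_in_prime_iff[OF pr(1)[OF PP]] pr(2)[OF PP] by simp
    qed
    then show False using c(2) by auto
  qed
  then have "finite {P \<in> primes. prime_below (P :: 'k set) = p} \<and>
     card {P \<in> primes. prime_below (P :: 'k set) = p} \<le> d" for p
    by (intro finite_if_finite_subsets_card_bdd) auto
  then show ?thesis using d(1) by blast
qed

lemma carrier_Quot_ring_of_integers:
  "carrier (ring_of_integers Quot P) = (\<lambda>x. {h + x |h. h \<in> P}) ` {x :: 'k::number_field. algebraic_int x}"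
  by (auto simp: FactRing_def A_RCOSETS_def RCOSETS_def r_coset_def ring_of_integers_def image_def)

lemma coset_eq:
  assumes P: "P \<in> primes" and "x - y \<in> P"
  shows "{h + x |h. h \<in> P} = {h + y |h. h \<in> P}"
proof -
  have 1: "{h + x |h. h \<in> P} \<subseteq> {h + y |h. h \<in> P}" if "x - y \<in> P" for x y
  proof
    fix z assume "z \<in> {h + x |h. h \<in> P}"
    then obtain h where h: "h \<in> P" "z = h + x" by auto
    have "h + (x - y) \<in> P" using ideal_of_integers_closed(3)[OF prime_ideal[OF P] h(1) that] .
    then show "z \<in> {h + y |h. h \<in> P}" using h by (auto intro!: exI[of _ "h + (x - y)"])
  qed
  have "y - x \<in> P"
    using ideal_diff[OF prime_ideal[OF P] ideal_of_integers_closed(2)[OF prime_ideal[OF P]] assms(2)] by simp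
  then show ?thesis by (intro subset_antisym 1 assms(2))
qed

text \<open>The residue ring is spanned over the integers modulo \<open>p\<close> by the residues of a largest set that is
  independent modulo \<open>P\<close>; the size of such sets is bounded because an integral relation is in
  particular a relation modulo \<open>P\<close>.\<close>

lemma finite_residue_ring:
  assumes P: "(P :: 'k::number_field set) \<in> primes"
  shows "finite (carrier (ring_of_integers Quot P))"
proof -
  note IP = prime_ideal[OF P] and R = prime_cring[OF P]
  define p where "p = prime_below P"
  have p: "prime p" unfolding p_def by (rule prime_below(1)[OF P])
  have pdvd: "of_int c \<in> P \<longleftrightarrow> int p dvd c" for c using of_int_in_prime_iff[OF P] p_def by simp
  obtain d where d: "\<And>(S :: 'k set) p::int. p > 1 \<Longrightarrow> finite S \<Longrightarrow> card S > d \<Longrightarrow>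
     (\<exists>c. lin_comb_int c S = 0 \<and> \<not> (\<forall>s\<in>S. p dvd c s))"
    using bounded_independent_sets by blast
  define indep where "indep S \<longleftrightarrow> finite S \<and> S \<subseteq> {x. algebraic_int x} \<and>
     (\<forall>c. lin_comb_int c S \<in> P \<longrightarrow> (\<forall>s\<in>S. int p dvd c s))" for S
  have "card S \<le> d" if "indep S" for S
  proof (rule ccontr)
    assume "\<not> card S \<le> d"
    moreover have "finite S" "int p > 1" using that p prime_gt_1_nat by (auto simp: indep_def)
    ultimately obtain c where c: "lin_comb_int c S = 0" "\<not> (\<forall>s\<in>S. int p dvd c s)"
      using d[of "int p" S] by auto
    then show False using that ideal_of_integers_closed(2)[OF IP] by (auto simp: indep_def)
  qed
  moreover have "indep {}" by (simp add: indep_def)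
  ultimately obtain S where S: "indep S" and max: "\<And>T. indep T \<Longrightarrow> card T \<le> card S"
    using ex_has_greatest_nat[of indep "{}" card "Suc d"] by (metis less_Suc_eq_le)
  have fS: "finite S" and aS: "\<And>s. s \<in> S \<Longrightarrow> algebraic_int s" using S by (auto simp: indep_def)
  have lin_alg: "algebraic_int (lin_comb_int c S)" for c
  proof -
    have "algebraic_int (\<Sum>s\<in>T. of_int (c s) * s)" if "T \<subseteq> S" for T
      using finite_subset[OF that fS] that
    proof (induction T rule: finite_induct)
      case (insert s T)
      then show ?case using algebraic_int_closed[OF R] aS[of s] by simp
    qed simp
    then show ?thesis by (simp add: lin_comb_int_def)
  qed
  let ?E = "S \<rightarrow>\<^sub>E {0..<int p}"
  have "\<exists>b\<in>?E. x - lin_comb_int b S \<in> P" if ax: "algebraic_int x" for x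
  proof -
    have "\<exists>a. x - lin_comb_int a S \<in> P"
    proof (cases "x \<in> S")
      case True
      have "lin_comb_int (\<lambda>s. if s = x then 1 else 0) S = (\<Sum>s\<in>S. if s = x then x else 0)"
        unfolding lin_comb_int_def by (intro sum.cong) auto
      also have "\<dots> = x" using True fS by simp
      finally have "x - lin_comb_int (\<lambda>s. if s = x then 1 else 0) S \<in> P"
        using ideal_of_integers_closed(2)[OF IP] by simp
      then show ?thesis by blast
    next
      case False
      have "\<not> indep (insert x S)" using max[of "insert x S"] False fS by auto
      then obtain c where c: "lin_comb_int c (insert x S) \<in> P" "\<not> (\<forall>s\<in>insert x S. int p dvd c s)"
        using S ax by (auto simp: indep_def)
      have c1: "of_int (c x) * x + lin_comb_int c S \<in> P"
        using c(1) False fS by (simp add: lin_comb_int_def)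
      have "\<not> int p dvd c x"
      proof
        assume "int p dvd c x"
        then have "of_int (c x) \<in> P" by (simp add: pdvd)
        then have "x * of_int (c x) \<in> P" by (rule ideal_of_integers_closed(4)[OF IP _ ax])
        then have "lin_comb_int c S \<in> P"
          using ideal_diff[OF IP c1, of "x * of_int (c x)"] by (simp add: mult.commute)
        then show False using S c(2) \<open>int p dvd c x\<close> by (auto simp: indep_def)
      qed
      then have "coprime (int p) (c x)" using p by (intro prime_imp_coprime) auto
      then obtain u v where uv: "u * int p + v * c x = 1" using bezout_int[of "int p" "c x"] by auto
      have "of_int v * (of_int (c x) * x + lin_comb_int c S) \<in> P"
        by (rule ideal_of_integers_closed(4)[OF IP c1]) simp
      moreover have "of_int (u * int p) * x \<in> P"
        using ideal_of_integers_closed(4)[OF IP _ ax, of "of_int (u * int p)"] pdvd[of "u * int p"] by (simp add: mult.commute)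
      ultimately have "of_int v * (of_int (c x) * x + lin_comb_int c S) + of_int (u * int p) * x \<in> P"
        by (rule ideal_of_integers_closed(3)[OF IP])
      also have "of_int v * (of_int (c x) * x + lin_comb_int c S) + of_int (u * int p) * x =
          of_int (u * int p + v * c x) * x + of_int v * lin_comb_int c S"
        by (simp add: algebra_simps)
      also have "\<dots> = x - lin_comb_int (\<lambda>s. - v * c s) S"
        unfolding uv lin_comb_int_def by (simp add: sum_distrib_left sum_negf mult.assoc)
      finally show ?thesis by blast
    qed
    then obtain a where a: "x - lin_comb_int a S \<in> P" by blast
    define b where "b = restrict (\<lambda>s. a s mod int p) S"
    have "b \<in> ?E" using p prime_gt_0_nat unfolding b_def by auto
    moreover have "lin_comb_int a S - lin_comb_int b S \<in> P"
    proof -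
      have "lin_comb_int a S - lin_comb_int b S = (\<Sum>s\<in>S. of_int (a s - b s) * s)"
        unfolding lin_comb_int_def sum_subtractf[symmetric] by (intro sum.cong) (auto simp: algebra_simps)
      also have "\<dots> \<in> P"
      proof (rule ideal_sum[OF IP])
        fix s assume s: "s \<in> S"
        have "int p dvd a s - b s" using s by (simp add: b_def minus_mod_eq_mult_div)
        then have "of_int (a s - b s) \<in> P" by (simp only: pdvd)
        then show "of_int (a s - b s) * s \<in> P"
          using ideal_of_integers_closed(4)[OF IP _ aS[OF s], of "of_int (a s - b s)"] by (simp only: mult.commute)
      qed
      finally show ?thesis .
    qed
    ultimately show ?thesis
      using ideal_of_integers_closed(3)[OF IP a, of "lin_comb_int a S - lin_comb_int b S"]
      by (intro bexI[of _ b]) simp_all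
  qed
  then have ex: "\<And>x. algebraic_int x \<Longrightarrow> \<exists>b\<in>?E. x - lin_comb_int b S \<in> P" by blast
  have "carrier (ring_of_integers Quot P) \<subseteq> (\<lambda>b. {h + lin_comb_int b S |h. h \<in> P}) ` ?E"
  proof
    fix Z assume "Z \<in> carrier (ring_of_integers Quot P)"
    then obtain x where x: "algebraic_int x" "Z = {h + x |h. h \<in> P}"
      unfolding carrier_Quot_ring_of_integers by blast
    obtain b where b: "b \<in> ?E" "x - lin_comb_int b S \<in> P" using ex[OF x(1)] by blast
    show "Z \<in> (\<lambda>b. {h + lin_comb_int b S |h. h \<in> P}) ` ?E"
      unfolding x(2) coset_eq[OF P b(2)] using b(1) by (rule imageI)
  qed
  moreover have "finite ?E" using fS by (intro finite_PiE) auto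
  ultimately show ?thesis by (rule finite_surj[rotated])
qed

lemma ideal_norm_ge_prime_below:
  assumes P: "(P :: 'k::number_field set) \<in> primes"
  shows "prime_below P \<le> ideal_norm P"
proof -
  let ?f = "\<lambda>i::nat. {h + of_nat i |h. h \<in> P}"
  have "inj_on ?f {..<prime_below P}"
  proof (rule inj_onI)
    fix i j assume ij: "i \<in> {..<prime_below P}" "j \<in> {..<prime_below P}" "?f i = ?f j"
    have "of_nat i \<in> ?f i" using ideal_of_integers_closed(2)[OF prime_ideal[OF P]] by force
    then obtain h where h: "h \<in> P" "of_nat i = h + of_nat j" using ij(3) by auto
    have "of_int (int i - int j) \<in> P" using h by simp
    then have "int (prime_below P) dvd int i - int j" by (simp only: of_int_in_prime_iff[OF P])
    then show "i = j" using ij(1,2) zdvd_imp_le[of "int (prime_below P)" "int i - int j"]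
        zdvd_imp_le[of "int (prime_below P)" "int j - int i"]
      by (cases i j rule: linorder_cases) (auto simp: dvd_diff_commute)
  qed
  moreover have "?f ` {..<prime_below P} \<subseteq> carrier (ring_of_integers Quot P)"
    unfolding carrier_Quot_ring_of_integers by auto
  ultimately have "card {..<prime_below P} \<le> card (carrier (ring_of_integers Quot P))"
    using card_inj_on_le[OF _ _ finite_residue_ring[OF P]] by blast
  then show ?thesis by (simp add: ideal_norm_def)
qed

lemma ideal_norm_ge_2: "P \<in> primes \<Longrightarrow> ideal_norm P \<ge> 2"
  using ideal_norm_ge_prime_below[of P] prime_below(1)[of P] prime_ge_2_nat[of "prime_below P"] by linarith

lemma prime_below_le_floor:
  assumes "P \<in> primes" "real (ideal_norm P) \<le> Y"
  shows "prime_below P \<le> nat \<lfloor>Y\<rfloor>"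
proof (rule le_nat_floor)
  have "real (prime_below P) \<le> real (ideal_norm P)" using ideal_norm_ge_prime_below[OF assms(1)] by simp
  then show "real (prime_below P) \<le> Y" using assms(2) by linarith
qed

lemma finite_primes_norm_le:
  "finite {P \<in> primes. real (ideal_norm (P :: 'k::number_field set)) \<le> Y}"
proof (rule finite_subset)
  show "{P \<in> primes. real (ideal_norm (P :: 'k set)) \<le> Y}
     \<subseteq> (\<Union>p\<le>nat \<lfloor>Y\<rfloor>. {P \<in> primes. prime_below P = p})"
    using prime_below_le_floor by auto
  show "finite (\<Union>p\<le>nat \<lfloor>Y\<rfloor>. {P \<in> primes. prime_below (P :: 'k set) = p})"
    using few_primes_above by auto
qed

text \<open>A nonzero ideal contains a positive rational integer, which every prime divisor contains too.\<close>

lemma finite_prime_divisors: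
  assumes "\<nn> \<in> nonzero_ideals"
  shows "finite {P \<in> primes. ideal_dvd P (\<nn> :: 'k::number_field set)}"
proof -
  have I: "ideal \<nn> ring_of_integers" and n0: "\<nn> \<noteq> {0}" using assms by (auto simp: nonzero_ideals_def)
  show ?thesis
  proof (cases "\<exists>P. P \<in> (primes :: 'k set set)")
    case True
    then have R: "cring (ring_of_integers :: 'k ring)" using prime_cring by blast
    interpret cring "ring_of_integers :: 'k ring" by fact
    obtain m :: nat where m: "m > 0" "of_nat m \<in> \<nn>" using ideal_contains_nat[OF R I n0] by blast
    have "prime_below P \<le> m" if P: "P \<in> primes" "ideal_dvd P \<nn>" for P
    proof -
      obtain A where A: "ideal A ring_of_integers" "\<nn> = P \<cdot>\<^bsub>ring_of_integers\<^esub> A"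
        using P(2) unfolding ideal_dvd_def by blast
      have "\<nn> \<subseteq> P" using ideal_prod_inter[OF prime_ideal[OF P(1)] A(1)] A(2) by blast
      then have "of_int (int m) \<in> P" using m by auto
      then have "prime_below P dvd m" by (simp only: of_int_in_prime_iff[OF P(1)] int_dvd_int_iff)
      then show ?thesis using m by (auto intro: dvd_imp_le)
    qed
    then have "{P \<in> primes. ideal_dvd P \<nn>} \<subseteq> (\<Union>p\<le>m. {P \<in> primes. prime_below P = p})" by auto
    moreover have "finite (\<Union>p\<le>m. {P \<in> primes. prime_below (P :: 'k set) = p})"
      using few_primes_above by auto
    ultimately show ?thesis by (rule finite_subset)
  qed auto
qed

section \<open>Mertens bounds for rational primes and for primes of a number field\<close>

lemma prod_prime_powers_dvd_fact: "(\<Prod>p\<in>{p. prime p \<and> p \<le> n}. p ^ (n div p)) dvd (fact n :: nat)"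
proof -
  have f: "fact n = (\<Prod>p\<in>prime_factors (fact n :: nat). p ^ multiplicity p (fact n))"
    by (rule prime_factorization_nat) simp
  have pf: "prime_factors (fact n :: nat) = {p. prime p \<and> p \<le> n}"
    by (auto simp: prime_factors_fact) (auto simp: prime_ge_2_nat)
  have "n div p \<le> multiplicity p (fact n :: nat)" if p: "prime p" for p
  proof -
    have "p ^ k dvd (fact (p * k) :: nat)" for k
    proof (induction k)
      case (Suc k)
      have pos: "p > 0" using p prime_gt_0_nat by auto
      have "p * Suc k = Suc (p * k + (p - 1))" using pos by simp
      then have "fact (p * Suc k) = (p * Suc k) * (fact (p * k + (p - 1)) :: nat)"
        by (metis fact_Suc of_nat_id)
      moreover have "(fact (p * k) :: nat) dvd fact (p * k + (p - 1))" by (rule fact_dvd) simp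
      then have "p ^ k dvd (fact (p * k + (p - 1)) :: nat)" using Suc.IH dvd_trans by blast
      then have "p * p ^ k dvd (p * Suc k) * (fact (p * k + (p - 1)) :: nat)" by (intro mult_dvd_mono) auto
      ultimately show ?case by simp
    qed simp
    then have "p ^ (n div p) dvd (fact (p * (n div p)) :: nat)" .
    also have "(fact (p * (n div p)) :: nat) dvd fact n" by (rule fact_dvd) simp
    finally show ?thesis using p by (intro multiplicity_geI) auto
  qed
  then show ?thesis by (subst f) (auto simp: pf intro!: prod_dvd_prod le_imp_power_dvd)
qed

text \<open>The product of the powers \<open>p ^ (n div p)\<close> divides \<open>n! \<le> n ^ n\<close>, and \<open>n div p\<close> is at least
  \<open>n / (2 p)\<close> for \<open>p \<le> n\<close>.\<close>

lemma mertens_rational: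
  assumes "n \<ge> 1"
  shows "(\<Sum>p | prime p \<and> p \<le> n. ln (real p) / real p) \<le> 2 * ln (real n)"
proof -
  let ?A = "{p. prime p \<and> p \<le> n}"
  have fin: "finite ?A" by simp
  have "(\<Prod>p\<in>?A. p ^ (n div p)) \<le> (fact n :: nat)"
    by (rule dvd_imp_le[OF prod_prime_powers_dvd_fact]) simp
  also have "\<dots> \<le> n ^ n" using fact_le_power[of n, where 'a = nat] by simp
  finally have "real (\<Prod>p\<in>?A. p ^ (n div p)) \<le> real (n ^ n)" by (rule of_nat_mono)
  then have "ln (real (\<Prod>p\<in>?A. p ^ (n div p))) \<le> ln (real (n ^ n))"
    using assms by (subst ln_le_cancel_iff) (auto intro!: prod_pos simp: prime_gt_0_nat)
  also have "ln (real (\<Prod>p\<in>?A. p ^ (n div p))) = (\<Sum>p\<in>?A. real (n div p) * ln (real p))"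
    unfolding of_nat_prod using fin
    by (subst ln_prod) (auto simp: prime_gt_0_nat ln_realpow intro!: sum.cong)
  also have "ln (real (n ^ n)) = real n * ln (real n)" using assms by (simp add: ln_realpow)
  finally have 1: "(\<Sum>p\<in>?A. real (n div p) * ln (real p)) \<le> real n * ln (real n)" .
  have "real n / 2 * (\<Sum>p\<in>?A. ln (real p) / real p) = (\<Sum>p\<in>?A. real n / (2 * real p) * ln (real p))"
    unfolding sum_distrib_left by (intro sum.cong) auto
  also have "\<dots> \<le> (\<Sum>p\<in>?A. real (n div p) * ln (real p))"
  proof (intro sum_mono mult_right_mono)
    fix p assume p: "p \<in> ?A"
    then have p0: "p \<ge> 2" using prime_ge_2_nat by auto
    then show "0 \<le> ln (real p)" by simp
    have "n div p \<ge> 1" using p p0 by (simp add: Suc_le_eq div_greater_zero_iff)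
    have "n = p * (n div p) + n mod p" by simp
    also have "\<dots> \<le> p * (n div p) + p * (n div p)"
    proof -
      have "n mod p < p" using p0 by simp
      moreover have "p * 1 \<le> p * (n div p)" using \<open>n div p \<ge> 1\<close> by (intro mult_le_mono2) auto
      ultimately show ?thesis by linarith
    qed
    finally have "real n \<le> real (2 * p * (n div p))" by (intro of_nat_mono) simp
    then show "real n / (2 * real p) \<le> real (n div p)" using p0 by (simp add: field_simps)
  qed
  also note 1
  finally have "real n * (\<Sum>p\<in>?A. ln (real p) / real p) \<le> real n * (2 * ln (real n))" by simp
  then show ?thesis using assms by (subst (asm) mult_le_cancel_left_pos) auto
qed

text \<open>Upper bounds for sums over primes of \<open>k\<close> are inherited from sums over rational primes, at the cost
  of the bounded number of primes above each of them.\<close>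

lemma sum_over_primes_below:
  assumes d: "\<And>p. finite {P \<in> primes. prime_below (P :: 'k::number_field set) = p} \<and>
     card {P \<in> primes. prime_below (P :: 'k set) = p} \<le> d"
    and T: "finite T" "T \<subseteq> (primes :: 'k set set)" and A: "finite A" "prime_below ` T \<subseteq> A"
    and g: "\<And>p. p \<in> A \<Longrightarrow> g p \<ge> (0::real)"
  shows "(\<Sum>P\<in>T. g (prime_below P)) \<le> real d * sum g A"
proof -
  have "(\<Sum>P\<in>T. g (prime_below P)) = (\<Sum>p\<in>A. \<Sum>P\<in>{P\<in>T. prime_below P = p}. g (prime_below P))"
    by (rule sum.group[OF T(1) A(1,2), symmetric])
  also have "\<dots> = (\<Sum>p\<in>A. real (card {P\<in>T. prime_below P = p}) * g p)"
    by (intro sum.cong) auto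
  also have "\<dots> \<le> (\<Sum>p\<in>A. real d * g p)"
  proof (intro sum_mono mult_right_mono g)
    fix p
    have "card {P\<in>T. prime_below P = p} \<le> card {P \<in> primes. prime_below (P :: 'k set) = p}"
      using d T by (intro card_mono) auto
    then show "real (card {P\<in>T. prime_below P = p}) \<le> real d" using d[of p] by linarith
  qed
  finally show ?thesis by (simp add: sum_distrib_left)
qed

lemma mertens_primes:
  "\<exists>C>0. \<forall>Y\<ge>2. (\<Sum>P | P \<in> primes \<and> real (ideal_norm (P :: 'k::number_field set)) \<le> Y.
     ln (real (ideal_norm P)) / real (ideal_norm P)) \<le> C * ln Y"
proof -
  obtain d where d: "d > 0" "\<And>p. finite {P \<in> primes. prime_below (P :: 'k set) = p} \<and>
     card {P \<in> primes. prime_below (P :: 'k set) = p} \<le> d" using few_primes_above by blast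
  \<comment> \<open>A substitute for the monotonicity of \<open>ln x / x\<close>, which fails on \<open>[2, exp 1]\<close>.\<close>
  have 1: "ln x / x \<le> 3 * (ln y / y)" if "2 \<le> y" "y \<le> x" for x y :: real
  proof -
    define c where "c = x / y"
    have c: "c \<ge> 1" "x = y * c" using that by (auto simp: c_def)
    have "ln y \<ge> ln 2" using that by simp
    then have y: "ln y \<ge> 1/2" using ln2_ge_two_thirds by linarith
    have "ln x = ln y + ln c" using c that by (simp add: ln_mult)
    also have "\<dots> \<le> ln y + (c - 1)" using c ln_le_minus_one[of c] by simp
    also have "\<dots> \<le> ln y * c + 2 * ln y * c"
    proof -
      have "1 * c \<le> (2 * ln y) * c" using y c by (intro mult_right_mono) auto
      moreover have "ln y * 1 \<le> ln y * c" using y c by (intro mult_left_mono) auto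
      ultimately show ?thesis by linarith
    qed
    finally have "ln x \<le> 3 * ln y * c" by (simp add: algebra_simps)
    then show ?thesis using that c by (simp add: field_simps)
  qed
  have "(\<Sum>P | P \<in> primes \<and> real (ideal_norm (P :: 'k set)) \<le> Y.
     ln (real (ideal_norm P)) / real (ideal_norm P)) \<le> 6 * real d * ln Y" if Y: "Y \<ge> 2" for Y
  proof -
    let ?T = "{P. P \<in> primes \<and> real (ideal_norm (P :: 'k set)) \<le> Y}"
    let ?n = "nat \<lfloor>Y\<rfloor>"
    let ?A = "{p. prime p \<and> p \<le> ?n}"
    have "(\<Sum>P\<in>?T. ln (real (ideal_norm P)) / real (ideal_norm P))
       \<le> (\<Sum>P\<in>?T. 3 * (ln (real (prime_below P)) / real (prime_below P)))"
    proof (intro sum_mono 1)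
      fix P assume "P \<in> ?T"
      then have P: "P \<in> primes" by simp
      show "2 \<le> real (prime_below P)" using prime_ge_2_nat[OF prime_below(1)[OF P]] by simp
      show "real (prime_below P) \<le> real (ideal_norm P)" using ideal_norm_ge_prime_below[OF P] by simp
    qed
    also have "\<dots> \<le> real d * (\<Sum>p\<in>?A. 3 * (ln (real p) / real p))"
    proof (rule sum_over_primes_below[OF d(2)])
      show "finite ?T" using finite_primes_norm_le[of Y] .
      show "prime_below ` ?T \<subseteq> ?A"
        using prime_below(1) prime_below_le_floor by auto
      show "0 \<le> 3 * (ln (real p) / real p)" if "p \<in> ?A" for p
        using that prime_ge_1_nat[of p] by simp
    qed auto
    also have "\<dots> = real d * 3 * (\<Sum>p\<in>?A. ln (real p) / real p)"
      by (simp only: sum_distrib_left mult.assoc)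
    also have "\<dots> \<le> real d * 3 * (2 * ln (real ?n))"
      using Y by (intro mult_left_mono mertens_rational) (auto simp: le_nat_floor)
    also have "ln (real ?n) \<le> ln Y" using Y by (subst ln_le_cancel_iff) (auto simp: le_nat_floor)
    finally show ?thesis using d by simp
  qed
  then show ?thesis using d by (intro exI[of _ "6 * real d"]) auto
qed

lemma prime_powr_sums_bounded:
  assumes "\<alpha> > 0"
  shows "\<exists>C>0. \<forall>T. finite T \<and> T \<subseteq> primes \<longrightarrow>
     (\<Sum>P\<in>T. real (ideal_norm (P :: 'k::number_field set)) powr (- 1 - \<alpha>)) \<le> C"
proof -
  obtain d where d: "d > 0" "\<And>p. finite {P \<in> primes. prime_below (P :: 'k set) = p} \<and>
     card {P \<in> primes. prime_below (P :: 'k set) = p} \<le> d" using few_primes_above by blast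
  have sm: "summable (\<lambda>n. real n powr (- 1 - \<alpha>))" using assms by (simp add: summable_real_powr_iff)
  let ?s = "\<Sum>n. real n powr (- 1 - \<alpha>)"
  have s0: "?s \<ge> 0" by (rule suminf_nonneg[OF sm]) simp
  have "(\<Sum>P\<in>T. real (ideal_norm P) powr (- 1 - \<alpha>)) \<le> real d * ?s"
    if T: "finite T" "T \<subseteq> primes" for T :: "'k set set"
  proof -
    have "(\<Sum>P\<in>T. real (ideal_norm P) powr (- 1 - \<alpha>)) \<le> (\<Sum>P\<in>T. real (prime_below P) powr (- 1 - \<alpha>))"
    proof (intro sum_mono powr_mono2')
      fix P assume "P \<in> T"
      then have "P \<in> primes" using T by auto
      then show "0 < real (prime_below P)" "real (prime_below P) \<le> real (ideal_norm P)"
        using ideal_norm_ge_prime_below[of P] prime_below(1)[of P] by (auto simp: prime_gt_0_nat)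
    qed (use assms in auto)
    also have "\<dots> \<le> real d * (\<Sum>p\<in>prime_below ` T. real p powr (- 1 - \<alpha>))"
      using T by (intro sum_over_primes_below[OF d(2)]) auto
    also have "\<dots> \<le> real d * ?s"
      using T by (intro mult_left_mono sum_le_suminf[OF sm]) auto
    finally show ?thesis .
  qed
  then have "\<forall>T. finite T \<and> T \<subseteq> primes \<longrightarrow>
     (\<Sum>P\<in>T. real (ideal_norm (P :: 'k set)) powr (- 1 - \<alpha>)) \<le> real d * ?s + 1" by fastforce
  moreover have "real d * ?s + 1 > 0" using s0 by (simp add: add_nonneg_pos)
  ultimately show ?thesis by blast
qed

section \<open>Consequences of a Mertens bound\<close>

text \<open>On \<open>(X powr (1/2), X]\<close> the bound gives \<open>\<Sum> 1 / N \<le> 2 C\<close>, since there \<open>ln N \<ge> ln X / 2\<close>.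
  The interval \<open>(Y, X]\<close> is exhausted by \<open>k\<close> such steps as soon as \<open>2 ^ k \<ge> ln X / ln Y\<close>.\<close>

lemma mertens_imp_reciprocal_sum:
  fixes N :: "'a \<Rightarrow> real"
  assumes N: "\<And>p. p \<in> A \<Longrightarrow> N p \<ge> 2" and fin: "\<And>Y. finite {p\<in>A. N p \<le> Y}"
    and C: "C > 0" "\<And>Y. Y \<ge> 2 \<Longrightarrow> (\<Sum>p | p \<in> A \<and> N p \<le> Y. ln (N p) / N p) \<le> C * ln Y"
    and Y: "2 \<le> Y" "Y \<le> X"
  shows "(\<Sum>p | p \<in> A \<and> Y < N p \<and> N p \<le> X. 1 / N p) \<le> 8 * C * (1 + ln (ln X / ln Y))"
proof -
  have lnY: "ln Y > 0" using Y by simp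
  have step: "(\<Sum>p | p \<in> A \<and> Y < N p \<and> N p \<le> X. 1 / N p) \<le> 2 * C * real k"
    if "Y \<le> X" "ln X \<le> 2 ^ k * ln Y" for X k
    using that
  proof (induction k arbitrary: X)
    case 0
    then have "X \<le> Y" using Y by (subst (asm) power_0) (simp add: ln_le_cancel_iff)
    then have e: "{p. p \<in> A \<and> Y < N p \<and> N p \<le> X} = {}" by auto
    show ?case unfolding e by simp
  next
    case (Suc k)
    have X2: "X \<ge> 2" using Suc.prems Y by simp
    \<comment> \<open>The maximum keeps the induction hypothesis applicable in the last step, where \<open>sqrt X\<close> drops below \<open>Y\<close>.\<close>
    let ?Z = "max Y (sqrt X)"
    have lnZ: "ln (sqrt X) = ln X / 2" using X2 by (simp add: ln_sqrt)
    have Z: "ln ?Z \<le> 2 ^ k * ln Y" "Y \<le> ?Z"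
    proof -
      have "1 * ln Y \<le> 2 ^ k * ln Y" using lnY by (intro mult_right_mono) auto
      then show "ln ?Z \<le> 2 ^ k * ln Y" using lnZ Suc.prems(2) by (auto simp: max_def)
    qed simp
    have "(\<Sum>p | p \<in> A \<and> Y < N p \<and> N p \<le> X. 1 / N p)
        \<le> (\<Sum>p\<in>{p. p \<in> A \<and> Y < N p \<and> N p \<le> ?Z} \<union> {p. p \<in> A \<and> sqrt X < N p \<and> N p \<le> X}. 1 / N p)"
    proof (rule sum_mono2)
      show "finite ({p. p \<in> A \<and> Y < N p \<and> N p \<le> ?Z} \<union> {p. p \<in> A \<and> sqrt X < N p \<and> N p \<le> X})"
        using fin[of ?Z] fin[of X] by (auto intro: rev_finite_subset)
    next
      fix b assume "b \<in> ({p. p \<in> A \<and> Y < N p \<and> N p \<le> ?Z} \<union> {p. p \<in> A \<and> sqrt X < N p \<and> N p \<le> X}) - {p. p \<in> A \<and> Y < N p \<and> N p \<le> X}"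
      then have "b \<in> A" by auto
      from N[OF this] show "0 \<le> 1 / N b" by simp
    qed auto
    also have "\<dots> \<le> (\<Sum>p\<in>{p. p \<in> A \<and> Y < N p \<and> N p \<le> ?Z}. 1 / N p) + (\<Sum>p\<in>{p. p \<in> A \<and> sqrt X < N p \<and> N p \<le> X}. 1 / N p)"
    proof -
      let ?U = "{p. p \<in> A \<and> Y < N p \<and> N p \<le> ?Z}" and ?W = "{p. p \<in> A \<and> sqrt X < N p \<and> N p \<le> X}"
      have f: "finite ?U" "finite ?W" using fin[of ?Z] fin[of X] by (auto intro: rev_finite_subset)
      have "0 \<le> (\<Sum>p\<in>?U \<inter> ?W. 1 / N p)"
      proof (rule sum_nonneg)
        fix p assume "p \<in> ?U \<inter> ?W"
        then have "p \<in> A" by auto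
        from N[OF this] show "0 \<le> 1 / N p" by simp
      qed
      then show ?thesis using sum.union_inter[OF f, of "\<lambda>p. 1 / N p"] by linarith
    qed
    also have "(\<Sum>p\<in>{p. p \<in> A \<and> Y < N p \<and> N p \<le> ?Z}. 1 / N p) \<le> 2 * C * real k"
      using Suc.IH[of ?Z] Z by simp
    also have "(\<Sum>p\<in>{p. p \<in> A \<and> sqrt X < N p \<and> N p \<le> X}. 1 / N p)
        \<le> (\<Sum>p\<in>{p. p \<in> A \<and> sqrt X < N p \<and> N p \<le> X}. 2 / ln X * (ln (N p) / N p))"
    proof (rule sum_mono)
      fix p assume p: "p \<in> {p. p \<in> A \<and> sqrt X < N p \<and> N p \<le> X}"
      have Np: "N p \<ge> 2" using p N by auto
      have "ln (sqrt X) \<le> ln (N p)" using p X2 Np by (subst ln_le_cancel_iff) auto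
      then have "ln X \<le> 2 * ln (N p)" using lnZ by simp
      moreover have "ln X > 0" using X2 by simp
      ultimately show "1 / N p \<le> 2 / ln X * (ln (N p) / N p)" using Np by (simp add: field_simps)
    qed
    also have "\<dots> = 2 / ln X * (\<Sum>p\<in>{p. p \<in> A \<and> sqrt X < N p \<and> N p \<le> X}. ln (N p) / N p)"
      by (simp add: sum_distrib_left)
    also have "(\<Sum>p\<in>{p. p \<in> A \<and> sqrt X < N p \<and> N p \<le> X}. ln (N p) / N p) \<le> (\<Sum>p | p \<in> A \<and> N p \<le> X. ln (N p) / N p)"
    proof (rule sum_mono2)
      show "finite {p. p \<in> A \<and> N p \<le> X}" using fin[of X] by simp
      fix p assume "p \<in> {p. p \<in> A \<and> N p \<le> X} - {p. p \<in> A \<and> sqrt X < N p \<and> N p \<le> X}"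
      then have "p \<in> A" by auto
      from N[OF this] show "0 \<le> ln (N p) / N p" by simp
    qed auto
    also have "\<dots> \<le> C * ln X" by (rule C(2)[OF X2])
    also have "2 / ln X * (C * ln X) = 2 * C" using X2 by simp
    finally show ?case using X2 by (simp add: algebra_simps divide_right_mono)
  qed
  define r where "r = ln X / ln Y"
  have r: "r \<ge> 1" using Y lnY by (simp add: r_def field_simps)
  define k where "k = nat \<lceil>log 2 r\<rceil>"
  have "log 2 r \<le> real k" unfolding k_def by linarith
  then have "r \<le> 2 powr real k" using r by (subst (asm) log_le_iff) auto
  then have "ln X \<le> 2 ^ k * ln Y" using lnY by (simp add: r_def field_simps powr_realpow)
  then have 1: "(\<Sum>p | p \<in> A \<and> Y < N p \<and> N p \<le> X. 1 / N p) \<le> 2 * C * real k" using step Y by blast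
  have "log 2 r \<ge> 0" using r by simp
  then have "real k \<le> log 2 r + 1" unfolding k_def by linarith
  also have "log 2 r = ln r / ln 2" by (simp add: log_def)
  also have "\<dots> \<le> 2 * ln r"
  proof -
    have "ln 2 \<ge> (1/2::real)" using ln2_ge_two_thirds by simp
    then have "ln r * 1 \<le> ln r * (2 * ln 2)" using r by (intro mult_left_mono) auto
    then show ?thesis by (simp add: field_simps)
  qed
  finally have "real k \<le> 4 * (1 + ln r)" using r by simp
  then have "2 * C * real k \<le> 2 * C * (4 * (1 + ln r))" using C by (intro mult_left_mono) auto
  also have "\<dots> = 8 * C * (1 + ln r)" by simp
  finally show ?thesis using 1 unfolding r_def by linarith
qed

lemma mertens_imp_reciprocal_sum_all:
  fixes N :: "'a \<Rightarrow> real"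
  assumes N: "\<And>p. p \<in> A \<Longrightarrow> N p \<ge> 2" and fin: "\<And>Y. finite {p\<in>A. N p \<le> Y}"
    and C: "C > 0" "\<And>Y. Y \<ge> 2 \<Longrightarrow> (\<Sum>p | p \<in> A \<and> N p \<le> Y. ln (N p) / N p) \<le> C * ln Y"
    and X: "X \<ge> 10"
  shows "(\<Sum>p | p \<in> A \<and> N p \<le> X. 1 / N p) \<le> 50 * C * ln (ln X)"
proof -
  have ln2: "ln 2 \<ge> (2/3::real)" "ln 2 \<le> (1::real)" using ln2_ge_two_thirds ln_le_minus_one[of 2] by auto
  have X2: "X \<ge> 2" using X by simp
  have "{p. p \<in> A \<and> N p \<le> X} = {p. p \<in> A \<and> N p \<le> 2} \<union> {p. p \<in> A \<and> 2 < N p \<and> N p \<le> X}"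
    using X by auto
  then have "(\<Sum>p | p \<in> A \<and> N p \<le> X. 1 / N p)
     = (\<Sum>p | p \<in> A \<and> N p \<le> 2. 1 / N p) + (\<Sum>p | p \<in> A \<and> 2 < N p \<and> N p \<le> X. 1 / N p)"
    using fin[of 2] fin[of X] by (simp only:) (intro sum.union_disjoint; auto intro: rev_finite_subset)
  also have "(\<Sum>p | p \<in> A \<and> 2 < N p \<and> N p \<le> X. 1 / N p) \<le> 8 * C * (1 + ln (ln X / ln 2))"
    by (rule mertens_imp_reciprocal_sum[OF N fin C]) (use X2 in auto)
  also have "(\<Sum>p | p \<in> A \<and> N p \<le> 2. 1 / N p) = (\<Sum>p | p \<in> A \<and> N p \<le> 2. 1 / ln 2 * (ln (N p) / N p))"
  proof (rule sum.cong[OF refl])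
    fix p assume p: "p \<in> {p. p \<in> A \<and> N p \<le> 2}"
    then have "p \<in> A" by simp
    from N[OF this] p have "N p = 2" by auto
    then show "1 / N p = 1 / ln 2 * (ln (N p) / N p)" by simp
  qed
  also have "\<dots> = 1 / ln 2 * (\<Sum>p | p \<in> A \<and> N p \<le> 2. ln (N p) / N p)" by (simp add: sum_distrib_left)
  also have "\<dots> \<le> 1 / ln 2 * (C * ln 2)" by (intro mult_left_mono C(2)) auto
  also have "1 / ln 2 * (C * ln 2) = C" by simp
  finally have 1: "(\<Sum>p | p \<in> A \<and> N p \<le> X. 1 / N p) \<le> C + 8 * C * (1 + ln (ln X / ln 2))" by simp
  have "exp 1 * exp (1/2) \<le> (10::real)"
  proof -
    have "exp (1/2::real) \<le> exp 1" by simp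
    then have "exp 1 * exp (1/2) \<le> exp 1 * exp (1::real)" by (intro mult_left_mono) auto
    also have "\<dots> \<le> 3 * 3" using exp_le by (intro mult_mono) auto
    finally show ?thesis by simp
  qed
  then have "exp (3/2) \<le> X" using X by (simp add: exp_add[symmetric])
  then have l1: "ln X \<ge> 3/2" using X by (subst ln_ge_iff) auto
  have "ln (3/2) \<ge> (1/3::real)"
    using ln_one_minus_pos_lower_bound[of "1/3"] ln_add_one_self_le_self2 ln_le_minus_one[of "2/3"]
    by (simp add: ln_div)
  moreover have "ln (ln X) \<ge> ln (3/2)" using l1 by (subst ln_le_cancel_iff) auto
  ultimately have l2: "ln (ln X) \<ge> 1/3" by linarith
  have "ln (ln X / ln 2) = ln (ln X) - ln (ln 2)" using l1 ln2 by (subst ln_div) auto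
  moreover have "- ln (ln 2) \<le> (1/2::real)"
  proof -
    have "1 / ln 2 \<le> (3/2::real)" using ln2 by (simp add: field_simps)
    moreover have "ln (1 / ln 2) \<le> 1 / ln 2 - (1::real)" using ln2 by (intro ln_le_minus_one) auto
    moreover have "ln (1 / ln 2) = - ln (ln 2 :: real)" using ln2 by (subst ln_div) auto
    ultimately show ?thesis by linarith
  qed
  ultimately have "C + 8 * C * (1 + ln (ln X / ln 2)) \<le> C + 8 * C * (1 + (ln (ln X) + 1/2))"
    using C by (intro add_left_mono mult_left_mono) auto
  also have "\<dots> = C * (13 + 8 * ln (ln X))" by (simp add: algebra_simps)
  also have "\<dots> \<le> C * (50 * ln (ln X))" using C l2 by (intro mult_left_mono) auto
  finally show ?thesis using 1 by simp
qed

text \<open>A crude polynomial bound: it is used with \<open>Y = X powr \<psi> X\<close>, against error terms that are smaller than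
  every fixed power of \<open>1 / Y\<close>.\<close>

lemma mertens_imp_card_bound:
  fixes N :: "'a \<Rightarrow> real"
  assumes N: "\<And>p. p \<in> A \<Longrightarrow> N p \<ge> 2" and fin: "\<And>Y. finite {p\<in>A. N p \<le> Y}"
    and C: "C > 0" "\<And>Y. Y \<ge> 2 \<Longrightarrow> (\<Sum>p | p \<in> A \<and> N p \<le> Y. ln (N p) / N p) \<le> C * ln Y"
    and Y: "Y \<ge> 1"
  shows "real (card {p\<in>A. N p \<le> Y}) \<le> 2 * C * Y ^ 2"
proof (cases "Y \<ge> 2")
  case True
  have "real (card {p\<in>A. N p \<le> Y}) = (\<Sum>p | p \<in> A \<and> N p \<le> Y. 1)" by simp
  also have "\<dots> \<le> (\<Sum>p | p \<in> A \<and> N p \<le> Y. 2 * Y * (ln (N p) / N p))"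
  proof (rule sum_mono)
    fix p assume p: "p \<in> {p. p \<in> A \<and> N p \<le> Y}"
    then have n: "N p \<ge> 2" using N by auto
    have "ln 2 \<le> ln (N p)" using n by simp
    then have "1/2 \<le> ln (N p)" using ln2_ge_two_thirds by linarith
    then have "N p * 1 \<le> Y * (2 * ln (N p))" using p n by (intro mult_mono) auto
    then show "1 \<le> 2 * Y * (ln (N p) / N p)" using n by (simp add: field_simps)
  qed
  also have "\<dots> = 2 * Y * (\<Sum>p | p \<in> A \<and> N p \<le> Y. ln (N p) / N p)" by (simp add: sum_distrib_left)
  also have "\<dots> \<le> 2 * Y * (C * ln Y)" using True by (intro mult_left_mono C) auto
  also have "\<dots> \<le> 2 * Y * (C * Y)" using True C ln_le_minus_one[of Y] by (intro mult_left_mono) auto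
  finally show ?thesis by (simp add: power2_eq_square mult_ac)
next
  case False
  then have "{p\<in>A. N p \<le> Y} = {}" using N by force
  then show ?thesis using C Y by (simp del: Collect_empty_eq)
qed

section \<open>A seminorm on jets\<close>

text \<open>Used with radius \<open>\<rho> = 1 / ln X\<close>: each derivative with respect to \<open>s\<close> that is shifted from
  \<open>X powr s\<close> to another factor costs a factor \<open>1 / ln X\<close>. Only the coefficients below the order \<open>b\<close> of
  the pole enter the residue.\<close>

definition jet_norm :: "nat \<Rightarrow> real \<Rightarrow> complex fps \<Rightarrow> real" where
  "jet_norm b \<rho> A = (\<Sum>r<b. norm (fps_nth A r) * \<rho> ^ r)"

context
  fixes b :: nat and \<rho> :: real
  assumes \<rho>: "\<rho> \<ge> 0"
begin

lemma jet_norm_nonneg: "jet_norm b \<rho> A \<ge> 0"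
  unfolding jet_norm_def using \<rho> by (intro sum_nonneg) auto

lemma jet_norm_add: "jet_norm b \<rho> (A + B) \<le> jet_norm b \<rho> A + jet_norm b \<rho> B"
  unfolding jet_norm_def sum.distrib[symmetric] using \<rho>
  by (intro sum_mono) (auto simp: distrib_right[symmetric] intro!: mult_right_mono norm_triangle_ineq)

lemma jet_norm_const: "b \<ge> 1 \<Longrightarrow> jet_norm b \<rho> (fps_const c) = norm c"
proof -
  assume b: "b \<ge> 1"
  have "jet_norm b \<rho> (fps_const c) = (\<Sum>r<b. if r = 0 then norm c else 0)"
    unfolding jet_norm_def by (intro sum.cong) auto
  then show ?thesis using b by simp
qed

lemma jet_norm_1: "b \<ge> 1 \<Longrightarrow> jet_norm b \<rho> 1 = 1"
  using jet_norm_const[of 1] by simp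

lemma jet_norm_mult: "jet_norm b \<rho> (A * B) \<le> jet_norm b \<rho> A * jet_norm b \<rho> B"
proof -
  let ?g = "\<lambda>i j. (norm (fps_nth A i) * \<rho> ^ i) * (norm (fps_nth B j) * \<rho> ^ j)"
  have "jet_norm b \<rho> (A * B) \<le> (\<Sum>r<b. \<Sum>i\<le>r. ?g i (r - i))"
    unfolding jet_norm_def
  proof (rule sum_mono)
    fix r
    have "norm (fps_nth (A * B) r) \<le> (\<Sum>i\<le>r. norm (fps_nth A i) * norm (fps_nth B (r - i)))"
      unfolding fps_mult_nth atLeast0AtMost by (rule sum_norm_le) (simp add: norm_mult)
    then have "norm (fps_nth (A * B) r) * \<rho> ^ r \<le> (\<Sum>i\<le>r. norm (fps_nth A i) * norm (fps_nth B (r - i))) * \<rho> ^ r"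
      using \<rho> by (intro mult_right_mono) auto
    also have "\<dots> = (\<Sum>i\<le>r. ?g i (r - i))"
      unfolding sum_distrib_right
    proof (intro sum.cong refl)
      fix i assume "i \<in> {..r}"
      then have "\<rho> ^ r = \<rho> ^ i * \<rho> ^ (r - i)" by (simp add: power_add[symmetric])
      then show "norm (fps_nth A i) * norm (fps_nth B (r - i)) * \<rho> ^ r = ?g i (r - i)" by simp
    qed
    finally show "norm (fps_nth (A * B) r) * \<rho> ^ r \<le> (\<Sum>i\<le>r. ?g i (r - i))" .
  qed
  also have "\<dots> = (\<Sum>(i,j)\<in>{(i,j). i + j < b}. ?g i j)" by (rule sum.triangle_reindex[symmetric])
  also have "\<dots> \<le> (\<Sum>(i,j)\<in>{..<b} \<times> {..<b}. ?g i j)"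
    using \<rho> by (intro sum_mono2) auto
  also have "\<dots> = jet_norm b \<rho> A * jet_norm b \<rho> B"
    unfolding jet_norm_def sum_product sum.cartesian_product ..
  finally show ?thesis .
qed

lemma jet_norm_cmult: "jet_norm b \<rho> (fps_const c * A) = norm c * jet_norm b \<rho> A"
  unfolding jet_norm_def by (simp add: sum_distrib_left norm_mult mult.assoc)

lemma jet_norm_minus: "jet_norm b \<rho> (- A) = jet_norm b \<rho> A"
  unfolding jet_norm_def by simp

lemma jet_norm_diff: "jet_norm b \<rho> (A - B) \<le> jet_norm b \<rho> A + jet_norm b \<rho> B"
  using jet_norm_add[of A "- B"] by (simp add: jet_norm_minus)

lemma jet_norm_prod:
  assumes "b \<ge> 1"
  shows "jet_norm b \<rho> (\<Prod>p\<in>T. A p) \<le> (\<Prod>p\<in>T. jet_norm b \<rho> (A p))"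
proof (induction T rule: infinite_finite_induct)
  case (insert p T)
  then show ?case
    using order.trans[OF jet_norm_mult[of "A p"] mult_left_mono[OF insert.IH jet_norm_nonneg[of "A p"]]] by simp
qed (use jet_norm_1[OF assms] in auto)

text \<open>The usual bound for products in a Banach algebra; \<open>jet_norm\<close> behaves like the norm of one.\<close>

lemma jet_norm_prod_one_plus:
  assumes "b \<ge> 1"
  shows "jet_norm b \<rho> ((\<Prod>p\<in>T. 1 + E p) - 1) \<le> exp (\<Sum>p\<in>T. jet_norm b \<rho> (E p)) - 1"
proof (induction T rule: infinite_finite_induct)
  case (insert p T)
  let ?P = "(\<Prod>p\<in>T. 1 + E p) - 1" and ?e = "jet_norm b \<rho> (E p)" and ?s = "\<Sum>p\<in>T. jet_norm b \<rho> (E p)"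
  have e: "?e \<ge> 0" by (rule jet_norm_nonneg)
  have "(\<Prod>p\<in>insert p T. 1 + E p) - 1 = (?P + E p * ?P) + E p"
    using insert by (simp add: algebra_simps)
  then have "jet_norm b \<rho> ((\<Prod>p\<in>insert p T. 1 + E p) - 1) \<le> jet_norm b \<rho> (?P + E p * ?P) + ?e"
    using jet_norm_add by metis
  also have "\<dots> \<le> (jet_norm b \<rho> ?P + jet_norm b \<rho> (E p * ?P)) + ?e" using jet_norm_add by simp
  also have "\<dots> \<le> (jet_norm b \<rho> ?P + ?e * jet_norm b \<rho> ?P) + ?e" using jet_norm_mult by simp
  also have "\<dots> = (1 + ?e) * jet_norm b \<rho> ?P + ?e" by (simp add: algebra_simps)
  also have "\<dots> \<le> (1 + ?e) * (exp ?s - 1) + ?e"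
    using insert.IH e by (intro add_right_mono mult_left_mono) auto
  also have "\<dots> = (1 + ?e) * exp ?s - 1" by (simp add: algebra_simps)
  also have "\<dots> \<le> exp ?e * exp ?s - 1" using exp_ge_add_one_self[of ?e] by (intro diff_right_mono mult_right_mono) auto
  finally show ?case using insert by (simp add: exp_add[symmetric])
qed (simp_all add: jet_norm_def)

lemma jet_norm_exp: "jet_norm b \<rho> (fps_exp c) \<le> exp (norm c * \<rho>)"
proof -
  have "jet_norm b \<rho> (fps_exp c) = (\<Sum>r<b. (norm c * \<rho>) ^ r / fact r)"
    unfolding jet_norm_def by (intro sum.cong) (auto simp: norm_divide norm_power power_mult_distrib)
  also have "\<dots> = (\<Sum>r<b. (norm c * \<rho>) ^ r /\<^sub>R fact r)" by (simp add: divide_inverse mult.commute)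
  also have "\<dots> \<le> (\<Sum>r. (norm c * \<rho>) ^ r /\<^sub>R fact r)"
    using \<rho> summable_exp_generic[of "norm c * \<rho>"] by (intro sum_le_suminf) auto
  finally show ?thesis by (simp add: exp_def)
qed

lemma norm_nth_le_jet_norm: "r < b \<Longrightarrow> norm (fps_nth A r) * \<rho> ^ r \<le> jet_norm b \<rho> A"
  unfolding jet_norm_def using \<rho>
  by (intro member_le_sum[of r "{..<b}" "\<lambda>r. norm (fps_nth A r) * \<rho> ^ r"]) auto

end

section \<open>Tauberian mixtures as functionals on power series\<close>

text \<open>Multiplication by \<open>(s - s\<^sub>0)\<^sup>b / s\<close> turns the germs of the \<open>D\<^sub>l\<close> into power series \<open>G\<^sub>l\<close>;
  residues then become coefficients of index \<open>b - 1\<close>, and \<open>X powr s\<close> contributes the factor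
  \<open>exp (t ln X)\<close>.\<close>

lemma mixture_power_series:
  assumes T: "tauberian_mixture \<T>"
  obtains G :: "'l \<Rightarrow> complex fps" where
    "fps_nth (\<Sum>l\<in>params \<T>. G l) 0 \<noteq> 0"
    "\<And>f F X. X > 0 \<Longrightarrow>
       (\<And>l. l \<in> params \<T> \<Longrightarrow> (\<lambda>w. f l (of_real (abscissa \<T>) + w)) has_fps_expansion F l) \<Longrightarrow>
       residue (\<lambda>s. (\<Sum>l\<in>params \<T>. f l s * dseries \<T> l s) * of_real X powr s / s) (of_real (abscissa \<T>))
         = of_real X powr of_real (abscissa \<T>) *
           fps_nth ((\<Sum>l\<in>params \<T>. F l * G l) * fps_exp (of_real (ln X))) (pole_order \<T> - 1)"
proof -
  define s0 :: complex where "s0 = of_real (abscissa \<T>)"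
  define b where "b = pole_order \<T>"
  define D where "D = dseries \<T>"
  define \<Lambda> where "\<Lambda> = params \<T>"
  have fin: "finite \<Lambda>" and s0: "abscissa \<T> > 0" and b: "b \<ge> 1"
    and mer: "\<And>l. l \<in> \<Lambda> \<Longrightarrow> D l meromorphic_on {s. Re s \<ge> abscissa \<T>}"
    and zo: "\<And>l. l \<in> \<Lambda> \<Longrightarrow> is_pole (D l) s0 \<Longrightarrow> - zorder (D l) s0 \<le> int b"
    and pole: "is_pole (\<lambda>s. \<Sum>l\<in>\<Lambda>. D l s) s0" "- zorder (\<lambda>s. \<Sum>l\<in>\<Lambda>. D l s) s0 = int b"
    using T unfolding tauberian_mixture_def Let_def s0_def b_def D_def \<Lambda>_def by auto
  have "\<exists>L. (\<lambda>w. D l (s0 + w)) has_laurent_expansion L" if "l \<in> \<Lambda>" for l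
    using mer[OF that] unfolding meromorphic_on_def by (auto simp: s0_def)
  then obtain L where L: "\<And>l. l \<in> \<Lambda> \<Longrightarrow> (\<lambda>w. D l (s0 + w)) has_laurent_expansion L l" by metis
  define H where "H l = fls_regpart (fls_shift (- int b) (L l))" for l
  have LH: "L l = fls_shift (int b) (fps_to_fls (H l))" if l: "l \<in> \<Lambda>" for l
  proof -
    have "fls_subdegree (fls_shift (- int b) (L l)) \<ge> 0"
    proof (cases "L l = 0")
      case False
      have "fls_subdegree (L l) \<ge> - int b"
      proof (cases "is_pole (D l) s0")
        case True
        then show ?thesis using zo[OF l True] has_laurent_expansion_zorder[OF L[OF l] False] by simp
      next
        case npole: False
        then have "\<not> fls_subdegree (L l) < 0" using is_pole_fls_subdegree_iff[OF L[OF l]] by simp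
        then show ?thesis by linarith
      qed
      then show ?thesis using False by simp
    qed simp
    then show ?thesis unfolding H_def by (simp add: fls_regpart_to_fls_trivial)
  qed
  define K where "K = fps_expansion (\<lambda>s::complex. 1 / s) s0"
  have s0': "s0 \<noteq> 0" using s0 by (simp add: s0_def)
  have K: "(\<lambda>w. 1 / (s0 + w)) has_fps_expansion K"
    unfolding K_def using s0' by (intro analytic_at_imp_has_fps_expansion analytic_intros) auto
  have K0: "fps_nth K 0 \<noteq> 0" using s0' by (simp add: K_def fps_expansion_def)
  define G where "G l = H l * K" for l
  show ?thesis
  proof (rule that[of G])
    have "(\<lambda>w. \<Sum>l\<in>\<Lambda>. D l (s0 + w)) has_laurent_expansion (\<Sum>l\<in>\<Lambda>. L l)"
      by (intro laurent_expansion_intros L)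
    then have LS: "(\<lambda>w. (\<lambda>s. \<Sum>l\<in>\<Lambda>. D l s) (s0 + w)) has_laurent_expansion (\<Sum>l\<in>\<Lambda>. L l)" by simp
    have "fls_subdegree (\<Sum>l\<in>\<Lambda>. L l) < 0" using pole(1) is_pole_fls_subdegree_iff[OF LS] by simp
    then have nz: "(\<Sum>l\<in>\<Lambda>. L l) \<noteq> 0" by auto
    then have sd: "fls_subdegree (\<Sum>l\<in>\<Lambda>. L l) = - int b"
      using has_laurent_expansion_zorder[OF LS] pole(2) by simp
    have "fls_nth (\<Sum>l\<in>\<Lambda>. L l) (- int b) \<noteq> 0" using nz sd by (metis nth_fls_subdegree_nonzero)
    moreover have "fls_nth (\<Sum>l\<in>\<Lambda>. L l) (- int b) = fps_nth (\<Sum>l\<in>\<Lambda>. H l) 0"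
      by (simp add: fls_nth_sum fps_sum_nth LH)
    moreover have "(\<Sum>l\<in>\<Lambda>. G l) = (\<Sum>l\<in>\<Lambda>. H l) * K" by (simp add: G_def sum_distrib_right)
    ultimately have "fps_nth (\<Sum>l\<in>\<Lambda>. G l) 0 \<noteq> 0" using K0 by simp
    then show "fps_nth (\<Sum>l\<in>params \<T>. G l) 0 \<noteq> 0" by (simp add: \<Lambda>_def)
  next
    fix f :: "'l \<Rightarrow> complex \<Rightarrow> complex" and F and X :: real
    assume X: "X > 0" and "\<And>l. l \<in> params \<T> \<Longrightarrow> (\<lambda>w. f l (of_real (abscissa \<T>) + w)) has_fps_expansion F l"
    then have F: "\<And>l. l \<in> \<Lambda> \<Longrightarrow> (\<lambda>w. f l (s0 + w)) has_fps_expansion F l" by (simp add: s0_def \<Lambda>_def)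
    let ?E = "fps_const (of_real X powr s0) * fps_exp (of_real (ln X)) :: complex fps"
    have "(\<lambda>w. of_real X powr s0 * exp (of_real (ln X) * w)) has_fps_expansion ?E"
      by (intro fps_expansion_intros)
    also have "(\<lambda>w. of_real X powr s0 * exp (of_real (ln X) * w)) = (\<lambda>w. of_real X powr (s0 + w))"
      using X by (auto simp: powr_def exp_add[symmetric] algebra_simps Ln_of_real)
    finally have E: "(\<lambda>w. of_real X powr (s0 + w)) has_laurent_expansion fps_to_fls ?E"
      by (rule has_laurent_expansion_fps)
    have "(\<lambda>w. (\<Sum>l\<in>\<Lambda>. f l (s0 + w) * D l (s0 + w)) * of_real X powr (s0 + w) * (1 / (s0 + w)))
      has_laurent_expansion (\<Sum>l\<in>\<Lambda>. fps_to_fls (F l) * L l) * fps_to_fls ?E * fps_to_fls K"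
      by (intro laurent_expansion_intros has_laurent_expansion_fps F L E K)
    then have "(\<lambda>w. (\<lambda>s. (\<Sum>l\<in>\<Lambda>. f l s * D l s) * of_real X powr s / s) (s0 + w))
      has_laurent_expansion (\<Sum>l\<in>\<Lambda>. fps_to_fls (F l) * L l) * fps_to_fls ?E * fps_to_fls K" by simp
    then have "residue (\<lambda>s. (\<Sum>l\<in>\<Lambda>. f l s * D l s) * of_real X powr s / s) s0
      = fls_residue ((\<Sum>l\<in>\<Lambda>. fps_to_fls (F l) * L l) * fps_to_fls ?E * fps_to_fls K)"
      by (rule has_laurent_expansion_residue)
    also have "(\<Sum>l\<in>\<Lambda>. fps_to_fls (F l) * L l) = fls_shift (int b) (fps_to_fls (\<Sum>l\<in>\<Lambda>. F l * H l))"
    proof -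
      have "(\<Sum>l\<in>\<Lambda>. fps_to_fls (F l) * L l) = (\<Sum>l\<in>\<Lambda>. fls_shift (int b) (fps_to_fls (F l * H l)))"
        by (intro sum.cong refl) (simp add: LH fls_times_fps_to_fls fls_shifted_times_simps)
      also have "\<dots> = fls_shift (int b) (fps_to_fls (\<Sum>l\<in>\<Lambda>. F l * H l))"
        using fin by (induction rule: finite_induct) (auto simp: fps_to_fls_plus)
      finally show ?thesis .
    qed
    also have "fls_shift (int b) (fps_to_fls (\<Sum>l\<in>\<Lambda>. F l * H l)) * fps_to_fls ?E * fps_to_fls K
       = fls_shift (int b) (fps_to_fls ((\<Sum>l\<in>\<Lambda>. F l * H l) * ?E * K))"
      by (simp add: fls_times_fps_to_fls fls_shifted_times_simps)
    also have "(\<Sum>l\<in>\<Lambda>. F l * H l) * ?E * K = fps_const (of_real X powr s0) * ((\<Sum>l\<in>\<Lambda>. F l * G l) * fps_exp (of_real (ln X)))"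
      by (simp add: G_def sum_distrib_left sum_distrib_right mult_ac)
    finally have "residue (\<lambda>s. (\<Sum>l\<in>\<Lambda>. f l s * D l s) * of_real X powr s / s) s0 =
       of_real X powr s0 * fps_nth ((\<Sum>l\<in>\<Lambda>. F l * G l) * fps_exp (of_real (ln X))) (b - 1)"
      using b by (simp add: nat_diff_distrib nat_add_distrib)
    then show "residue (\<lambda>s. (\<Sum>l\<in>params \<T>. f l s * dseries \<T> l s) * of_real X powr s / s) (of_real (abscissa \<T>))
         = of_real X powr of_real (abscissa \<T>) *
           fps_nth ((\<Sum>l\<in>params \<T>. F l * G l) * fps_exp (of_real (ln X))) (pole_order \<T> - 1)"
      by (simp add: s0_def b_def D_def \<Lambda>_def)
  qed
qed

text \<open>With \<open>x = ln X\<close> this is the mixture expectation of the tuple of germs with expansions \<open>F\<close>.\<close>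

definition jet_expectation ::
  "nat \<Rightarrow> 'l set \<Rightarrow> ('l \<Rightarrow> complex fps) \<Rightarrow> real \<Rightarrow> ('l \<Rightarrow> complex fps) \<Rightarrow> complex" where
  "jet_expectation b \<Lambda> G x F =
     fps_nth ((\<Sum>l\<in>\<Lambda>. F l * G l) * fps_exp (of_real x)) (b - 1) /
     fps_nth ((\<Sum>l\<in>\<Lambda>. G l) * fps_exp (of_real x)) (b - 1)"

lemma jet_expectation_sum:
  "jet_expectation b \<Lambda> G x (\<lambda>l. \<Sum>i\<in>I. fps_const (c i) * F i l) = (\<Sum>i\<in>I. c i * jet_expectation b \<Lambda> G x (F i))"
proof -
  have "(\<Sum>l\<in>\<Lambda>. (\<Sum>i\<in>I. fps_const (c i) * F i l) * G l) * fps_exp (of_real x)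
     = (\<Sum>i\<in>I. fps_const (c i) * ((\<Sum>l\<in>\<Lambda>. F i l * G l) * fps_exp (of_real x)))"
    unfolding sum_distrib_right sum_distrib_left by (subst sum.swap) (simp add: mult.assoc)
  then show ?thesis
    by (simp add: jet_expectation_def fps_sum_nth sum_divide_distrib)
qed

lemma jet_expectation_diff:
  "jet_expectation b \<Lambda> G x (\<lambda>l. F l - F' l) = jet_expectation b \<Lambda> G x F - jet_expectation b \<Lambda> G x F'"
  by (simp add: jet_expectation_def algebra_simps sum_subtractf diff_divide_distrib)

lemma jet_expectation_const:
  assumes "fps_nth ((\<Sum>l\<in>\<Lambda>. G l) * fps_exp (of_real x)) (b - 1) \<noteq> 0"
  shows "jet_expectation b \<Lambda> G x (\<lambda>_. fps_const c) = c"
  using assms by (simp add: jet_expectation_def sum_distrib_left[symmetric] mult.assoc)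

text \<open>The leading term in \<open>x\<close> of the coefficient comes from the top coefficient of the exponential.\<close>

lemma nth_mult_fps_exp_limit:
  fixes A :: "complex fps"
  shows "((\<lambda>x. fps_nth (A * fps_exp (of_real x)) n / of_real x ^ n) \<longlongrightarrow> fps_nth A 0 / fact n) at_top"
proof -
  have "((\<lambda>x. \<Sum>i=0..n. fps_nth A i / fact (n - i) * of_real (1 / x ^ i)) \<longlongrightarrow>
      (\<Sum>i=0..n. fps_nth A i / fact (n - i) * of_real (if i = 0 then 1 else 0))) at_top"
  proof (intro tendsto_intros)
    fix i
    show "((\<lambda>x::real. 1 / x ^ i) \<longlongrightarrow> (if i = 0 then 1 else 0)) at_top"
    proof (cases "i = 0")
      case False
      then have "filterlim (\<lambda>x::real. x ^ i) at_top at_top" by (intro filterlim_pow_at_top filterlim_ident) auto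
      then show ?thesis using False tendsto_inverse_0_at_top by (auto simp: divide_inverse)
    qed simp
  qed
  also have "(\<Sum>i=0..n. fps_nth A i / fact (n - i) * of_real (if i = 0 then 1 else 0))
     = (\<Sum>i=0..n. if i = 0 then fps_nth A 0 / fact n else 0)"
    by (intro sum.cong) auto
  also have "\<dots> = fps_nth A 0 / fact n" by simp
  finally show ?thesis
  proof (rule Lim_transform_eventually)
    show "\<forall>\<^sub>F x in at_top. (\<Sum>i=0..n. fps_nth A i / fact (n - i) * of_real (1 / x ^ i)) =
       fps_nth (A * fps_exp (of_real x)) n / of_real x ^ n"
      using eventually_gt_at_top[of 0]
    proof eventually_elim
      case (elim x)
      have "fps_nth A i / fact (n - i) * of_real (1 / x ^ i) =
         fps_nth A i * (of_real x ^ (n - i) / fact (n - i)) / of_real x ^ n" if "i \<le> n" for i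
      proof -
        have "(of_real x :: complex) ^ n = of_real x ^ i * of_real x ^ (n - i)"
          using that by (simp add: power_add[symmetric])
        then show ?thesis using elim by (simp add: field_simps)
      qed
      then show ?case by (simp add: fps_mult_nth sum_divide_distrib)
    qed
  qed
qed

text \<open>A parameter whose weight vanishes in the limit gains a factor \<open>1 / ln X\<close>: then \<open>G l\<close> has no
  constant term, so that its norm at radius \<open>1 / x\<close> is \<open>O (1 / x)\<close>.\<close>

lemma jet_expectation_bound:
  assumes fin: "finite \<Lambda>" and b: "b \<ge> 1" and G0: "fps_nth (\<Sum>l\<in>\<Lambda>. G l) 0 \<noteq> 0"
  shows "\<exists>K>0. \<forall>\<^sub>F x in at_top.
    fps_nth ((\<Sum>l\<in>\<Lambda>. G l) * fps_exp (of_real x)) (b - 1) \<noteq> 0 \<and>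
    (\<forall>F. norm (jet_expectation b \<Lambda> G x F) \<le>
      K * (\<Sum>l\<in>\<Lambda>. (if fps_nth (G l) 0 = 0 then 1 / x else 1) * jet_norm b (1 / x) (F l)))"
proof -
  \<comment> \<open>Half of the limiting absolute value of the denominator divided by \<open>x ^ (b - 1)\<close>.\<close>
  define g where "g = norm (fps_nth (\<Sum>l\<in>\<Lambda>. G l) 0 / fact (b - 1)) / 2"
  have g: "g > 0" using G0 by (simp add: g_def)
  define c where "c = Max (insert 1 ((\<lambda>l. jet_norm b 1 (G l)) ` \<Lambda>))"
  have c: "jet_norm b 1 (G l) \<le> c" if "l \<in> \<Lambda>" for l
    unfolding c_def using that fin by (intro Max_ge) auto
  have "((\<lambda>x. norm (fps_nth ((\<Sum>l\<in>\<Lambda>. G l) * fps_exp (of_real x)) (b - 1) / of_real x ^ (b - 1)))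
      \<longlongrightarrow> 2 * g) at_top"
    unfolding g_def using tendsto_norm[OF nth_mult_fps_exp_limit] by simp
  then have "\<forall>\<^sub>F x in at_top. norm (fps_nth ((\<Sum>l\<in>\<Lambda>. G l) * fps_exp (of_real x)) (b - 1) / of_real x ^ (b - 1)) > g"
    using g by (intro order_tendstoD) auto
  then have "\<forall>\<^sub>F x in at_top. fps_nth ((\<Sum>l\<in>\<Lambda>. G l) * fps_exp (of_real x)) (b - 1) \<noteq> 0 \<and>
    (\<forall>F. norm (jet_expectation b \<Lambda> G x F) \<le>
      (c * exp 1 / g) * (\<Sum>l\<in>\<Lambda>. (if fps_nth (G l) 0 = 0 then 1 / x else 1) * jet_norm b (1 / x) (F l)))"
    using eventually_ge_at_top[of 1]
  proof eventually_elim
    case (elim x)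
    let ?d = "fps_nth ((\<Sum>l\<in>\<Lambda>. G l) * fps_exp (of_real x)) (b - 1)"
    let ?n = "jet_norm b (1 / x)"
    have x: "x \<ge> 1" "1 / x \<ge> 0" "1 / x \<le> 1" using elim by auto
    have d: "norm ?d > g * x ^ (b - 1)" using elim x by (simp add: norm_divide norm_power field_simps)
    then have d0: "?d \<noteq> 0" using g x by (smt (verit) norm_zero zero_le_mult_iff zero_le_power)
    have nG: "?n (G l) \<le> c * (if fps_nth (G l) 0 = 0 then 1 / x else 1)" if l: "l \<in> \<Lambda>" for l
    proof -
      have "?n (G l) \<le> jet_norm b 1 (G l) * (if fps_nth (G l) 0 = 0 then 1 / x else 1)"
        unfolding jet_norm_def sum_distrib_right
      proof (rule sum_mono)
        fix r
        have "(1 / x) ^ r \<le> 1" using x by (intro power_le_one) auto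
        moreover have "(1 / x) ^ r \<le> 1 / x" if "r \<noteq> 0"
          using power_decreasing[of 1 r "1 / x"] x that by simp
        moreover have "r = 0 \<Longrightarrow> fps_nth (G l) 0 = 0 \<Longrightarrow> norm (fps_nth (G l) r) = 0" by simp
        ultimately show "norm (fps_nth (G l) r) * (1 / x) ^ r \<le>
           norm (fps_nth (G l) r) * 1 ^ r * (if fps_nth (G l) 0 = 0 then 1 / x else 1)"
          using mult_left_mono[of "(1 / x) ^ r" "1 / x" "norm (fps_nth (G l) r)"]
            mult_left_mono[of "(1 / x) ^ r" 1 "norm (fps_nth (G l) r)"]
          by (cases "r = 0") (auto simp del: power_one_over)
      qed
      also have "\<dots> \<le> c * (if fps_nth (G l) 0 = 0 then 1 / x else 1)"
        using c[OF l] x by (intro mult_right_mono) auto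
      finally show ?thesis .
    qed
    have "norm (jet_expectation b \<Lambda> G x F) \<le>
      (c * exp 1 / g) * (\<Sum>l\<in>\<Lambda>. (if fps_nth (G l) 0 = 0 then 1 / x else 1) * ?n (F l))" for F
    proof -
      let ?N = "(\<Sum>l\<in>\<Lambda>. F l * G l) * fps_exp (of_real x)"
      let ?S = "\<Sum>l\<in>\<Lambda>. (if fps_nth (G l) 0 = 0 then 1 / x else 1) * ?n (F l)"
      have sum_le: "?n (\<Sum>l\<in>M. F l * G l) \<le> (\<Sum>l\<in>M. ?n (F l * G l))" for M
      proof (induction M rule: infinite_finite_induct)
        case (insert l M)
        then show ?case using jet_norm_add[OF x(2), of b "F l * G l" "\<Sum>l\<in>M. F l * G l"] by simp
      qed (simp_all add: jet_norm_def)
      have "norm (fps_nth ?N (b - 1)) * (1 / x) ^ (b - 1) \<le> ?n ?N"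
        using b by (intro norm_nth_le_jet_norm x) auto
      also have "\<dots> \<le> ?n (\<Sum>l\<in>\<Lambda>. F l * G l) * ?n (fps_exp (of_real x))" by (rule jet_norm_mult[OF x(2)])
      also have "\<dots> \<le> (\<Sum>l\<in>\<Lambda>. c * ((if fps_nth (G l) 0 = 0 then 1 / x else 1) * ?n (F l))) * exp 1"
      proof (intro mult_mono)
        show "?n (\<Sum>l\<in>\<Lambda>. F l * G l) \<le> (\<Sum>l\<in>\<Lambda>. c * ((if fps_nth (G l) 0 = 0 then 1 / x else 1) * ?n (F l)))"
        proof (rule order.trans[OF sum_le sum_mono])
          fix l assume l: "l \<in> \<Lambda>"
          have "?n (F l * G l) \<le> ?n (F l) * ?n (G l)" by (rule jet_norm_mult[OF x(2)])
          also have "\<dots> \<le> ?n (F l) * (c * (if fps_nth (G l) 0 = 0 then 1 / x else 1))"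
            by (intro mult_left_mono nG l jet_norm_nonneg x)
          finally show "?n (F l * G l) \<le> c * ((if fps_nth (G l) 0 = 0 then 1 / x else 1) * ?n (F l))"
            by (simp add: mult_ac)
        qed
        show "?n (fps_exp (of_real x)) \<le> exp 1"
          using jet_norm_exp[OF x(2), of b "of_real x"] x by simp
        have "1 \<le> c" unfolding c_def using fin by (intro Max_ge) auto
        then show "0 \<le> (\<Sum>l\<in>\<Lambda>. c * ((if fps_nth (G l) 0 = 0 then 1 / x else 1) * ?n (F l)))"
          using x jet_norm_nonneg[OF x(2)] by (intro sum_nonneg mult_nonneg_nonneg) auto
      qed (use jet_norm_nonneg[OF x(2)] in auto)
      finally have N: "norm (fps_nth ?N (b - 1)) \<le> (c * exp 1 * ?S) * x ^ (b - 1)"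
        using x by (simp add: sum_distrib_left field_simps)
      have "norm (jet_expectation b \<Lambda> G x F) = norm (fps_nth ?N (b - 1)) / norm ?d"
        by (simp add: jet_expectation_def norm_divide)
      also have "\<dots> \<le> (c * exp 1 * ?S) * x ^ (b - 1) / (g * x ^ (b - 1))"
      proof (intro frac_le)
        show "0 \<le> (c * exp 1 * ?S) * x ^ (b - 1)" by (rule order.trans[OF norm_ge_zero N])
      qed (use d g x N in auto)
      also have "\<dots> = (c * exp 1 / g) * ?S" using x by simp
      finally show ?thesis .
    qed
    then show ?case using d0 by blast
  qed
  moreover have "c > 0" unfolding c_def using fin by (subst Max_gr_iff) auto
  ultimately show ?thesis using g by (intro exI[of _ "c * exp 1 / g"]) auto
qed

section \<open>The generating function of a mixture of Bernoulli variables\<close>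

text \<open>The analytic content of a well-mixed Bernoulli process: \<open>A\<close> is the set of admissible primes, \<open>N\<close>
  their norm, \<open>F p l\<close> the expansion of the germ of \<open>p\<close> and \<open>l\<close> at \<open>s\<^sub>0\<close>, and \<open>G l\<close> the power series of
  \<open>mixture_power_series\<close>. One constant \<open>C\<close> serves for all bounds.\<close>

locale jet_model =
  fixes A :: "'p set" and N :: "'p \<Rightarrow> real"
    and \<Lambda> :: "'l set" and b :: nat and G :: "'l \<Rightarrow> complex fps"
    and F :: "'p \<Rightarrow> 'l \<Rightarrow> complex fps" and C \<alpha> :: real
  assumes N_ge: "p \<in> A \<Longrightarrow> N p \<ge> 2"
    and fin_le: "finite {p\<in>A. N p \<le> Y}"
    and C: "C > 0"
    and mertens: "Y \<ge> 2 \<Longrightarrow> (\<Sum>p | p \<in> A \<and> N p \<le> Y. ln (N p) / N p) \<le> C * ln Y"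
    and powr_sum: "finite T \<Longrightarrow> T \<subseteq> A \<Longrightarrow> (\<Sum>p\<in>T. N p powr (- 1 - \<alpha>)) \<le> C"
    and square_sum: "finite T \<Longrightarrow> T \<subseteq> A \<Longrightarrow> (\<Sum>p\<in>T. N p powr (- 2)) \<le> C"
    and fin_\<Lambda>: "finite \<Lambda>" and b: "b \<ge> 1" and G0: "fps_nth (\<Sum>l\<in>\<Lambda>. G l) 0 \<noteq> 0"
    and jets: "l \<in> \<Lambda> \<Longrightarrow> p \<in> A \<Longrightarrow> r < b \<Longrightarrow> norm (fps_nth (F p l) r) \<le> C * (ln (N p) ^ r / N p)"
    and mixed: "l \<in> \<Lambda> \<Longrightarrow> l' \<in> \<Lambda> \<Longrightarrow> fps_nth (G l) 0 \<noteq> 0 \<Longrightarrow> fps_nth (G l') 0 \<noteq> 0 \<Longrightarrow> p \<in> A \<Longrightarrow>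
       norm (fps_nth (F p l) 0 - fps_nth (F p l') 0) \<le> C * N p powr (- 1 - \<alpha>)"
begin

abbreviation f :: "'p \<Rightarrow> 'l \<Rightarrow> complex" where "f p l \<equiv> fps_nth (F p l) 0"

abbreviation J :: "real \<Rightarrow> ('l \<Rightarrow> complex fps) \<Rightarrow> complex" where "J \<equiv> jet_expectation b \<Lambda> G"

text \<open>The parameters of nonzero limiting weight, since the limiting weight of \<open>l\<close> is proportional to the
  constant term of \<open>G l\<close>.\<close>

definition heavy :: "'l set" where "heavy = {l\<in>\<Lambda>. fps_nth (G l) 0 \<noteq> 0}"

lemma heavy_nonempty: "heavy \<noteq> {}"
proof
  assume "heavy = {}"
  then have "fps_nth (\<Sum>l\<in>\<Lambda>. G l) 0 = 0" unfolding fps_sum_nth by (intro sum.neutral) (auto simp: heavy_def)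
  then show False using G0 by simp
qed

lemma f_bound: "l \<in> \<Lambda> \<Longrightarrow> p \<in> A \<Longrightarrow> norm (f p l) \<le> C / N p"
  using jets[of l p 0] b by simp

lemma ln_N: "p \<in> A \<Longrightarrow> ln (N p) \<ge> 1/2"
proof -
  assume "p \<in> A"
  then have "ln (N p) \<ge> ln 2" using N_ge[of p] by simp
  then show ?thesis using ln2_ge_two_thirds by linarith
qed

text \<open>Of the factors \<open>(ln (N p) / x)\<^sup>r\<close> one is kept, since the sum of \<open>ln (N p) / N p\<close> has the order of \<open>ln X\<close>,
  and the others are bounded by 1.\<close>

lemma jet_tail:
  assumes "l \<in> \<Lambda>" "p \<in> A" "ln (N p) \<le> x"
  shows "jet_norm b (1 / x) (F p l - fps_const (f p l)) \<le> real b * C * (ln (N p) / (N p * x))"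
proof -
  have N: "N p \<ge> 2" "ln (N p) > 0" using N_ge[of p] ln_N[of p] assms by auto
  have x: "x > 0" using N assms by linarith
  have "norm (fps_nth (F p l - fps_const (f p l)) r) * (1 / x) ^ r \<le> C * (ln (N p) / (N p * x))" if r: "r < b" for r
  proof (cases "r = 0")
    case False
    then obtain q where q: "r = Suc q" by (cases r) auto
    have "norm (fps_nth (F p l - fps_const (f p l)) r) * (1 / x) ^ r \<le> C * (ln (N p) ^ r / N p) * (1 / x) ^ r"
      using jets[OF assms(1,2) r] False x by (intro mult_right_mono) auto
    also have "\<dots> = C * (ln (N p) / (N p * x)) * (ln (N p) / x) ^ q"
      using x N by (simp add: q field_simps)
    also have "\<dots> \<le> C * (ln (N p) / (N p * x)) * 1"
      using assms N x C by (intro mult_left_mono power_le_one) auto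
    finally show ?thesis by simp
  qed (use C N x in auto)
  then have "jet_norm b (1 / x) (F p l - fps_const (f p l)) \<le> (\<Sum>r<b. C * (ln (N p) / (N p * x)))"
    unfolding jet_norm_def by (intro sum_mono) auto
  then show ?thesis by simp
qed

lemma jet_norm_F:
  assumes "l \<in> \<Lambda>" "p \<in> A" "ln (N p) \<le> x"
  shows "jet_norm b (1 / x) (F p l) \<le> (1 + real b) * C / N p"
proof -
  have N: "N p \<ge> 2" "ln (N p) > 0" using N_ge[of p] ln_N[of p] assms by auto
  have x: "x > 0" using N assms by linarith
  have "jet_norm b (1 / x) (F p l) \<le> jet_norm b (1 / x) (F p l - fps_const (f p l)) + jet_norm b (1 / x) (fps_const (f p l))"
    using jet_norm_add[of "1 / x" b "F p l - fps_const (f p l)" "fps_const (f p l)"] x by simp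
  also have "\<dots> \<le> real b * C * (ln (N p) / (N p * x)) + C / N p"
    using jet_tail[OF assms] jet_norm_const[of "1 / x" b "f p l"] x b f_bound[OF assms(1,2)] by simp
  also have "ln (N p) / (N p * x) \<le> 1 / N p" using assms N x by (simp add: field_simps)
  then have "real b * C * (ln (N p) / (N p * x)) + C / N p \<le> real b * C * (1 / N p) + C / N p"
    using C by (intro add_right_mono mult_left_mono) auto
  finally show ?thesis by (simp add: algebra_simps add_divide_distrib)
qed

lemma reciprocal_sum:
  assumes "X \<ge> 10" "T \<subseteq> {p\<in>A. N p \<le> X}"
  shows "(\<Sum>p\<in>T. 1 / N p) \<le> 50 * C * ln (ln X)"
proof -
  have "(\<Sum>p\<in>T. 1 / N p) \<le> (\<Sum>p | p \<in> A \<and> N p \<le> X. 1 / N p)"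
  proof (rule sum_mono2)
    fix p assume "p \<in> {p \<in> A. N p \<le> X} - T"
    then show "0 \<le> 1 / N p" using N_ge[of p] by simp
  qed (use fin_le assms in auto)
  also have "\<dots> \<le> 50 * C * ln (ln X)"
    by (rule mertens_imp_reciprocal_sum_all[OF N_ge fin_le C mertens assms(1)])
  finally show ?thesis .
qed

lemma log_sum:
  assumes "X \<ge> 2" "T \<subseteq> {p\<in>A. N p \<le> X}"
  shows "(\<Sum>p\<in>T. ln (N p) / (N p * ln X)) \<le> C"
proof -
  have "(\<Sum>p\<in>T. ln (N p) / N p) \<le> (\<Sum>p | p \<in> A \<and> N p \<le> X. ln (N p) / N p)"
  proof (rule sum_mono2)
    fix p assume "p \<in> {p \<in> A. N p \<le> X} - T"
    then show "0 \<le> ln (N p) / N p" using N_ge[of p] by simp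
  qed (use fin_le assms in auto)
  also have "\<dots> \<le> C * ln X" by (rule mertens[OF assms(1)])
  finally have "(\<Sum>p\<in>T. ln (N p) / N p) / ln X \<le> C" using assms by (simp add: field_simps)
  then show ?thesis by (simp add: sum_divide_distrib)
qed

text \<open>The bounds for a single prime: parameters of zero limiting weight contribute \<open>1 / ln X\<close>,
  derivatives contribute \<open>ln (N p) / ln X\<close>, and the remaining values differ by
  \<open>N p powr (- 1 - \<alpha>)\<close>.\<close>

lemma expectation_single:
  assumes l0: "l0 \<in> heavy"
  shows "\<exists>K>0. \<forall>\<^sub>F x in at_top. \<forall>p\<in>A. ln (N p) \<le> x \<longrightarrow>
    norm (J x (F p) - f p l0) \<le> K * (N p powr (- 1 - \<alpha>) + ln (N p) / (N p * x))"
proof -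
  obtain K where K: "K > 0" "\<forall>\<^sub>F x in at_top.
    fps_nth ((\<Sum>l\<in>\<Lambda>. G l) * fps_exp (of_real x)) (b - 1) \<noteq> 0 \<and>
    (\<forall>F. norm (J x F) \<le> K * (\<Sum>l\<in>\<Lambda>. (if fps_nth (G l) 0 = 0 then 1 / x else 1) * jet_norm b (1 / x) (F l)))"
    using jet_expectation_bound[OF fin_\<Lambda> b G0] by blast
  define K' where "K' = K * real (card \<Lambda>) * ((2 * real b + 4) * C)"
  have "\<forall>\<^sub>F x in at_top. \<forall>p\<in>A. ln (N p) \<le> x \<longrightarrow>
    norm (J x (F p) - f p l0) \<le> K' * (N p powr (- 1 - \<alpha>) + ln (N p) / (N p * x))"
    using K(2)
  proof eventually_elim
    case (elim x)
    show ?case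
    proof (intro ballI impI)
      fix p assume p: "p \<in> A" "ln (N p) \<le> x"
      have N: "N p \<ge> 2" "ln (N p) \<ge> 1/2" using N_ge[of p] ln_N[of p] p by auto
      have x: "x > 0" using N p by linarith
      let ?R = "N p powr (- 1 - \<alpha>) + ln (N p) / (N p * x)"
      have L: "(if fps_nth (G l) 0 = 0 then 1 / x else 1) * jet_norm b (1 / x) (F p l - fps_const (f p l0)) \<le> (2 * real b + 4) * C * ?R"
        if l: "l \<in> \<Lambda>" for l
      proof (cases "fps_nth (G l) 0 = 0")
        case True
        have "jet_norm b (1 / x) (F p l - fps_const (f p l0)) \<le> jet_norm b (1 / x) (F p l) + jet_norm b (1 / x) (fps_const (f p l0))"
          using x by (intro jet_norm_diff) auto
        also have "\<dots> \<le> (1 + real b) * C / N p + C / N p"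
          using jet_norm_F[OF l p] f_bound[of l0 p] l0 p x b by (intro add_mono) (auto simp: jet_norm_const heavy_def)
        finally have "(1 / x) * jet_norm b (1 / x) (F p l - fps_const (f p l0)) \<le> (1 / x) * ((real b + 2) * C / N p)"
          using x by (intro mult_left_mono) (auto simp: algebra_simps add_divide_distrib)
        also have "\<dots> = (real b + 2) * C * (1 / (N p * x))" by simp
        also have "\<dots> \<le> (real b + 2) * C * ((2 * ln (N p)) / (N p * x))"
          using C N x by (intro mult_left_mono divide_right_mono) auto
        also have "\<dots> = (2 * real b + 4) * C * (ln (N p) / (N p * x))"
          by (simp add: algebra_simps add_divide_distrib)
        also have "\<dots> \<le> (2 * real b + 4) * C * ?R" using C by (intro mult_left_mono) auto
        finally show ?thesis using True by simp
      next
        case False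
        have x': "0 \<le> 1 / x" using x by simp
        have D: "F p l - fps_const (f p l0) = (F p l - fps_const (f p l)) + fps_const (f p l - f p l0)"
          by (simp add: algebra_simps)
        have "jet_norm b (1 / x) (F p l - fps_const (f p l0)) \<le> jet_norm b (1 / x) (F p l - fps_const (f p l)) + norm (f p l - f p l0)"
          unfolding D jet_norm_const[OF x' b, symmetric] by (rule jet_norm_add[OF x'])
        also have "\<dots> \<le> real b * C * (ln (N p) / (N p * x)) + C * N p powr (- 1 - \<alpha>)"
          using l0 l False p by (intro add_mono jet_tail mixed) (auto simp: heavy_def)
        also have "\<dots> \<le> (2 * real b + 4) * C * (ln (N p) / (N p * x)) + (2 * real b + 4) * C * N p powr (- 1 - \<alpha>)"
          using C N x by (intro add_mono mult_right_mono) (auto intro!: divide_nonneg_nonneg)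
        finally show ?thesis using False by (simp add: algebra_simps)
      qed
      have "J x (F p) - f p l0 = J x (\<lambda>l. F p l - fps_const (f p l0))"
        using elim by (subst jet_expectation_diff) (simp add: jet_expectation_const)
      also have "norm \<dots> \<le> K * (\<Sum>l\<in>\<Lambda>. (2 * real b + 4) * C * ?R)"
        using elim K(1) L by (intro order.trans[OF conjunct2[OF elim, rule_format]] mult_left_mono sum_mono) auto
      also have "\<dots> = K' * ?R" by (simp add: K'_def)
      finally show "norm (J x (F p) - f p l0) \<le> K' * ?R" .
    qed
  qed
  moreover have "K' > 0"
  proof -
    have "\<Lambda> \<noteq> {}" using l0 by (auto simp: heavy_def)
    then show ?thesis using fin_\<Lambda> K C by (simp add: K'_def card_gt_0_iff)
  qed
  ultimately show ?thesis by blast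
qed

text \<open>Each factor is \<open>exp w (1 + E)\<close> with a scalar \<open>w\<close> that collects the terms of first and second
  order, so that the product of the factors \<open>exp w\<close> is Gaussian and the factors \<open>1 + E\<close> are
  negligible.\<close>

lemma factor_estimate:
  fixes a :: complex
  assumes l: "l \<in> \<Lambda>" and p: "p \<in> A" "ln (N p) \<le> x" and a: "norm a \<le> h" and h: "h \<le> 1" "3 * h * C \<le> 1"
  defines "w \<equiv> f p l * (a + a\<^sup>2 / 2)"
  defines "E \<equiv> (1 + F p l * fps_const (exp a - 1)) * fps_const (exp (- w)) - 1"
  shows "jet_norm b (1 / x) E \<le> 30 * C\<^sup>2 * h\<^sup>2 * N p powr (- 2) + 2 * C * h ^ 3 * (1 / N p)
           + 9 * real b * C * h * (ln (N p) / (N p * x))"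
    and "1 + F p l * fps_const (exp a - 1) = fps_const (exp w) * (1 + E)"
proof -
  have N: "N p \<ge> 2" "ln (N p) \<ge> 1/2" using N_ge[of p] ln_N[of p] p by auto
  have x: "x > 0" using N p by linarith
  have x': "0 \<le> 1 / x" using x by simp
  have h0: "h \<ge> 0" using a norm_ge_zero order.trans by blast
  \<comment> \<open>All exponents below are at most 1 in absolute value; this is the source of the constants.\<close>
  have exp1: "exp (1::real) \<le> 3" by (rule exp_le)
  have Rea: "exp \<bar>Re a\<bar> \<le> 3"
  proof -
    have "\<bar>Re a\<bar> \<le> 1" using abs_Re_le_cmod[of a] a h by linarith
    then have "exp \<bar>Re a\<bar> \<le> exp 1" by simp
    then show ?thesis using exp1 by linarith
  qed
  define u where "u = exp a - 1"
  have u1: "norm u \<le> 3 * h"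
  proof -
    have "norm u \<le> exp \<bar>Re a\<bar> * norm a" using Taylor_exp[of a 0] by (simp add: u_def)
    also have "\<dots> \<le> 3 * h" using Rea a by (intro mult_mono) auto
    finally show ?thesis .
  qed
  have u3: "norm (u - (a + a\<^sup>2 / 2)) \<le> 2 * h ^ 3"
  proof -
    have "norm (u - (a + a\<^sup>2 / 2)) \<le> exp \<bar>Re a\<bar> * norm a ^ 3 / 2"
      using Taylor_exp[of a 2] by (simp add: u_def eval_nat_numeral algebra_simps)
    also have "\<dots> \<le> 3 * h ^ 3 / 2" using Rea a by (intro divide_right_mono mult_mono power_mono) auto
    also have "\<dots> \<le> 2 * h ^ 3" using h0 by simp
    finally show ?thesis .
  qed
  have fb: "norm (f p l) \<le> C / N p" by (rule f_bound[OF l p(1)])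
  have CN: "C / N p \<le> C" using N C by (simp add: field_simps)
  have aq: "norm (a + a\<^sup>2 / 2) \<le> 2 * h"
  proof -
    have "norm (a + a\<^sup>2 / 2) \<le> norm a + norm a ^ 2 / 2" using norm_triangle_ineq[of a "a\<^sup>2 / 2"] by (simp add: norm_power)
    also have "norm a ^ 2 \<le> h * 1" unfolding power2_eq_square using a h h0 by (intro mult_mono) auto
    finally show ?thesis using a h0 by simp
  qed
  have w: "norm w \<le> 2 * h * norm (f p l)" unfolding w_def norm_mult using mult_left_mono[OF aq, of "norm (f p l)"] by (simp add: mult_ac)
  have w1: "norm w \<le> 1"
  proof -
    have "2 * h * norm (f p l) \<le> 3 * h * C" using fb CN h0 by (intro mult_mono) auto
    then show ?thesis using w h by linarith
  qed
  define y where "y = f p l * u"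
  have y: "norm y \<le> 3 * h * norm (f p l)" unfolding y_def norm_mult using mult_left_mono[OF u1, of "norm (f p l)"] by (simp add: mult_ac)
  have y1: "norm y \<le> 1"
  proof -
    have "3 * h * norm (f p l) \<le> 3 * h * C" using fb CN h0 by (intro mult_mono) auto
    then show ?thesis using y h by linarith
  qed
  have yw: "norm (y - w) \<le> 2 * h ^ 3 * norm (f p l)"
  proof -
    have "y - w = f p l * (u - (a + a\<^sup>2 / 2))" by (simp add: y_def w_def algebra_simps)
    then show ?thesis using mult_left_mono[OF u3, of "norm (f p l)"] by (simp add: norm_mult mult_ac)
  qed
  have Rew: "exp \<bar>Re w\<bar> \<le> 3"
  proof -
    have "\<bar>Re w\<bar> \<le> 1" using abs_Re_le_cmod[of w] w1 by linarith
    then have "exp \<bar>Re w\<bar> \<le> exp 1" by simp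
    then show ?thesis using exp1 by linarith
  qed
  have ew: "norm (exp (- w) - 1 + w) \<le> 3 * norm w ^ 2"
  proof -
    have "norm (exp (- w) - 1 + w) \<le> exp \<bar>Re w\<bar> * norm w ^ 2"
      using Taylor_exp[of "- w" 1] by (simp add: algebra_simps power2_eq_square)
    then show ?thesis using mult_right_mono[OF Rew, of "norm w ^ 2"] by simp
  qed
  have expw: "norm (exp (- w)) \<le> 3"
  proof -
    have "norm (exp (- w)) = exp (- Re w)" by simp
    moreover have "exp (- Re w) \<le> exp \<bar>Re w\<bar>" unfolding exp_le_cancel_iff by simp
    ultimately show ?thesis using Rew by linarith
  qed
  have scalar: "norm ((1 + y) * exp (- w) - 1) \<le> 30 * h\<^sup>2 * norm (f p l) ^ 2 + 2 * h ^ 3 * norm (f p l)"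
  proof -
    have tri: "norm (r + s - t) \<le> norm r + norm s + norm t" for r s t :: complex
      using norm_triangle_ineq4[of "r + s" t] norm_triangle_ineq[of r s] by linarith
    have "(1 + y) * exp (- w) - 1 = (1 + y) * (exp (- w) - 1 + w) + (y - w) - y * w"
      by (simp add: algebra_simps)
    then have "norm ((1 + y) * exp (- w) - 1) \<le> norm ((1 + y) * (exp (- w) - 1 + w)) + norm (y - w) + norm (y * w)"
      by (simp only: tri)
    also have "norm ((1 + y) * (exp (- w) - 1 + w)) \<le> 2 * (3 * (2 * h * norm (f p l)) ^ 2)"
      unfolding norm_mult
    proof (intro mult_mono)
      show "norm (1 + y) \<le> 2" using norm_triangle_ineq[of 1 y] y1 by simp
      show "norm (exp (- w) - 1 + w) \<le> 3 * (2 * h * norm (f p l)) ^ 2"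
        using ew power_mono[OF w, of 2] by simp
    qed auto
    also have "norm (y * w) \<le> (3 * h * norm (f p l)) * (2 * h * norm (f p l))"
      unfolding norm_mult using y w h0 by (intro mult_mono) auto
    finally show ?thesis using yw by (simp add: power2_eq_square algebra_simps)
  qed
  have E: "E = fps_const ((1 + y) * exp (- w) - 1) + fps_const (u * exp (- w)) * (F p l - fps_const (f p l))"
    unfolding E_def y_def u_def[symmetric]
    by (simp add: algebra_simps flip: fps_const_mult fps_const_add fps_const_sub)
  have "jet_norm b (1 / x) E \<le> norm ((1 + y) * exp (- w) - 1) + norm (u * exp (- w)) * jet_norm b (1 / x) (F p l - fps_const (f p l))"
    unfolding E jet_norm_cmult[OF x', symmetric] unfolding jet_norm_const[OF x' b, symmetric]
    by (rule jet_norm_add[OF x'])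
  also have "\<dots> \<le> (30 * h\<^sup>2 * norm (f p l) ^ 2 + 2 * h ^ 3 * norm (f p l)) + (3 * h * 3) * (real b * C * (ln (N p) / (N p * x)))"
  proof (intro add_mono scalar mult_mono jet_tail l p)
    show "norm (u * exp (- w)) \<le> 3 * h * 3" unfolding norm_mult using u1 expw h0 by (intro mult_mono) auto
    show "0 \<le> jet_norm b (1 / x) (F p l - fps_const (f p l))" using x by (intro jet_norm_nonneg) auto
  qed (use h0 in auto)
  also have "30 * h\<^sup>2 * norm (f p l) ^ 2 \<le> 30 * h\<^sup>2 * (C / N p) ^ 2"
    using fb by (intro mult_left_mono power_mono) auto
  also have "30 * h\<^sup>2 * (C / N p) ^ 2 = 30 * C\<^sup>2 * h\<^sup>2 * N p powr (- 2)"
    using N by (simp add: powr_minus powr_realpow[of "N p" 2, simplified] power_divide field_simps)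
  also have "2 * h ^ 3 * norm (f p l) \<le> 2 * h ^ 3 * (C / N p)" using fb h0 by (intro mult_left_mono) auto
  finally show "jet_norm b (1 / x) E \<le> 30 * C\<^sup>2 * h\<^sup>2 * N p powr (- 2) + 2 * C * h ^ 3 * (1 / N p)
           + 9 * real b * C * h * (ln (N p) / (N p * x))" by (simp add: mult_ac)
  have "fps_const (exp w) * (1 + E) = fps_const (exp w) * fps_const (exp (- w)) * (1 + F p l * fps_const (exp a - 1))"
    by (simp add: E_def mult_ac del: fps_const_mult)
  also have "fps_const (exp w) * fps_const (exp (- w)) = (1 :: complex fps)"
    by (simp add: exp_add[symmetric])
  finally show "1 + F p l * fps_const (exp a - 1) = fps_const (exp w) * (1 + E)" by simp
qed

end

lemma filterlim_ln_ln: "filterlim (\<lambda>X::real. ln (ln X)) at_top at_top"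
  by real_asymp

lemma eventually_ln_ln_ge_1: "\<forall>\<^sub>F X::real in at_top. 1 \<le> ln (ln X)"
  by real_asymp

lemma tendsto_over_ln_ln:
  fixes g :: "real \<Rightarrow> 'a::real_normed_field"
  assumes "((\<lambda>X. g X / of_real (sqrt (ln (ln X)))) \<longlongrightarrow> 0) at_top"
  shows "((\<lambda>X. g X / of_real (ln (ln X))) \<longlongrightarrow> 0) at_top"
proof (rule Lim_null_comparison)
  show "\<forall>\<^sub>F X in at_top. norm (g X / of_real (ln (ln X))) \<le> norm (g X / of_real (sqrt (ln (ln X))))"
    using eventually_ln_ln_ge_1
  proof eventually_elim
    case (elim X)
    have "sqrt (ln (ln X)) * 1 \<le> sqrt (ln (ln X)) * sqrt (ln (ln X))" using elim by (intro mult_left_mono) auto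
    then have "sqrt (ln (ln X)) \<le> ln (ln X)" "0 < sqrt (ln (ln X))" using elim by auto
    then show ?case unfolding norm_divide norm_of_real by (intro divide_left_mono) auto
  qed
  show "((\<lambda>X. norm (g X / of_real (sqrt (ln (ln X))))) \<longlongrightarrow> 0) at_top"
    using assms by (rule tendsto_norm_zero)
qed

lemma tendsto_divide_sqrt_ln_ln:
  fixes g :: "real \<Rightarrow> 'a::real_normed_field"
  assumes "\<forall>\<^sub>F X in at_top. norm (g X) \<le> K"
  shows "((\<lambda>X. g X / of_real (sqrt (ln (ln X)))) \<longlongrightarrow> 0) at_top"
proof (rule Lim_null_comparison)
  show "\<forall>\<^sub>F X in at_top. norm (g X / of_real (sqrt (ln (ln X)))) \<le> K / sqrt (ln (ln X))"
    using assms eventually_ge_at_top[of "exp (exp 0)"]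
  proof eventually_elim
    case (elim X)
    have "ln (ln X) \<ge> 0" using elim by (metis exp_gt_zero exp_ge_zero ln_exp ln_mono one_le_exp_iff order.refl exp_zero less_le_trans zero_less_one)
    then show ?case using elim by (auto simp: norm_divide intro!: divide_right_mono)
  qed
  show "((\<lambda>X. K / sqrt (ln (ln X))) \<longlongrightarrow> 0) at_top" by real_asymp
qed

lemma bounded_mult_tendsto_zero:
  fixes g u :: "real \<Rightarrow> 'a::real_normed_algebra"
  assumes g: "\<And>X. norm (g X) \<le> K" and u: "(u \<longlongrightarrow> 0) at_top"
  shows "((\<lambda>X. g X * u X) \<longlongrightarrow> 0) at_top"
proof (rule Lim_null_comparison)
  have K: "0 \<le> K" using g[of 0] norm_ge_zero order.trans by blast
  show "\<forall>\<^sub>F X in at_top. norm (g X * u X) \<le> K * norm (u X)"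
    using g K by (intro always_eventually allI order.trans[OF norm_mult_ineq] mult_right_mono) auto
  show "((\<lambda>X. K * norm (u X)) \<longlongrightarrow> 0) at_top" using tendsto_mult[OF tendsto_const tendsto_norm[OF u], of K] by simp
qed

context jet_model
begin

text \<open>By well-mixedness all heavy parameters lead to the same sums up to a bounded error, so a single one
  may be used to state the asymptotics of mean and variance.\<close>

lemma heavy_sum_diff:
  assumes l: "l \<in> heavy" "l' \<in> heavy" and T: "finite T" "T \<subseteq> A"
    and g: "\<And>p. p \<in> A \<Longrightarrow> \<bar>g p\<bar> \<le> B" and B: "B \<ge> 0"
  shows "norm ((\<Sum>p\<in>T. of_real (g p) * f p l) - (\<Sum>p\<in>T. of_real (g p) * f p l')) \<le> B * (C * C)"
proof -
  have "(\<Sum>p\<in>T. of_real (g p) * f p l) - (\<Sum>p\<in>T. of_real (g p) * f p l') = (\<Sum>p\<in>T. of_real (g p) * (f p l - f p l'))"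
    by (simp add: sum_subtractf algebra_simps)
  also have "norm \<dots> \<le> (\<Sum>p\<in>T. B * (C * N p powr (- 1 - \<alpha>)))"
  proof (rule sum_norm_le)
    fix p assume "p \<in> T"
    then have p: "p \<in> A" using T by auto
    show "norm (of_real (g p) * (f p l - f p l')) \<le> B * (C * N p powr (- 1 - \<alpha>))"
      unfolding norm_mult using g[OF p] mixed[of l l' p] l p B by (intro mult_mono) (auto simp: heavy_def)
  qed
  also have "\<dots> = B * (C * (\<Sum>p\<in>T. N p powr (- 1 - \<alpha>)))" by (simp add: sum_distrib_left)
  also have "\<dots> \<le> B * (C * C)" using powr_sum[OF T] B C by (intro mult_left_mono) auto
  finally show ?thesis .
qed

end

text \<open>The sum of \<open>\<omega> p\<close> over a set \<open>T X\<close> of primes, centred at \<open>M X\<close>; the last two hypotheses say that \<open>M X\<close>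
  and \<open>V ln ln X\<close> are its mean and variance to the precision that the limit law needs.\<close>

locale truncated_sum = jet_model A N \<Lambda> b G F C \<alpha>
  for A :: "'p set" and N :: "'p \<Rightarrow> real"
    and \<Lambda> :: "'l set" and b :: nat and G :: "'l \<Rightarrow> complex fps"
    and F :: "'p \<Rightarrow> 'l \<Rightarrow> complex fps" and C \<alpha> :: real +
  fixes T :: "real \<Rightarrow> 'p set" and \<omega> :: "'p \<Rightarrow> real" and M :: "real \<Rightarrow> real" and B V :: real and l0 :: 'l
  assumes T: "T X \<subseteq> {p\<in>A. N p \<le> X}"
    and \<omega>: "p \<in> A \<Longrightarrow> \<bar>\<omega> p\<bar> \<le> B" and B: "B > 0" and V: "V > 0"
    and l0: "l0 \<in> heavy"
    and mean: "((\<lambda>X. ((\<Sum>p\<in>T X. of_real (\<omega> p) * f p l0) - of_real (M X)) / of_real (sqrt (ln (ln X)))) \<longlongrightarrow> 0) at_top"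
    and var: "((\<lambda>X. (\<Sum>p\<in>T X. of_real ((\<omega> p)\<^sup>2) * f p l0) / of_real (ln (ln X))) \<longlongrightarrow> of_real V) at_top"
begin

lemma finite_T: "finite (T X)"
  using T fin_le by (rule finite_subset)

definition \<sigma> :: "real \<Rightarrow> real" where "\<sigma> X = sqrt (V * ln (ln X))"

lemma mean_heavy:
  assumes l: "l \<in> heavy"
  shows "((\<lambda>X. ((\<Sum>p\<in>T X. of_real (\<omega> p) * f p l) - of_real (M X)) / of_real (sqrt (ln (ln X)))) \<longlongrightarrow> 0) at_top"
proof -
  have "((\<lambda>X. ((\<Sum>p\<in>T X. of_real (\<omega> p) * f p l) - (\<Sum>p\<in>T X. of_real (\<omega> p) * f p l0)) / of_real (sqrt (ln (ln X)))) \<longlongrightarrow> 0) at_top"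
    using heavy_sum_diff[OF l l0 finite_T, of _ \<omega> B] T \<omega> B
    by (intro tendsto_divide_sqrt_ln_ln always_eventually) (auto simp: subset_iff)
  from tendsto_add[OF this mean] show ?thesis by (simp add: diff_divide_distrib)
qed

lemma var_heavy:
  assumes l: "l \<in> heavy"
  shows "((\<lambda>X. (\<Sum>p\<in>T X. of_real ((\<omega> p)\<^sup>2) * f p l) / of_real (ln (ln X))) \<longlongrightarrow> of_real V) at_top"
proof -
  let ?D = "\<lambda>X. (\<Sum>p\<in>T X. of_real ((\<omega> p)\<^sup>2) * f p l) - (\<Sum>p\<in>T X. of_real ((\<omega> p)\<^sup>2) * f p l0)"
  have "((\<lambda>X. ?D X / of_real (sqrt (ln (ln X)))) \<longlongrightarrow> 0) at_top"
  proof (intro tendsto_divide_sqrt_ln_ln always_eventually allI)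
    fix X
    show "norm ((\<Sum>p\<in>T X. of_real ((\<omega> p)\<^sup>2) * f p l) - (\<Sum>p\<in>T X. of_real ((\<omega> p)\<^sup>2) * f p l0)) \<le> B\<^sup>2 * (C * C)"
    proof (rule heavy_sum_diff[OF l l0 finite_T])
      show "\<bar>(\<omega> p)\<^sup>2\<bar> \<le> B\<^sup>2" if "p \<in> A" for p
        using power_mono[OF \<omega>[OF that], of 2] by simp
    qed (use T in auto)
  qed
  then have "((\<lambda>X. ?D X / of_real (ln (ln X))) \<longlongrightarrow> 0) at_top" by (rule tendsto_over_ln_ln)
  from tendsto_add[OF this var] show ?thesis by (simp add: diff_divide_distrib)
qed

lemma mean_bound: "\<forall>\<^sub>F X in at_top. \<bar>M X\<bar> \<le> (1 + 50 * B * C * C) * ln (ln X)"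
proof -
  have l: "l0 \<in> \<Lambda>" using l0 by (simp add: heavy_def)
  have "\<forall>\<^sub>F X in at_top. dist (((\<Sum>p\<in>T X. of_real (\<omega> p) * f p l0) - of_real (M X)) / of_real (sqrt (ln (ln X)))) 0 < 1"
    using mean by (intro tendstoD) auto
  then show ?thesis
    using eventually_ge_at_top[of 10] eventually_ln_ln_ge_1
  proof eventually_elim
    case (elim X)
    define y where "y = ln (ln X)"
    have y: "y \<ge> 1" using elim by (simp add: y_def)
    then have sy: "sqrt y > 0" "sqrt y \<le> y" by (auto intro: real_le_lsqrt simp: power2_eq_square)
    let ?S = "\<Sum>p\<in>T X. of_real (\<omega> p) * f p l0"
    have "norm ?S \<le> (\<Sum>p\<in>T X. B * (C * (1 / N p)))"
    proof (rule sum_norm_le)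
      fix p assume "p \<in> T X"
      then have p: "p \<in> A" using T by auto
      show "norm (of_real (\<omega> p) * f p l0) \<le> B * (C * (1 / N p))"
        unfolding norm_mult norm_of_real using \<omega>[OF p] B f_bound[OF l p] by (intro mult_mono) auto
    qed
    also have "\<dots> = B * C * (\<Sum>p\<in>T X. 1 / N p)" by (simp add: sum_distrib_left mult.assoc)
    also have "\<dots> \<le> B * C * (50 * C * y)"
      unfolding y_def using B C elim T by (intro mult_left_mono reciprocal_sum) auto
    finally have 1: "norm ?S \<le> 50 * B * C * C * y" by (simp add: mult_ac)
    have "norm (?S - of_real (M X)) / sqrt y < 1" using elim(1) sy(1) unfolding y_def by (simp add: norm_divide)
    then have "norm (?S - of_real (M X)) < sqrt y" using sy(1) by (simp add: divide_less_eq_1_pos)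
    moreover have "norm (complex_of_real (M X)) \<le> norm ?S + norm (?S - of_real (M X))"
      using norm_triangle_sub[of "complex_of_real (M X)" ?S] by (simp add: norm_minus_commute)
    ultimately have "\<bar>M X\<bar> \<le> 50 * B * C * C * y + y" using 1 sy by simp
    then show ?case by (simp add: y_def algebra_simps)
  qed
qed

text \<open>The formal generating function \<open>E exp (\<zeta> Y)\<close> for the normalized sum \<open>Y\<close> of independent Bernoulli
  variables with success probabilities \<open>F p l\<close>. The argument \<open>\<zeta>\<close> may depend on \<open>X\<close>; limits along
  arbitrary bounded \<open>\<zeta>\<close> are uniform limits.\<close>

definition \<Phi> :: "(real \<Rightarrow> complex) \<Rightarrow> real \<Rightarrow> 'l \<Rightarrow> complex fps" where
  "\<Phi> \<zeta> X l = fps_const (exp (- \<zeta> X * of_real (M X / \<sigma> X))) *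
     (\<Prod>p\<in>T X. 1 + F p l * fps_const (exp (\<zeta> X * of_real (\<omega> p / \<sigma> X)) - 1))"

context
  fixes R :: real and \<zeta> :: "real \<Rightarrow> complex"
  assumes R: "R > 0" and \<zeta>: "norm (\<zeta> X) \<le> R"
begin

text \<open>A common bound for the exponents \<open>\<zeta> \<omega> p / \<sigma>\<close> of the individual factors.\<close>

definition h :: "real \<Rightarrow> real" where "h X = R * B / \<sigma> X"

lemma h_tendsto: "(h \<longlongrightarrow> 0) at_top"
proof -
  have "filterlim (\<lambda>X. sqrt (V * ln (ln X))) at_top at_top"
    using filterlim_ln_ln V
    by (intro filterlim_compose[OF sqrt_at_top] filterlim_tendsto_pos_mult_at_top[OF tendsto_const]) auto
  then show ?thesis unfolding h_def \<sigma>_def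
    by (intro tendsto_divide_0[OF tendsto_const]) (rule filterlim_at_top_imp_at_infinity)
qed

lemma eventually_regular:
  "\<forall>\<^sub>F X in at_top. X \<ge> 10 \<and> ln X \<ge> 1 \<and> ln (ln X) \<ge> 1 \<and> \<sigma> X > 0 \<and> 0 \<le> h X \<and> h X \<le> 1 \<and> 3 * h X * C \<le> 1 \<and>
     (h X)\<^sup>2 * ln (ln X) = (R * B)\<^sup>2 / V \<and> (\<forall>p\<in>T X. p \<in> A \<and> ln (N p) \<le> ln X \<and> norm (\<zeta> X * of_real (\<omega> p / \<sigma> X)) \<le> h X)"
proof -
  have "\<forall>\<^sub>F X in at_top. h X < min 1 (1 / (3 * C))"
    using h_tendsto C by (intro order_tendstoD) auto
  moreover have "\<forall>\<^sub>F X::real in at_top. ln X \<ge> 1" by real_asymp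
  moreover have "\<forall>\<^sub>F X::real in at_top. ln (ln X) \<ge> 1" by real_asymp
  ultimately show ?thesis using eventually_ge_at_top[of 10]
  proof eventually_elim
    case (elim X)
    have "ln (ln X) > 0" using elim by linarith
    then have "V * ln (ln X) > 0" by (rule mult_pos_pos[OF V])
    then have sg: "\<sigma> X > 0" by (simp add: \<sigma>_def)
    then have h0: "h X \<ge> 0" using R B by (simp add: h_def)
    have "3 * h X * C \<le> 1" using elim C by (simp add: field_simps)
    moreover have "(h X)\<^sup>2 * ln (ln X) = (R * B)\<^sup>2 / V"
      using \<open>ln (ln X) > 0\<close> V by (simp add: h_def \<sigma>_def power_divide)
    moreover have "p \<in> A \<and> ln (N p) \<le> ln X \<and> norm (\<zeta> X * of_real (\<omega> p / \<sigma> X)) \<le> h X" if p: "p \<in> T X" for p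
    proof -
      have pA: "p \<in> A" "N p \<le> X" using T p by auto
      have "norm (\<zeta> X * of_real (\<omega> p / \<sigma> X)) \<le> R * (B / \<sigma> X)"
        unfolding norm_mult norm_of_real using \<zeta> \<omega>[OF pA(1)] sg R B
        by (intro mult_mono) (auto simp: abs_divide intro!: divide_right_mono)
      then show ?thesis using pA N_ge[OF pA(1)] by (simp add: h_def)
    qed
    ultimately show ?case using elim sg h0 by auto
  qed
qed

text \<open>The factors \<open>exp w\<close> multiply up to the exponential of the centred first and second order terms, which
  is asymptotically \<open>exp (\<zeta>\<^sup>2 / 2)\<close>. The factors \<open>1 + E\<close> multiply up to \<open>1 + o (1)\<close>, as the norms
  of the \<open>E\<close> have a sum \<open>S\<close> that tends to 0: the bound \<open>h\<close> is of order \<open>1 / sqrt (ln ln X)\<close>, and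
  \<open>h\<^sup>3 ln ln X\<close> tends to 0.\<close>

lemma heavy_generating:
  assumes l: "l \<in> heavy"
  shows "((\<lambda>X. jet_norm b (1 / ln X) (\<Phi> \<zeta> X l - fps_const (exp ((\<zeta> X)\<^sup>2 / 2)))) \<longlongrightarrow> 0) at_top"
proof -
  \<comment> \<open>\<open>S\<close> bounds the total size of the errors \<open>E\<close>, and \<open>\<delta>\<close> is the defect of the exponent from \<open>\<zeta>\<^sup>2 / 2\<close>.\<close>
  define S where "S X = 30 * C\<^sup>2 * (h X)\<^sup>2 * C + 2 * C * (h X * ((R * B)\<^sup>2 / V)) * (50 * C) + 9 * real b * C * h X * C" for X
  define \<delta> where "\<delta> X = \<zeta> X * of_real (1 / sqrt V) * (((\<Sum>p\<in>T X. of_real (\<omega> p) * f p l) - of_real (M X)) / of_real (sqrt (ln (ln X))))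
     + (\<zeta> X)\<^sup>2 / 2 * (of_real (1 / V) * ((\<Sum>p\<in>T X. of_real ((\<omega> p)\<^sup>2) * f p l) / of_real (ln (ln X))) - 1)" for X
  have S: "(S \<longlongrightarrow> 0) at_top"
  proof -
    have "(S \<longlongrightarrow> 30 * C\<^sup>2 * 0\<^sup>2 * C + 2 * C * (0 * ((R * B)\<^sup>2 / V)) * (50 * C) + 9 * real b * C * 0 * C) at_top"
      unfolding S_def by (intro tendsto_intros h_tendsto)
    then show ?thesis by simp
  qed
  have \<delta>: "(\<delta> \<longlongrightarrow> 0) at_top"
  proof -
    have 1: "((\<lambda>X. \<zeta> X * (of_real (1 / sqrt V) * (((\<Sum>p\<in>T X. of_real (\<omega> p) * f p l) - of_real (M X)) / of_real (sqrt (ln (ln X)))))) \<longlongrightarrow> 0) at_top"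
      using tendsto_mult_right_zero[OF mean_heavy[OF l], of "of_real (1 / sqrt V)"]
      by (rule bounded_mult_tendsto_zero[OF \<zeta>])
    have b2: "norm ((\<zeta> X)\<^sup>2 / 2) \<le> R\<^sup>2 / 2" for X using power_mono[OF \<zeta>, of X 2] by (simp add: norm_power)
    have "((\<lambda>X. of_real (1 / V) * ((\<Sum>p\<in>T X. of_real ((\<omega> p)\<^sup>2) * f p l) / of_real (ln (ln X))) - 1) \<longlongrightarrow> of_real (1 / V) * of_real V - 1) at_top"
      by (intro tendsto_intros var_heavy[OF l])
    then have "((\<lambda>X. of_real (1 / V) * ((\<Sum>p\<in>T X. of_real ((\<omega> p)\<^sup>2) * f p l) / of_real (ln (ln X))) - 1) \<longlongrightarrow> 0) at_top"
      using V by (simp flip: of_real_mult)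
    from tendsto_add_zero[OF 1 bounded_mult_tendsto_zero[OF b2 this]] show ?thesis
      unfolding \<delta>_def by (simp only: mult.assoc)
  qed
  let ?Q = "exp (R\<^sup>2 / 2)"
  have "\<forall>\<^sub>F X in at_top. norm (jet_norm b (1 / ln X) (\<Phi> \<zeta> X l - fps_const (exp ((\<zeta> X)\<^sup>2 / 2))))
      \<le> ?Q * norm (exp (\<delta> X)) * (exp (S X) - 1) + ?Q * norm (exp (\<delta> X) - 1)"
    using eventually_regular
  proof eventually_elim
    case (elim X)
    define x where "x = ln X"
    have x: "x \<ge> 1" "1 / x \<ge> 0" using elim by (auto simp: x_def)
    have l\<Lambda>: "l \<in> \<Lambda>" using l by (simp add: heavy_def)
    define a where "a p = \<zeta> X * of_real (\<omega> p / \<sigma> X)" for p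
    define w where "w p = f p l * (a p + (a p)\<^sup>2 / 2)" for p
    define E where "E p = (1 + F p l * fps_const (exp (a p) - 1)) * fps_const (exp (- w p)) - 1" for p
    have est: "jet_norm b (1 / x) (E p) \<le> 30 * C\<^sup>2 * (h X)\<^sup>2 * N p powr (- 2) + 2 * C * h X ^ 3 * (1 / N p)
           + 9 * real b * C * h X * (ln (N p) / (N p * x))"
      and fac: "1 + F p l * fps_const (exp (a p) - 1) = fps_const (exp (w p)) * (1 + E p)" if p: "p \<in> T X" for p
    proof -
      have *: "p \<in> A" "ln (N p) \<le> x" "norm (a p) \<le> h X" "h X \<le> 1" "3 * h X * C \<le> 1"
        using elim p by (auto simp: x_def a_def)
      from factor_estimate[OF l\<Lambda> *]
      show "jet_norm b (1 / x) (E p) \<le> 30 * C\<^sup>2 * (h X)\<^sup>2 * N p powr (- 2) + 2 * C * h X ^ 3 * (1 / N p)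
           + 9 * real b * C * h X * (ln (N p) / (N p * x))"
        and "1 + F p l * fps_const (exp (a p) - 1) = fps_const (exp (w p)) * (1 + E p)"
        by (simp_all add: E_def w_def)
    qed
    have "(\<Sum>p\<in>T X. jet_norm b (1 / x) (E p)) \<le> (\<Sum>p\<in>T X. 30 * C\<^sup>2 * (h X)\<^sup>2 * N p powr (- 2) + 2 * C * h X ^ 3 * (1 / N p)
           + 9 * real b * C * h X * (ln (N p) / (N p * x)))"
      by (rule sum_mono[OF est])
    also have "\<dots> = 30 * C\<^sup>2 * (h X)\<^sup>2 * (\<Sum>p\<in>T X. N p powr (- 2)) + 2 * C * h X ^ 3 * (\<Sum>p\<in>T X. 1 / N p)
           + 9 * real b * C * h X * (\<Sum>p\<in>T X. ln (N p) / (N p * x))"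
      by (simp only: sum.distrib sum_distrib_left)
    also have "\<dots> \<le> 30 * C\<^sup>2 * (h X)\<^sup>2 * C + 2 * C * h X ^ 3 * (50 * C * ln (ln X)) + 9 * real b * C * h X * C"
    proof (intro add_mono mult_left_mono)
      show "(\<Sum>p\<in>T X. N p powr (- 2)) \<le> C" using T by (intro square_sum finite_T) auto
      show "(\<Sum>p\<in>T X. 1 / N p) \<le> 50 * C * ln (ln X)" using elim T by (intro reciprocal_sum) auto
      show "(\<Sum>p\<in>T X. ln (N p) / (N p * x)) \<le> C" unfolding x_def using elim T by (intro log_sum) auto
    qed (use elim C in auto)
    also have "2 * C * h X ^ 3 * (50 * C * ln (ln X)) = 2 * C * (h X * ((h X)\<^sup>2 * ln (ln X))) * (50 * C)"
      by (simp add: power2_eq_square power3_eq_cube)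
    also have "(h X)\<^sup>2 * ln (ln X) = (R * B)\<^sup>2 / V" using elim by blast
    finally have sumE: "(\<Sum>p\<in>T X. jet_norm b (1 / x) (E p)) \<le> S X" by (simp add: S_def)
    define E0 where "E0 = exp ((\<zeta> X)\<^sup>2 / 2) * exp (\<delta> X)"
    have expo: "- \<zeta> X * of_real (M X / \<sigma> X) + (\<Sum>p\<in>T X. w p) = (\<zeta> X)\<^sup>2 / 2 + \<delta> X"
    proof -
      let ?r = "complex_of_real (sqrt V)" and ?y = "complex_of_real (sqrt (ln (ln X)))"
      have s: "complex_of_real (\<sigma> X) = ?r * ?y" using elim V by (simp add: \<sigma>_def real_sqrt_mult)
      have nz: "?r \<noteq> 0" "?y \<noteq> 0" using elim V by auto
      have sq: "complex_of_real V = ?r\<^sup>2" "complex_of_real (ln (ln X)) = ?y\<^sup>2"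
        using elim V by (simp_all flip: of_real_power)
      have "(\<Sum>p\<in>T X. w p) = \<zeta> X / of_real (\<sigma> X) * (\<Sum>p\<in>T X. of_real (\<omega> p) * f p l)
          + (\<zeta> X)\<^sup>2 / (2 * of_real (\<sigma> X) ^ 2) * (\<Sum>p\<in>T X. of_real ((\<omega> p)\<^sup>2) * f p l)"
        unfolding sum_distrib_left sum.distrib[symmetric] w_def a_def
        by (intro sum.cong refl) (simp add: field_simps power2_eq_square)
      moreover have "- z * (m / (r * y)) + (z / (r * y) * P + z\<^sup>2 / (2 * (r * y)\<^sup>2) * Q)
          = z\<^sup>2 / 2 + (z * (1 / r) * ((P - m) / y) + z\<^sup>2 / 2 * (1 / r\<^sup>2 * (Q / y\<^sup>2) - 1))"
        if "r \<noteq> 0" "y \<noteq> 0" for r y z m P Q :: complex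
        using that by (simp add: field_simps power2_eq_square)
      ultimately show ?thesis unfolding \<delta>_def of_real_divide s sq of_real_1 using nz by simp
    qed
    have "\<Phi> \<zeta> X l = fps_const (exp (- \<zeta> X * of_real (M X / \<sigma> X))) * (\<Prod>p\<in>T X. fps_const (exp (w p)) * (1 + E p))"
      unfolding \<Phi>_def a_def[symmetric] using fac by simp
    also have "\<dots> = fps_const (exp (- \<zeta> X * of_real (M X / \<sigma> X)) * exp (\<Sum>p\<in>T X. w p)) * (\<Prod>p\<in>T X. 1 + E p)"
    proof -
      have "(\<Prod>p\<in>T X. fps_const (exp (w p))) = fps_const (exp (\<Sum>p\<in>T X. w p))"
        using finite_T[of X] by (induction rule: finite_induct) (auto simp: exp_add)
      then show ?thesis by (simp add: prod.distrib mult.assoc[symmetric])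
    qed
    also have "exp (- \<zeta> X * of_real (M X / \<sigma> X)) * exp (\<Sum>p\<in>T X. w p) = E0"
      unfolding exp_add[symmetric] E0_def expo ..
    finally have "\<Phi> \<zeta> X l = fps_const E0 * (\<Prod>p\<in>T X. 1 + E p)" .
    then have "\<Phi> \<zeta> X l - fps_const (exp ((\<zeta> X)\<^sup>2 / 2)) = fps_const E0 * ((\<Prod>p\<in>T X. 1 + E p) - 1) + fps_const (E0 - exp ((\<zeta> X)\<^sup>2 / 2))"
      by (simp add: algebra_simps)
    then have "jet_norm b (1 / x) (\<Phi> \<zeta> X l - fps_const (exp ((\<zeta> X)\<^sup>2 / 2)))
       \<le> norm E0 * jet_norm b (1 / x) ((\<Prod>p\<in>T X. 1 + E p) - 1) + norm (E0 - exp ((\<zeta> X)\<^sup>2 / 2))"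
      using jet_norm_add[OF x(2), of b "fps_const E0 * ((\<Prod>p\<in>T X. 1 + E p) - 1)" "fps_const (E0 - exp ((\<zeta> X)\<^sup>2 / 2))"]
      by (simp only: jet_norm_cmult[OF x(2)] jet_norm_const[OF x(2) b])
    also have "\<dots> \<le> norm E0 * (exp (S X) - 1) + norm (E0 - exp ((\<zeta> X)\<^sup>2 / 2))"
    proof (intro add_right_mono mult_left_mono)
      have "jet_norm b (1 / x) ((\<Prod>p\<in>T X. 1 + E p) - 1) \<le> exp (\<Sum>p\<in>T X. jet_norm b (1 / x) (E p)) - 1"
        by (rule jet_norm_prod_one_plus[OF x(2) b])
      also have "\<dots> \<le> exp (S X) - 1" using sumE by simp
      finally show "jet_norm b (1 / x) ((\<Prod>p\<in>T X. 1 + E p) - 1) \<le> exp (S X) - 1" .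
    qed simp
    also have "E0 - exp ((\<zeta> X)\<^sup>2 / 2) = exp ((\<zeta> X)\<^sup>2 / 2) * (exp (\<delta> X) - 1)" by (simp add: E0_def algebra_simps)
    also have "norm E0 * (exp (S X) - 1) + norm (exp ((\<zeta> X)\<^sup>2 / 2) * (exp (\<delta> X) - 1))
       \<le> ?Q * norm (exp (\<delta> X)) * (exp (S X) - 1) + ?Q * norm (exp (\<delta> X) - 1)"
    proof -
      have "norm (exp ((\<zeta> X)\<^sup>2 / 2)) \<le> exp (norm ((\<zeta> X)\<^sup>2 / 2))" by (rule norm_exp)
      also have "norm ((\<zeta> X)\<^sup>2 / 2) \<le> R\<^sup>2 / 2" using power_mono[OF \<zeta>, of X 2] by (simp add: norm_power)
      finally have n: "norm (exp ((\<zeta> X)\<^sup>2 / 2)) \<le> ?Q" by (simp only: exp_le_cancel_iff)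
      have S0: "S X \<ge> 0"
        using sumE sum_nonneg[of "T X" "\<lambda>p. jet_norm b (1 / x) (E p)"] jet_norm_nonneg[OF x(2)] by force
      show ?thesis unfolding E0_def norm_mult
        using n S0 by (intro add_mono mult_right_mono) auto
    qed
    finally show ?case using jet_norm_nonneg[OF x(2), of b] by (simp add: x_def)
  qed
  moreover have "((\<lambda>X. ?Q * norm (exp (\<delta> X)) * (exp (S X) - 1) + ?Q * norm (exp (\<delta> X) - 1)) \<longlongrightarrow>
      ?Q * norm (exp (0::complex)) * (exp 0 - 1) + ?Q * norm (exp (0::complex) - 1)) at_top"
    by (intro tendsto_intros S \<delta>)
  moreover have "?Q * norm (exp (0::complex)) * (exp 0 - 1) + ?Q * norm (exp (0::complex) - 1) = 0" by simp
  ultimately show ?thesis by (simp only:) (rule Lim_null_comparison)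
qed

text \<open>The trivial bound \<open>exp (K sqrt (ln ln X))\<close> for the generating function is smaller than every positive power of
  \<open>ln X\<close>, so that the factor \<open>1 / ln X\<close> of a light parameter suppresses it.\<close>

lemma light_generating:
  assumes l: "l \<in> \<Lambda>"
  shows "((\<lambda>X. jet_norm b (1 / ln X) (\<Phi> \<zeta> X l) / ln X) \<longlongrightarrow> 0) at_top"
proof -
  define K where "K = R * (1 + 50 * B * C * C) / sqrt V + 150 * (1 + real b) * C * C * (R * B / sqrt V)"
  have K: "K > 0" unfolding K_def using R B C V by (intro add_pos_nonneg divide_pos_pos mult_pos_pos mult_nonneg_nonneg) (auto intro: add_pos_nonneg)
  from eventually_regular mean_bound have "\<forall>\<^sub>F X in at_top. norm (jet_norm b (1 / ln X) (\<Phi> \<zeta> X l) / ln X) \<le> exp (K * sqrt (ln (ln X))) / ln X"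
  proof eventually_elim
    case (elim X)
    define x where "x = ln X"
    define y where "y = ln (ln X)"
    have x: "x \<ge> 1" "1 / x \<ge> 0" and y: "y \<ge> 1" using elim by (auto simp: x_def y_def)
    have h0: "0 \<le> h X" "h X \<le> 1" using elim by auto
    have l0': "l0 \<in> \<Lambda>" using l0 by (simp add: heavy_def)
    have yy: "sqrt y * sqrt y = y" "1 \<le> sqrt y" using y by auto
    have rec: "(\<Sum>p\<in>T X. 1 / N p) \<le> 50 * C * y" unfolding y_def using elim T by (intro reciprocal_sum) auto
    have M: "\<bar>M X\<bar> \<le> (1 + 50 * B * C * C) * y" using elim by (simp add: y_def)
    have sg: "\<sigma> X = sqrt V * sqrt y" by (simp add: \<sigma>_def y_def real_sqrt_mult)
    have c1: "norm (exp (- \<zeta> X * of_real (M X / \<sigma> X))) \<le> exp (R * (1 + 50 * B * C * C) / sqrt V * sqrt y)"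
    proof -
      have "norm (exp (- \<zeta> X * of_real (M X / \<sigma> X))) \<le> exp (norm (- \<zeta> X * of_real (M X / \<sigma> X)))" by (rule norm_exp)
      also have "norm (- \<zeta> X * of_real (M X / \<sigma> X)) \<le> R * ((1 + 50 * B * C * C) * y / \<sigma> X)"
        unfolding norm_mult norm_minus_cancel norm_of_real abs_divide using \<zeta> M elim R
        by (intro mult_mono divide_mono) auto
      also have "\<dots> = R * (1 + 50 * B * C * C) / sqrt V * (y / sqrt y)" by (simp add: sg)
      also have "y / sqrt y = sqrt y" using yy by (simp add: field_simps)
      finally show ?thesis by simp
    qed
    have c2: "jet_norm b (1 / x) (\<Prod>p\<in>T X. 1 + F p l * fps_const (exp (\<zeta> X * of_real (\<omega> p / \<sigma> X)) - 1))
       \<le> exp (150 * (1 + real b) * C * C * (R * B / sqrt V) * sqrt y)"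
    proof -
      let ?u = "\<lambda>p. exp (\<zeta> X * of_real (\<omega> p / \<sigma> X)) - 1"
      have "jet_norm b (1 / x) (1 + F p l * fps_const (?u p)) \<le> exp ((1 + real b) * C * 3 * h X * (1 / N p))" if p: "p \<in> T X" for p
      proof -
        let ?a = "\<zeta> X * of_real (\<omega> p / \<sigma> X)"
        have pA: "p \<in> A" "ln (N p) \<le> x" "norm ?a \<le> h X" using elim p by (auto simp: x_def)
        have N: "N p \<ge> 2" using N_ge pA by auto
        have "norm (?u p) \<le> exp \<bar>Re ?a\<bar> * norm ?a" using Taylor_exp[of ?a 0] by simp
        also have "\<dots> \<le> 3 * h X"
        proof (intro mult_mono)
          have "\<bar>Re ?a\<bar> \<le> 1" using abs_Re_le_cmod[of ?a] pA h0 by linarith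
          then have "exp \<bar>Re ?a\<bar> \<le> exp 1" unfolding exp_le_cancel_iff .
          then show "exp \<bar>Re ?a\<bar> \<le> 3" using exp_le by linarith
        qed (use pA in auto)
        finally have u: "norm (?u p) \<le> 3 * h X" .
        have "jet_norm b (1 / x) (1 + F p l * fps_const (?u p)) \<le> 1 + jet_norm b (1 / x) (F p l * fps_const (?u p))"
          using jet_norm_add[OF x(2), of b 1 "F p l * fps_const (?u p)"] jet_norm_1[OF x(2) b] by simp
        also have "jet_norm b (1 / x) (F p l * fps_const (?u p)) = norm (?u p) * jet_norm b (1 / x) (F p l)"
          using jet_norm_cmult[OF x(2), of b "?u p" "F p l"] by (simp add: mult.commute)
        also have "\<dots> \<le> (3 * h X) * ((1 + real b) * C / N p)"
          using u h0 jet_norm_F[OF l pA(1,2)] jet_norm_nonneg[OF x(2)] by (intro mult_mono) auto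
        also have "\<dots> = (1 + real b) * C * 3 * h X * (1 / N p)" by simp
        also have "1 + \<dots> \<le> exp \<dots>" by (rule exp_ge_add_one_self)
        finally show ?thesis by simp
      qed
      then have "jet_norm b (1 / x) (\<Prod>p\<in>T X. 1 + F p l * fps_const (?u p)) \<le> (\<Prod>p\<in>T X. exp ((1 + real b) * C * 3 * h X * (1 / N p)))"
        by (intro order.trans[OF jet_norm_prod[OF x(2) b]] prod_mono conjI jet_norm_nonneg[OF x(2)]) auto
      also have "\<dots> = exp ((1 + real b) * C * 3 * h X * (\<Sum>p\<in>T X. 1 / N p))"
        by (simp add: exp_sum finite_T sum_distrib_left)
      also have "\<dots> \<le> exp ((1 + real b) * C * 3 * h X * (50 * C * y))"
        unfolding exp_le_cancel_iff using rec C h0 by (intro mult_left_mono) auto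
      also have "(1 + real b) * C * 3 * h X * (50 * C * y) = 150 * (1 + real b) * C * C * (R * B / sqrt V) * (y / sqrt y)"
        by (simp add: h_def sg)
      also have "y / sqrt y = sqrt y" using yy by (simp add: field_simps)
      finally show ?thesis .
    qed
    have "jet_norm b (1 / x) (\<Phi> \<zeta> X l) \<le> exp (R * (1 + 50 * B * C * C) / sqrt V * sqrt y) * exp (150 * (1 + real b) * C * C * (R * B / sqrt V) * sqrt y)"
      unfolding \<Phi>_def jet_norm_cmult[OF x(2)] using jet_norm_nonneg[OF x(2)] by (intro mult_mono c1 c2) auto
    also have "\<dots> = exp (K * sqrt y)" by (simp add: K_def exp_add[symmetric] algebra_simps)
    finally have "jet_norm b (1 / x) (\<Phi> \<zeta> X l) / x \<le> exp (K * sqrt y) / x" using x by (intro divide_right_mono) auto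
    then show ?case using x jet_norm_nonneg[OF x(2), of b "\<Phi> \<zeta> X l"] by (simp add: x_def y_def)
  qed
  moreover have "((\<lambda>X. exp (K * sqrt (ln (ln X))) / ln X) \<longlongrightarrow> 0) at_top" using K by real_asymp
  ultimately show ?thesis by (rule Lim_null_comparison)
qed

lemma generating_limit:
  "((\<lambda>X. J (ln X) (\<Phi> \<zeta> X) - exp ((\<zeta> X)\<^sup>2 / 2)) \<longlongrightarrow> 0) at_top"
proof -
  obtain K where K: "K > 0" "\<forall>\<^sub>F x in at_top.
    fps_nth ((\<Sum>l\<in>\<Lambda>. G l) * fps_exp (of_real x)) (b - 1) \<noteq> 0 \<and>
    (\<forall>F. norm (J x F) \<le> K * (\<Sum>l\<in>\<Lambda>. (if fps_nth (G l) 0 = 0 then 1 / x else 1) * jet_norm b (1 / x) (F l)))"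
    using jet_expectation_bound[OF fin_\<Lambda> b G0] by blast
  let ?g = "\<lambda>X l. (if fps_nth (G l) 0 = 0 then 1 / ln X else 1) * jet_norm b (1 / ln X) (\<Phi> \<zeta> X l - fps_const (exp ((\<zeta> X)\<^sup>2 / 2)))"
  have ev: "\<forall>\<^sub>F X in at_top. norm (J (ln X) (\<Phi> \<zeta> X) - exp ((\<zeta> X)\<^sup>2 / 2)) \<le> K * (\<Sum>l\<in>\<Lambda>. ?g X l)"
    using eventually_compose_filterlim[OF K(2) ln_at_top]
  proof eventually_elim
    case (elim X)
    have "J (ln X) (\<Phi> \<zeta> X) - exp ((\<zeta> X)\<^sup>2 / 2) = J (ln X) (\<lambda>l. \<Phi> \<zeta> X l - fps_const (exp ((\<zeta> X)\<^sup>2 / 2)))"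
      using elim by (subst jet_expectation_diff) (simp add: jet_expectation_const)
    then show ?case using elim by simp
  qed
  have "((\<lambda>X. K * (\<Sum>l\<in>\<Lambda>. ?g X l)) \<longlongrightarrow> K * (\<Sum>l\<in>\<Lambda>. 0)) at_top"
  proof (intro tendsto_mult tendsto_const tendsto_sum)
    fix l assume l: "l \<in> \<Lambda>"
    show "((\<lambda>X. ?g X l) \<longlongrightarrow> 0) at_top"
    proof (cases "fps_nth (G l) 0 = 0")
      case False
      then show ?thesis using heavy_generating[of l] l by (simp add: heavy_def)
    next
      case True
      have "\<forall>\<^sub>F X in at_top. norm (?g X l) \<le> jet_norm b (1 / ln X) (\<Phi> \<zeta> X l) / ln X + exp (R\<^sup>2 / 2) / ln X"
        using eventually_regular
      proof eventually_elim
        case (elim X)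
        have x: "ln X \<ge> 1" "1 / ln X \<ge> 0" using elim by auto
        have "norm (exp ((\<zeta> X)\<^sup>2 / 2)) \<le> exp (norm ((\<zeta> X)\<^sup>2 / 2))" by (rule norm_exp)
        also have "norm ((\<zeta> X)\<^sup>2 / 2) \<le> R\<^sup>2 / 2" using power_mono[OF \<zeta>, of X 2] by (simp add: norm_power)
        finally have n: "norm (exp ((\<zeta> X)\<^sup>2 / 2)) \<le> exp (R\<^sup>2 / 2)" by (simp only: exp_le_cancel_iff)
        have "jet_norm b (1 / ln X) (\<Phi> \<zeta> X l - fps_const (exp ((\<zeta> X)\<^sup>2 / 2))) \<le> jet_norm b (1 / ln X) (\<Phi> \<zeta> X l) + exp (R\<^sup>2 / 2)"
          using jet_norm_diff[OF x(2), of b "\<Phi> \<zeta> X l" "fps_const (exp ((\<zeta> X)\<^sup>2 / 2))"] n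
          unfolding jet_norm_const[OF x(2) b] by linarith
        then have "jet_norm b (1 / ln X) (\<Phi> \<zeta> X l - fps_const (exp ((\<zeta> X)\<^sup>2 / 2))) / ln X \<le> (jet_norm b (1 / ln X) (\<Phi> \<zeta> X l) + exp (R\<^sup>2 / 2)) / ln X"
          using x by (intro divide_right_mono) auto
        then show ?case using True x jet_norm_nonneg[OF x(2), of b] by (simp add: add_divide_distrib)
      qed
      moreover have "((\<lambda>X. jet_norm b (1 / ln X) (\<Phi> \<zeta> X l) / ln X + exp (R\<^sup>2 / 2) / ln X) \<longlongrightarrow> 0) at_top"
        by (intro tendsto_add_zero light_generating[OF l] tendsto_divide_0[OF tendsto_const]
            filterlim_at_top_imp_at_infinity ln_at_top)
      ultimately show ?thesis by (rule Lim_null_comparison)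
    qed
  qed
  then have "((\<lambda>X. K * (\<Sum>l\<in>\<Lambda>. ?g X l)) \<longlongrightarrow> 0) at_top" by (simp only: sum.neutral_const mult_zero_right)
  with ev show ?thesis by (rule Lim_null_comparison)
qed

end

end

section \<open>Convergence of moments\<close>

text \<open>The moments of the standard normal law, defined through the generating function \<open>exp (z\<^sup>2 / 2)\<close>.\<close>

definition gauss_moment :: "nat \<Rightarrow> complex" where
  "gauss_moment m = (deriv ^^ m) (\<lambda>z. exp (z\<^sup>2 / 2)) 0"

lemma higher_deriv_exponential_sum:
  "(deriv ^^ m) (\<lambda>z. \<Sum>i\<in>I. c i * exp (z * a i)) = (\<lambda>z::complex. \<Sum>i\<in>I. c i * a i ^ m * exp (z * a i))"
proof (induction m)
  case (Suc m)
  have "((\<lambda>z. \<Sum>i\<in>I. c i * a i ^ m * exp (z * a i)) has_field_derivative (\<Sum>i\<in>I. c i * a i ^ Suc m * exp (z * a i))) (at z)" for z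
    by (auto intro!: derivative_eq_intros sum.cong simp: mult_ac)
  then have "deriv (\<lambda>z. \<Sum>i\<in>I. c i * a i ^ m * exp (z * a i)) = (\<lambda>z. \<Sum>i\<in>I. c i * a i ^ Suc m * exp (z * a i))"
    by (intro ext DERIV_imp_deriv)
  then show ?case by (simp add: Suc.IH)
qed simp

lemma sum_power_eq_sum_lists:
  fixes g :: "'a \<Rightarrow> 'b::comm_semiring_1"
  assumes "finite U"
  shows "(\<Sum>p\<in>U. g p) ^ k = (\<Sum>P | set P \<subseteq> U \<and> length P = k. prod_list (map g P))"
proof (induction k)
  case 0
  have "{P :: 'a list. set P \<subseteq> U \<and> length P = 0} = {[]}" by auto
  then show ?case by simp
next
  case (Suc k)
  have inj: "inj_on (\<lambda>(xs, n). n # xs) ({xs. set xs \<subseteq> U \<and> length xs = k} \<times> U)" by (auto simp: inj_on_def)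
  have "(\<Sum>P | set P \<subseteq> U \<and> length P = Suc k. prod_list (map g P))
     = (\<Sum>(P, p)\<in>{xs. set xs \<subseteq> U \<and> length xs = k} \<times> U. g p * prod_list (map g P))"
    unfolding lists_length_Suc_eq sum.reindex[OF inj] by (intro sum.cong) auto
  also have "\<dots> = (\<Sum>p\<in>U. g p) ^ k * (\<Sum>p\<in>U. g p)"
    unfolding Suc.IH sum_product sum.cartesian_product by (intro sum.cong) (auto simp: mult.commute)
  finally show ?case by (simp add: mult.commute)
qed

lemma weighted_power_sum_expand:
  fixes g :: "'a \<Rightarrow> 'b::comm_semiring_1"
  assumes I: "finite I" and T: "finite T" and D: "\<And>i. i \<in> I \<Longrightarrow> D i \<subseteq> T"
  shows "(\<Sum>i\<in>I. c i * (\<Sum>p\<in>D i. g p) ^ k) =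
     (\<Sum>P | set P \<subseteq> T \<and> length P = k. prod_list (map g P) * (\<Sum>i | i \<in> I \<and> set P \<subseteq> D i. c i))"
proof -
  let ?L = "{P. set P \<subseteq> T \<and> length P = k}"
  have fL: "finite ?L" using finite_lists_length_eq[OF T] .
  have "(\<Sum>i\<in>I. c i * (\<Sum>p\<in>D i. g p) ^ k) = (\<Sum>i\<in>I. \<Sum>P\<in>?L. if set P \<subseteq> D i then c i * prod_list (map g P) else 0)"
  proof (rule sum.cong[OF refl])
    fix i assume i: "i \<in> I"
    have "{P. set P \<subseteq> D i \<and> length P = k} = {P \<in> ?L. set P \<subseteq> D i}" using D[OF i] by auto
    then show "c i * (\<Sum>p\<in>D i. g p) ^ k = (\<Sum>P\<in>?L. if set P \<subseteq> D i then c i * prod_list (map g P) else 0)"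
      unfolding sum_power_eq_sum_lists[OF finite_subset[OF D[OF i] T]]
      using fL by (simp only: sum_distrib_left sum.inter_filter) (intro sum.cong, auto)
  qed
  also have "\<dots> = (\<Sum>P\<in>?L. \<Sum>i\<in>I. if set P \<subseteq> D i then c i * prod_list (map g P) else 0)"
    by (rule sum.swap)
  also have "\<dots> = (\<Sum>P\<in>?L. prod_list (map g P) * (\<Sum>i | i \<in> I \<and> set P \<subseteq> D i. c i))"
  proof (rule sum.cong[OF refl])
    fix P
    have "(\<Sum>i\<in>I. if set P \<subseteq> D i then c i * prod_list (map g P) else 0) = (\<Sum>i\<in>{i\<in>I. set P \<subseteq> D i}. c i * prod_list (map g P))"
      using I by (rule sum.inter_filter[symmetric])
    then show "(\<Sum>i\<in>I. if set P \<subseteq> D i then c i * prod_list (map g P) else 0) = prod_list (map g P) * (\<Sum>i | i \<in> I \<and> set P \<subseteq> D i. c i)"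
      by (simp add: sum_distrib_left mult.commute)
  qed
  finally show ?thesis .
qed

text \<open>The probability that independent Bernoulli variables with parameters \<open>g p\<close> are all 1 on \<open>Q\<close>; a formal
  identity, valid in any commutative ring.\<close>

lemma sum_supersets_prod:
  fixes g :: "'a \<Rightarrow> 'b::comm_ring_1"
  assumes T: "finite T" and Q: "Q \<subseteq> T"
  shows "(\<Sum>U | U \<in> Pow T \<and> Q \<subseteq> U. (\<Prod>p\<in>U. g p) * (\<Prod>p\<in>T - U. 1 - g p)) = (\<Prod>p\<in>Q. g p)"
proof -
  \<comment> \<open>With this choice the expansion of the product over \<open>T\<close> has no terms for sets that do not contain \<open>Q\<close>.\<close>
  let ?h = "\<lambda>p. if p \<in> Q then 0 else 1 - g p"
  have "(\<Prod>p\<in>Q. g p) = (\<Prod>p\<in>T. if p \<in> Q then g p else 1)"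
    using T Q by (simp add: prod.If_cases Int_absorb1)
  also have "\<dots> = (\<Prod>p\<in>T. g p + ?h p)" by (intro prod.cong) auto
  also have "\<dots> = (\<Sum>U\<in>Pow T. (\<Prod>p\<in>U. g p) * (\<Prod>p\<in>T - U. ?h p))" by (rule prod_add[OF T])
  also have "\<dots> = (\<Sum>U\<in>Pow T. if Q \<subseteq> U then (\<Prod>p\<in>U. g p) * (\<Prod>p\<in>T - U. 1 - g p) else 0)"
  proof (rule sum.cong[OF refl])
    fix U assume U: "U \<in> Pow T"
    show "(\<Prod>p\<in>U. g p) * (\<Prod>p\<in>T - U. ?h p) = (if Q \<subseteq> U then (\<Prod>p\<in>U. g p) * (\<Prod>p\<in>T - U. 1 - g p) else 0)"
    proof (cases "Q \<subseteq> U")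
      case True
      then have "(\<Prod>p\<in>T - U. ?h p) = (\<Prod>p\<in>T - U. 1 - g p)" by (intro prod.cong) auto
      then show ?thesis using True by simp
    next
      case False
      then obtain q where "q \<in> Q" "q \<notin> U" by auto
      then have "(\<Prod>p\<in>T - U. ?h p) = 0" using T Q by (intro prod_zero) auto
      then show ?thesis using False by simp
    qed
  qed
  also have "\<dots> = (\<Sum>U | U \<in> Pow T \<and> Q \<subseteq> U. (\<Prod>p\<in>U. g p) * (\<Prod>p\<in>T - U. 1 - g p))"
    using T by (intro sum.inter_filter[symmetric]) auto
  finally show ?thesis by simp
qed

context truncated_sum
begin

text \<open>The mass that the functional assigns to the event that exactly the primes in \<open>U\<close> divide. It is complex
  in general, so this is no probability.\<close>

definition signed_weight :: "real \<Rightarrow> 'p set \<Rightarrow> complex" where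
  "signed_weight X U = J (ln X) (\<lambda>l. (\<Prod>p\<in>U. F p l) * (\<Prod>p\<in>T X - U. 1 - F p l))"

definition normalized :: "real \<Rightarrow> 'p set \<Rightarrow> real" where
  "normalized X U = ((\<Sum>p\<in>U. \<omega> p) - M X) / \<sigma> X"

lemma generating_function_eq:
  "(\<Sum>U\<in>Pow (T X). signed_weight X U * exp (\<zeta> X * of_real (normalized X U))) = J (ln X) (\<Phi> \<zeta> X)"
proof -
  have "\<Phi> \<zeta> X l = (\<Sum>U\<in>Pow (T X). fps_const (exp (\<zeta> X * of_real (normalized X U))) * ((\<Prod>p\<in>U. F p l) * (\<Prod>p\<in>T X - U. 1 - F p l)))" for l
  proof -
    let ?e = "\<lambda>p. exp (\<zeta> X * of_real (\<omega> p / \<sigma> X))"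
    have "(\<Prod>p\<in>T X. 1 + F p l * fps_const (?e p - 1)) = (\<Prod>p\<in>T X. F p l * fps_const (?e p) + (1 - F p l))"
    proof (rule prod.cong[OF refl])
      fix p
      have "fps_const (?e p - 1) = fps_const (?e p) - 1" by (simp flip: fps_const_sub)
      then show "1 + F p l * fps_const (?e p - 1) = F p l * fps_const (?e p) + (1 - F p l)"
        by (simp only:) (simp add: algebra_simps)
    qed
    also have "\<dots> = (\<Sum>U\<in>Pow (T X). (\<Prod>p\<in>U. F p l * fps_const (?e p)) * (\<Prod>p\<in>T X - U. 1 - F p l))"
      by (rule prod_add[OF finite_T])
    finally have 1: "\<Phi> \<zeta> X l = (\<Sum>U\<in>Pow (T X). fps_const (exp (- \<zeta> X * of_real (M X / \<sigma> X))) * ((\<Prod>p\<in>U. F p l * fps_const (?e p)) * (\<Prod>p\<in>T X - U. 1 - F p l)))"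
      by (simp only: \<Phi>_def sum_distrib_left)
    show ?thesis unfolding 1
    proof (rule sum.cong[OF refl])
      fix U assume "U \<in> Pow (T X)"
      then have fU: "finite U" using finite_T finite_subset by auto
      have "(\<Prod>p\<in>U. fps_const (?e p)) = fps_const (exp (\<Sum>p\<in>U. \<zeta> X * of_real (\<omega> p / \<sigma> X)))"
        using fU by (induction rule: finite_induct) (auto simp: exp_add)
      moreover have "exp (- \<zeta> X * of_real (M X / \<sigma> X)) * exp (\<Sum>p\<in>U. \<zeta> X * of_real (\<omega> p / \<sigma> X)) = exp (\<zeta> X * of_real (normalized X U))"
        unfolding exp_add[symmetric] normalized_def
        by (simp add: sum_distrib_left[symmetric] sum_divide_distrib[symmetric] diff_divide_distrib algebra_simps)
      ultimately show "fps_const (exp (- \<zeta> X * of_real (M X / \<sigma> X))) * ((\<Prod>p\<in>U. F p l * fps_const (?e p)) * (\<Prod>p\<in>T X - U. 1 - F p l)) =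
         fps_const (exp (\<zeta> X * of_real (normalized X U))) * ((\<Prod>p\<in>U. F p l) * (\<Prod>p\<in>T X - U. 1 - F p l))"
        by (simp add: prod.distrib mult_ac fps_const_mult[symmetric] del: fps_const_mult)
    qed
  qed
  then have "\<Phi> \<zeta> X = (\<lambda>l. \<Sum>U\<in>Pow (T X). fps_const (exp (\<zeta> X * of_real (normalized X U))) * ((\<Prod>p\<in>U. F p l) * (\<Prod>p\<in>T X - U. 1 - F p l)))"
    by (intro ext)
  then show ?thesis by (simp only: jet_expectation_sum signed_weight_def mult.commute)
qed

text \<open>The limit holds along every bounded choice of the argument as a function of \<open>X\<close>, hence
  uniformly on bounded sets.\<close>

lemma generating_function_uniform:
  "uniform_limit (ball 0 1) (\<lambda>X z. \<Sum>U\<in>Pow (T X). signed_weight X U * exp (z * of_real (normalized X U)))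
     (\<lambda>z. exp (z\<^sup>2 / 2)) at_top"
  unfolding uniform_limit_iff
proof (intro allI impI)
  fix e :: real assume e: "e > 0"
  define close where "close X z \<longleftrightarrow>
    dist (\<Sum>U\<in>Pow (T X). signed_weight X U * exp (z * of_real (normalized X U))) (exp (z\<^sup>2 / 2)) < e" for X z
  \<comment> \<open>Choose \<open>\<zeta> X\<close> to be a point where the bound fails, whenever there is one.\<close>
  have "\<forall>X. \<exists>z. norm z \<le> 1 \<and> (close X z \<longrightarrow> (\<forall>w\<in>ball 0 1. close X w))"
  proof
    fix X
    show "\<exists>z. norm z \<le> 1 \<and> (close X z \<longrightarrow> (\<forall>w\<in>ball 0 1. close X w))"
  proof (cases "\<forall>w\<in>ball 0 1. close X w")
    case True
    then show ?thesis by (intro exI[of _ 0]) simp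
  next
    case False
    then obtain w where "w \<in> ball 0 1" "\<not> close X w" by blast
    then show ?thesis by (intro exI[of _ w]) auto
  qed
  qed
  from choice[OF this] obtain \<zeta> where
    \<zeta>: "\<And>X. norm (\<zeta> X) \<le> 1" "\<And>X. close X (\<zeta> X) \<Longrightarrow> \<forall>w\<in>ball 0 1. close X w" by auto
  have "\<forall>\<^sub>F X in at_top. dist (J (ln X) (\<Phi> \<zeta> X) - exp ((\<zeta> X)\<^sup>2 / 2)) 0 < e"
    using generating_limit[of 1 \<zeta>] \<zeta>(1) e by (intro tendstoD) auto
  then have "\<forall>\<^sub>F X in at_top. \<forall>w\<in>ball 0 1. close X w"
  proof eventually_elim
    case (elim X)
    then have "close X (\<zeta> X)" unfolding close_def generating_function_eq[symmetric] dist_norm by (simp only: diff_zero)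
    then show ?case by (rule \<zeta>(2))
  qed
  then show "\<forall>\<^sub>F X in at_top. \<forall>z\<in>ball 0 1.
     dist (\<Sum>U\<in>Pow (T X). signed_weight X U * exp (z * of_real (normalized X U))) (exp (z\<^sup>2 / 2)) < e"
    by (simp only: close_def)
qed

lemma signed_moments:
  "((\<lambda>X. \<Sum>U\<in>Pow (T X). signed_weight X U * of_real (normalized X U) ^ m) \<longlongrightarrow> gauss_moment m) at_top"
proof -
  have "((\<lambda>X. (deriv ^^ m) (\<lambda>z. \<Sum>U\<in>Pow (T X). signed_weight X U * exp (z * of_real (normalized X U))) 0) \<longlongrightarrow> gauss_moment m) at_top"
    unfolding gauss_moment_def
    by (rule higher_deriv_complex_uniform_limit[OF generating_function_uniform])
       (auto intro!: always_eventually holomorphic_intros)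
  then show ?thesis by (simp add: higher_deriv_exponential_sum)
qed

lemma signed_weight_supersets:
  assumes "Q \<subseteq> T X"
  shows "(\<Sum>U | U \<in> Pow (T X) \<and> Q \<subseteq> U. signed_weight X U) = J (ln X) (\<lambda>l. \<Prod>p\<in>Q. F p l)"
proof -
  have "J (ln X) (\<lambda>l. \<Prod>p\<in>Q. F p l) = J (ln X) (\<lambda>l. \<Sum>U\<in>{U. U \<in> Pow (T X) \<and> Q \<subseteq> U}. fps_const 1 * ((\<Prod>p\<in>U. F p l) * (\<Prod>p\<in>T X - U. 1 - F p l)))"
    by (simp add: sum_supersets_prod[OF finite_T assms, symmetric])
  also have "\<dots> = (\<Sum>U | U \<in> Pow (T X) \<and> Q \<subseteq> U. signed_weight X U)"
    unfolding jet_expectation_sum signed_weight_def by simp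
  finally show ?thesis by simp
qed

text \<open>Divisibility frequencies that agree with the functional up to \<open>err\<close> on each list of at most
  \<open>n\<close> primes yield moments that agree up to \<open>(card T B + \<bar>M\<bar>) ^ j err\<close>.\<close>

lemma moments_transfer:
  fixes I :: "real \<Rightarrow> 'i set" and D :: "real \<Rightarrow> 'i \<Rightarrow> 'p set"
  assumes I: "\<And>X. finite (I X)" and D: "\<And>X i. i \<in> I X \<Longrightarrow> D X i \<subseteq> T X"
    and err: "\<forall>\<^sub>F X in at_top. 0 \<le> err X \<and> (\<forall>P. set P \<subseteq> T X \<longrightarrow> length P \<le> n \<longrightarrow>
      norm (of_real (real (card {i\<in>I X. set P \<subseteq> D X i}) / real (card (I X))) - J (ln X) (\<lambda>l. \<Prod>p\<in>set P. F p l)) \<le> err X)"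
    and small: "\<And>j. j \<le> n \<Longrightarrow> ((\<lambda>X. (real (card (T X)) * B + \<bar>M X\<bar>) ^ j * err X) \<longlongrightarrow> 0) at_top"
    and j: "j \<le> n"
  shows "((\<lambda>X. of_real (1 / real (card (I X)) * (\<Sum>i\<in>I X. normalized X (D X i) ^ j))) \<longlongrightarrow> gauss_moment j) at_top"
proof -
  let ?E = "\<lambda>X. complex_of_real (1 / real (card (I X)) * (\<Sum>i\<in>I X. normalized X (D X i) ^ j))"
  let ?S = "\<lambda>X. \<Sum>U\<in>Pow (T X). signed_weight X U * of_real (normalized X U) ^ j"
  have "\<forall>\<^sub>F X in at_top. \<sigma> X \<ge> 1"
    using filterlim_ln_ln[unfolded filterlim_at_top, rule_format, of "1 / V"]
  proof eventually_elim
    case (elim X)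
    then have "1 \<le> V * ln (ln X)" using V by (simp add: field_simps)
    then show ?case by (simp add: \<sigma>_def)
  qed
  with err have "\<forall>\<^sub>F X in at_top. norm (?E X - ?S X) \<le> (real (card (T X)) * B + \<bar>M X\<bar>) ^ j * err X"
  proof eventually_elim
    case (elim X)
    let ?c = "complex_of_real (1 / real (card (I X)))"
    let ?g = "\<lambda>p. complex_of_real (\<omega> p)"
    \<comment> \<open>The difference of the \<open>k\<close>-th moments before centring and normalization.\<close>
    define d where "d k = (\<Sum>i\<in>I X. ?c * (\<Sum>p\<in>D X i. ?g p) ^ k) - (\<Sum>U\<in>Pow (T X). signed_weight X U * (\<Sum>p\<in>U. ?g p) ^ k)" for k
    have d: "norm (d k) \<le> (real (card (T X)) * B) ^ k * err X" if k: "k \<le> n" for k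
    proof -
      let ?L = "{P. set P \<subseteq> T X \<and> length P = k}"
      have "(\<Sum>i\<in>I X. ?c * (\<Sum>p\<in>D X i. ?g p) ^ k) = (\<Sum>P\<in>?L. prod_list (map ?g P) * (\<Sum>i | i \<in> I X \<and> set P \<subseteq> D X i. ?c))"
        by (rule weighted_power_sum_expand[OF I finite_T]) (rule D)
      moreover have "(\<Sum>U\<in>Pow (T X). signed_weight X U * (\<Sum>p\<in>U. ?g p) ^ k)
         = (\<Sum>P\<in>?L. prod_list (map ?g P) * (\<Sum>U | U \<in> Pow (T X) \<and> set P \<subseteq> U. signed_weight X U))"
        using finite_T by (intro weighted_power_sum_expand) auto
      ultimately have "d k = (\<Sum>P\<in>?L. prod_list (map ?g P) * ((\<Sum>i | i \<in> I X \<and> set P \<subseteq> D X i. ?c) - (\<Sum>U | U \<in> Pow (T X) \<and> set P \<subseteq> U. signed_weight X U)))"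
        unfolding d_def by (simp only: sum_subtractf right_diff_distrib)
      also have "norm \<dots> \<le> (\<Sum>P\<in>?L. B ^ k * err X)"
      proof (rule sum_norm_le)
        fix P assume P: "P \<in> ?L"
        have 1: "norm (prod_list (map ?g P)) \<le> B ^ length P" if "set P \<subseteq> A" for P
          using that
        proof (induction P)
          case (Cons p P)
          then show ?case using \<omega>[of p] B by (auto simp: norm_mult intro!: mult_mono)
        qed simp
        have "(\<Sum>i | i \<in> I X \<and> set P \<subseteq> D X i. ?c) = of_real (real (card {i\<in>I X. set P \<subseteq> D X i}) / real (card (I X)))"
          by simp
        then have "norm ((\<Sum>i | i \<in> I X \<and> set P \<subseteq> D X i. ?c) - (\<Sum>U | U \<in> Pow (T X) \<and> set P \<subseteq> U. signed_weight X U)) \<le> err X"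
          using elim P k signed_weight_supersets[of "set P" X] by simp
        moreover have "set P \<subseteq> A" using P T[of X] by auto
        ultimately show "norm (prod_list (map ?g P) * ((\<Sum>i | i \<in> I X \<and> set P \<subseteq> D X i. ?c) - (\<Sum>U | U \<in> Pow (T X) \<and> set P \<subseteq> U. signed_weight X U))) \<le> B ^ k * err X"
          unfolding norm_mult using 1[of P] P B by (intro mult_mono) auto
      qed
      also have "\<dots> = (real (card (T X)) * B) ^ k * err X"
        by (simp add: card_lists_length_eq[OF finite_T] power_mult_distrib)
      finally show ?thesis .
    qed
    have bin: "complex_of_real (normalized X U) ^ j = (\<Sum>k\<le>j. of_nat (j choose k) * of_real (- M X) ^ (j - k) / of_real (\<sigma> X) ^ j * (\<Sum>p\<in>U. ?g p) ^ k)" for U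
    proof -
      have "complex_of_real (normalized X U) = ((\<Sum>p\<in>U. ?g p) + of_real (- M X)) / of_real (\<sigma> X)" by (simp add: normalized_def)
      then have "complex_of_real (normalized X U) ^ j = ((\<Sum>p\<in>U. ?g p) + of_real (- M X)) ^ j / of_real (\<sigma> X) ^ j"
        by (simp add: power_divide)
      then show ?thesis unfolding binomial_ring by (simp add: sum_divide_distrib mult_ac)
    qed
    have "?E X - ?S X = (\<Sum>i\<in>I X. ?c * of_real (normalized X (D X i)) ^ j) - ?S X"
      by (simp add: sum_divide_distrib)
    also have "\<dots> = (\<Sum>k\<le>j. of_nat (j choose k) * of_real (- M X) ^ (j - k) / of_real (\<sigma> X) ^ j * d k)"
      unfolding bin d_def right_diff_distrib sum_subtractf sum_distrib_left
      by (subst (1 2) sum.swap) (simp add: mult_ac)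
    also have "norm \<dots> \<le> (\<Sum>k\<le>j. of_nat (j choose k) * (real (card (T X)) * B) ^ k * \<bar>M X\<bar> ^ (j - k) * err X)"
    proof (rule sum_norm_le)
      fix k assume "k \<in> {..j}"
      then have k: "k \<le> n" using j by auto
      have "norm (of_nat (j choose k) * of_real (- M X) ^ (j - k) / of_real (\<sigma> X) ^ j * d k)
         = of_nat (j choose k) * \<bar>M X\<bar> ^ (j - k) / \<sigma> X ^ j * norm (d k)"
        using elim by (simp add: norm_mult norm_divide norm_power)
      also have "\<dots> \<le> of_nat (j choose k) * \<bar>M X\<bar> ^ (j - k) / 1 * ((real (card (T X)) * B) ^ k * err X)"
        using elim B by (intro mult_mono divide_left_mono d k) auto
      finally show "norm (of_nat (j choose k) * of_real (- M X) ^ (j - k) / of_real (\<sigma> X) ^ j * d k)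
         \<le> of_nat (j choose k) * (real (card (T X)) * B) ^ k * \<bar>M X\<bar> ^ (j - k) * err X" by (simp add: mult_ac)
    qed
    also have "\<dots> = (real (card (T X)) * B + \<bar>M X\<bar>) ^ j * err X"
      unfolding binomial_ring by (simp add: sum_distrib_right)
    finally show ?case .
  qed
  from Lim_null_comparison[OF this small[OF j]] signed_moments[of j] have "((\<lambda>X. (?E X - ?S X) + ?S X) \<longlongrightarrow> 0 + gauss_moment j) at_top"
    by (rule tendsto_add)
  then show ?thesis by simp
qed

end

section \<open>Well-mixed Bernoulli processes\<close>

abbreviation germ_jet :: "('l, 'k) bernoulli \<Rightarrow> 'k set \<Rightarrow> 'l \<Rightarrow> complex fps" where
  "germ_jet \<B> p l \<equiv> fps_expansion (germ_at \<B> p l) (centre \<B>)"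

text \<open>The functional of \<open>jet_expectation\<close> computes the algebraic moments, because the factor
  \<open>X powr s\<^sub>0\<close> cancels, and the limiting weights are read off from the leading coefficients in \<open>ln X\<close>.\<close>

lemma jet_model_of_bernoulli:
  fixes \<B> :: "('l, 'k::number_field) bernoulli"
  assumes BP: "bernoulli_process \<B>" and WM: "well_mixed \<B>"
  obtains G C \<alpha> where
    "jet_model (good_primes \<B>) (\<lambda>p. real (ideal_norm p)) (params (mixture_of \<B>))
       (pole_order (mixture_of \<B>)) G (germ_jet \<B>) C \<alpha>"
    "\<And>X P. X > 0 \<Longrightarrow> set P \<subseteq> good_primes \<B> \<Longrightarrow> algebraic_moment \<B> X P =
       jet_expectation (pole_order (mixture_of \<B>)) (params (mixture_of \<B>)) G (ln X) (\<lambda>l. \<Prod>p\<in>set P. germ_jet \<B> p l)"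
    "\<And>l. l \<in> params (mixture_of \<B>) \<Longrightarrow> weight_lim (mixture_of \<B>) l =
       fps_nth (G l) 0 / (\<Sum>l\<in>params (mixture_of \<B>). fps_nth (G l) 0)"
proof -
  define \<T> where "\<T> = mixture_of \<B>"
  define \<Lambda> where "\<Lambda> = params \<T>"
  define b where "b = pole_order \<T>"
  define s0 where "s0 = centre \<B>"
  have TM: "tauberian_mixture \<T>" using BP by (simp add: bernoulli_process_def \<T>_def)
  have fin: "finite \<Lambda>" and b: "b \<ge> 1" using TM by (auto simp: tauberian_mixture_def Let_def \<Lambda>_def b_def)
  obtain G :: "'l \<Rightarrow> complex fps" where G0: "fps_nth (\<Sum>l\<in>\<Lambda>. G l) 0 \<noteq> 0"
    and res: "\<And>f F X. X > 0 \<Longrightarrow>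
       (\<And>l. l \<in> \<Lambda> \<Longrightarrow> (\<lambda>w. f l (s0 + w)) has_fps_expansion F l) \<Longrightarrow>
       residue (\<lambda>s. (\<Sum>l\<in>\<Lambda>. f l s * dseries \<T> l s) * of_real X powr s / s) s0
         = of_real X powr s0 * fps_nth ((\<Sum>l\<in>\<Lambda>. F l * G l) * fps_exp (of_real (ln X))) (b - 1)"
    using mixture_power_series[OF TM] unfolding \<Lambda>_def b_def s0_def \<T>_def by blast
  have tot: "total_residue \<T> X = of_real X powr s0 * fps_nth ((\<Sum>l\<in>\<Lambda>. G l) * fps_exp (of_real (ln X))) (b - 1)"
    if "X > 0" for X
    using res[OF that, of "\<lambda>_ _. 1" "\<lambda>_. 1"] by (simp add: total_residue_def \<Lambda>_def s0_def \<T>_def)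
  have Xp: "complex_of_real X powr s0 \<noteq> 0" if "X > 0" for X using that by simp
  have moment: "algebraic_moment \<B> X P = jet_expectation b \<Lambda> G (ln X) (\<lambda>l. \<Prod>p\<in>set P. germ_jet \<B> p l)"
    if X: "X > 0" and P: "set P \<subseteq> good_primes \<B>" for X P
  proof -
    have "(\<lambda>w. \<Prod>p\<in>set P. germ_at \<B> p l (s0 + w)) has_fps_expansion (\<Prod>p\<in>set P. germ_jet \<B> p l)" if l: "l \<in> \<Lambda>" for l
    proof (intro fps_expansion_intros)
      fix p assume "p \<in> set P"
      then have "germ_at \<B> p l analytic_on {s0}"
        using BP P l by (auto simp: bernoulli_process_def s0_def \<Lambda>_def \<T>_def)
      then show "(\<lambda>w. germ_at \<B> p l (s0 + w)) has_fps_expansion germ_jet \<B> p l"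
        unfolding s0_def by (rule analytic_at_imp_has_fps_expansion)
    qed
    from res[OF X this] have "residue (\<lambda>s. (\<Sum>l\<in>\<Lambda>. (\<Prod>p\<in>set P. germ_at \<B> p l s) * dseries \<T> l s) * of_real X powr s / s) s0
         = of_real X powr s0 * fps_nth ((\<Sum>l\<in>\<Lambda>. (\<Prod>p\<in>set P. germ_jet \<B> p l) * G l) * fps_exp (of_real (ln X))) (b - 1)" by simp
    then show ?thesis
      using Xp[OF X] tot[OF X]
      by (simp add: algebraic_moment_def mixture_expectation_def jet_expectation_def \<Lambda>_def s0_def \<T>_def)
  qed
  have wl: "weight_lim \<T> l = fps_nth (G l) 0 / (\<Sum>l\<in>\<Lambda>. fps_nth (G l) 0)" if l: "l \<in> \<Lambda>" for l
  proof -
    have par: "param_residue \<T> l X = of_real X powr s0 * fps_nth (G l * fps_exp (of_real (ln X))) (b - 1)"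
      if "X > 0" for X
    proof -
      have "(\<Sum>l'\<in>\<Lambda>. (if l' = l then 1 else 0) * c l') = c l" for c :: "'l \<Rightarrow> complex"
      proof -
        have "(\<Sum>l'\<in>\<Lambda>. (if l' = l then 1 else 0) * c l') = (\<Sum>l'\<in>\<Lambda>. if l' = l then c l' else 0)" by (intro sum.cong) auto
        then show ?thesis using fin l by simp
      qed
      moreover have "(\<Sum>l'\<in>\<Lambda>. (if l' = l then 1 else 0) * G l') = G l"
      proof -
        have "(\<Sum>l'\<in>\<Lambda>. (if l' = l then 1 else 0) * G l') = (\<Sum>l'\<in>\<Lambda>. if l' = l then G l' else 0)" by (intro sum.cong) auto
        then show ?thesis using fin l by simp
      qed
      ultimately show ?thesis
        using res[OF that, of "\<lambda>l' _. if l' = l then 1 else 0" "\<lambda>l'. if l' = l then 1 else 0"]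
        by (simp add: param_residue_def s0_def \<T>_def)
    qed
    have "((\<lambda>X. (fps_nth (G l * fps_exp (of_real (ln X))) (b - 1) / of_real (ln X) ^ (b - 1)) /
        (fps_nth ((\<Sum>l\<in>\<Lambda>. G l) * fps_exp (of_real (ln X))) (b - 1) / of_real (ln X) ^ (b - 1))) \<longlongrightarrow>
        (fps_nth (G l) 0 / fact (b - 1)) / (fps_nth (\<Sum>l\<in>\<Lambda>. G l) 0 / fact (b - 1))) at_top"
      using G0 by (intro tendsto_divide filterlim_compose[OF nth_mult_fps_exp_limit ln_at_top]) auto
    also have "(fps_nth (G l) 0 / fact (b - 1)) / (fps_nth (\<Sum>l\<in>\<Lambda>. G l) 0 / fact (b - 1)) = fps_nth (G l) 0 / (\<Sum>l\<in>\<Lambda>. fps_nth (G l) 0)"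
      by (simp add: fps_sum_nth)
    finally have "(weight \<T> l \<longlongrightarrow> fps_nth (G l) 0 / (\<Sum>l\<in>\<Lambda>. fps_nth (G l) 0)) at_top"
    proof (rule Lim_transform_eventually)
      show "\<forall>\<^sub>F X in at_top. (fps_nth (G l * fps_exp (of_real (ln X))) (b - 1) / of_real (ln X) ^ (b - 1)) /
        (fps_nth ((\<Sum>l\<in>\<Lambda>. G l) * fps_exp (of_real (ln X))) (b - 1) / of_real (ln X) ^ (b - 1)) = weight \<T> l X"
        using eventually_gt_at_top[of 1]
      proof eventually_elim
        case (elim X)
        then have "complex_of_real (ln X) ^ (b - 1) \<noteq> 0" "X > 0" by auto
        then show ?case using Xp[of X] by (simp add: weight_def par tot)
      qed
    qed
    then show ?thesis unfolding weight_lim_def by (intro tendsto_Lim) auto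
  qed
  have heavy: "l \<in> positive_params \<T> \<longleftrightarrow> l \<in> \<Lambda> \<and> fps_nth (G l) 0 \<noteq> 0" for l
    using wl G0 by (auto simp: positive_params_def \<Lambda>_def fps_sum_nth)
  obtain C1 where C1: "C1 > 0" "\<And>Y. Y \<ge> 2 \<Longrightarrow> (\<Sum>P | P \<in> primes \<and> real (ideal_norm (P :: 'k set)) \<le> Y.
     ln (real (ideal_norm P)) / real (ideal_norm P)) \<le> C1 * ln Y"
    using mertens_primes by blast
  obtain \<alpha> C2 where C2: "\<alpha> > 0" "C2 > 0" "\<And>p l l'. p \<in> good_primes \<B> \<Longrightarrow> l \<in> positive_params \<T> \<Longrightarrow> l' \<in> positive_params \<T> \<Longrightarrow>
        norm (germ_at \<B> p l s0 - germ_at \<B> p l' s0) \<le> C2 * real (ideal_norm p) powr (- 1 - \<alpha>)"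
    using WM unfolding well_mixed_def s0_def \<T>_def by metis
  obtain C3 where C3: "C3 > 0" "\<And>T. finite T \<Longrightarrow> T \<subseteq> primes \<Longrightarrow> (\<Sum>P\<in>T. real (ideal_norm (P :: 'k set)) powr (- 1 - \<alpha>)) \<le> C3"
    using prime_powr_sums_bounded[OF C2(1)] by blast
  obtain C4 where C4: "C4 > 0" "\<And>T. finite T \<Longrightarrow> T \<subseteq> primes \<Longrightarrow> (\<Sum>P\<in>T. real (ideal_norm (P :: 'k set)) powr (- 1 - 1)) \<le> C4"
    using prime_powr_sums_bounded[of 1] by auto
  have "\<forall>r. \<exists>c>0. \<forall>l\<in>\<Lambda>. \<forall>p\<in>good_primes \<B>.
        norm ((deriv ^^ r) (germ_at \<B> p l) s0) \<le> c * (ln (real (ideal_norm p)) ^ r / real (ideal_norm p))"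
    using WM by (simp add: well_mixed_def \<Lambda>_def \<T>_def s0_def)
  from choice[OF this] obtain c where c: "\<And>r. c r > 0" "\<And>r l p. l \<in> \<Lambda> \<Longrightarrow> p \<in> good_primes \<B> \<Longrightarrow>
        norm ((deriv ^^ r) (germ_at \<B> p l) s0) \<le> c r * (ln (real (ideal_norm p)) ^ r / real (ideal_norm p))"
    by blast
  define C where "C = C1 + C2 + C3 + C4 + (\<Sum>r<b. c r)"
  have cs: "(\<Sum>r<b. c r) \<ge> 0" using c(1) by (intro sum_nonneg) (auto intro: less_imp_le)
  have Cge: "C > 0" "C1 \<le> C" "C2 \<le> C" "C3 \<le> C" "C4 \<le> C" "\<And>r. r < b \<Longrightarrow> c r \<le> C"
  proof -
    show "C > 0" "C1 \<le> C" "C2 \<le> C" "C3 \<le> C" "C4 \<le> C" using C1 C2 C3 C4 cs by (auto simp: C_def)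
    fix r assume "r < b"
    then have "c r \<le> (\<Sum>r<b. c r)" using c(1) by (intro member_le_sum) (auto intro: less_imp_le)
    then show "c r \<le> C" using C1 C2 C3 C4 by (simp add: C_def)
  qed
  have gp: "good_primes \<B> \<subseteq> primes" by (auto simp: good_primes_def)
  have N2: "real (ideal_norm p) \<ge> 2" if "p \<in> good_primes \<B>" for p
    using ideal_norm_ge_2[of p] gp that by auto
  have "jet_model (good_primes \<B>) (\<lambda>p. real (ideal_norm p)) \<Lambda> b G (germ_jet \<B>) C \<alpha>"
  proof
    show "real (ideal_norm p) \<ge> 2" if "p \<in> good_primes \<B>" for p by (rule N2[OF that])
    show finY: "finite {p \<in> good_primes \<B>. real (ideal_norm p) \<le> Y}" for Y
      using gp by (intro finite_subset[OF _ finite_primes_norm_le[of Y]]) auto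
    show "C > 0" by (rule Cge)
    show "(\<Sum>p | p \<in> good_primes \<B> \<and> real (ideal_norm p) \<le> Y. ln (real (ideal_norm p)) / real (ideal_norm p)) \<le> C * ln Y"
      if Y: "2 \<le> Y" for Y
    proof -
      have "(\<Sum>p | p \<in> good_primes \<B> \<and> real (ideal_norm p) \<le> Y. ln (real (ideal_norm p)) / real (ideal_norm p))
        \<le> (\<Sum>P | P \<in> primes \<and> real (ideal_norm (P :: 'k set)) \<le> Y. ln (real (ideal_norm P)) / real (ideal_norm P))"
      proof (rule sum_mono2)
        show "finite {P. P \<in> primes \<and> real (ideal_norm (P :: 'k set)) \<le> Y}" using finite_primes_norm_le[of Y] .
        show "0 \<le> ln (real (ideal_norm p)) / real (ideal_norm p)"
          if "p \<in> {P. P \<in> primes \<and> real (ideal_norm P) \<le> Y} - {p. p \<in> good_primes \<B> \<and> real (ideal_norm p) \<le> Y}" for p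
          using ideal_norm_ge_2[of p] that by simp
      qed (use gp in auto)
      also have "\<dots> \<le> C1 * ln Y" by (rule C1(2)[OF Y])
      also have "\<dots> \<le> C * ln Y" using Cge Y by (intro mult_right_mono) auto
      finally show ?thesis .
    qed
    show "(\<Sum>p\<in>T. real (ideal_norm p) powr (- 1 - \<alpha>)) \<le> C" if "finite T" "T \<subseteq> good_primes \<B>" for T
      using C3(2)[of T] that gp Cge by force
    show "(\<Sum>p\<in>T. real (ideal_norm p) powr (- 2)) \<le> C" if "finite T" "T \<subseteq> good_primes \<B>" for T
      using C4(2)[of T] that gp Cge by force
    show "finite \<Lambda>" "1 \<le> b" "fps_nth (\<Sum>l\<in>\<Lambda>. G l) 0 \<noteq> 0" by fact+
    show "norm (fps_nth (germ_jet \<B> p l) r) \<le> C * (ln (real (ideal_norm p)) ^ r / real (ideal_norm p))"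
      if "l \<in> \<Lambda>" "p \<in> good_primes \<B>" "r < b" for l p r
    proof -
      have "norm (fps_nth (germ_jet \<B> p l) r) = norm ((deriv ^^ r) (germ_at \<B> p l) s0) / fact r"
        by (simp add: fps_expansion_def s0_def norm_divide)
      also have "\<dots> \<le> norm ((deriv ^^ r) (germ_at \<B> p l) s0) / 1"
        by (intro divide_left_mono) auto
      also have "\<dots> \<le> c r * (ln (real (ideal_norm p)) ^ r / real (ideal_norm p))" using c(2)[OF that(1,2)] by simp
      also have "\<dots> \<le> C * (ln (real (ideal_norm p)) ^ r / real (ideal_norm p))"
        using Cge that N2[of p] by (intro mult_right_mono) auto
      finally show ?thesis .
    qed
    show "norm (fps_nth (germ_jet \<B> p l) 0 - fps_nth (germ_jet \<B> p l') 0) \<le> C * real (ideal_norm p) powr (- 1 - \<alpha>)"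
      if "l \<in> \<Lambda>" "l' \<in> \<Lambda>" "fps_nth (G l) 0 \<noteq> 0" "fps_nth (G l') 0 \<noteq> 0" "p \<in> good_primes \<B>" for l l' p
    proof -
      have "norm (germ_at \<B> p l s0 - germ_at \<B> p l' s0) \<le> C2 * real (ideal_norm p) powr (- 1 - \<alpha>)"
        using that heavy by (intro C2(3)) auto
      also have "\<dots> \<le> C * real (ideal_norm p) powr (- 1 - \<alpha>)" using Cge by (intro mult_right_mono) auto
      finally show ?thesis by (simp add: fps_expansion_def s0_def)
    qed
  qed
  then show ?thesis using that moment wl by (simp add: \<T>_def \<Lambda>_def b_def)
qed

section \<open>The truncation level\<close>

text \<open>Moments up to order \<open>n\<close> are controlled for primes of norm at most \<open>X powr \<psi> X\<close> with
  \<open>\<psi> X = (ln ln X) powr (- 1/2 + \<delta>/2)\<close>: the error term beats any power of \<open>X powr \<psi> X\<close>, while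
  \<open>1 / \<psi> X = o (sqrt (ln ln X))\<close>.\<close>

lemma truncation_error_tendsto_0:
  fixes \<delta> a K :: real
  assumes \<delta>: "0 < \<delta>" "\<delta> \<le> 1/4" and a: "a \<ge> 0"
  defines "\<psi> \<equiv> \<lambda>X. ln (ln X) powr (- (1/2) + \<delta> / 2)"
  shows "((\<lambda>X. (a * (X powr \<psi> X)\<^sup>2 + a * ln (ln X)) ^ j *
     ((X powr \<psi> X) powr K * exp (- (ln X / ln (ln X) powr (1/2 - \<delta>))))) \<longlongrightarrow> 0) at_top"
proof (rule Lim_null_comparison)
  \<comment> \<open>The exponent of \<open>X powr \<psi> X\<close> in the whole expression.\<close>
  define L where "L = 2 * real j + \<bar>K\<bar>"
  have L: "L \<ge> 0" by (simp add: L_def)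
  have "((\<lambda>y::real. y powr (- \<delta> / 2)) \<longlongrightarrow> 0) at_top" using \<delta> by real_asymp
  then have "((\<lambda>y::real. L * y powr (- \<delta> / 2)) \<longlongrightarrow> L * 0) at_top" by (intro tendsto_intros)
  then have "\<forall>\<^sub>F y in at_top. L * y powr (- \<delta> / 2) < 1/2" by (rule order_tendstoD) simp
  then have "\<forall>\<^sub>F X in at_top. L * ln (ln X) powr (- \<delta> / 2) < 1/2"
    by (rule eventually_compose_filterlim[OF _ filterlim_ln_ln])
  moreover have "\<forall>\<^sub>F X::real in at_top. ln (ln X) \<ge> 1" by real_asymp
  moreover have "\<forall>\<^sub>F X::real in at_top. ln X \<ge> 1" by real_asymp
  ultimately show "\<forall>\<^sub>F X in at_top. norm ((a * (X powr \<psi> X)\<^sup>2 + a * ln (ln X)) ^ j *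
     ((X powr \<psi> X) powr K * exp (- (ln X / ln (ln X) powr (1/2 - \<delta>)))))
     \<le> (2 * a) ^ j * exp (real j * ln (ln X) - 1/2 * ln X / sqrt (ln (ln X)))"
    using eventually_ge_at_top[of 1]
  proof eventually_elim
    case (elim X)
    define y where "y = ln (ln X)"
    define Z where "Z = X powr \<psi> X"
    have y: "y \<ge> 1" and x: "ln X \<ge> 1" and X: "X \<ge> 1" using elim by (auto simp: y_def)
    have psi: "\<psi> X = y powr (- (1/2) + \<delta> / 2)" by (simp add: \<psi>_def y_def)
    have Z1: "Z \<ge> 1" unfolding Z_def using X by (simp add: ge_one_powr_ge_zero psi)
    have lnZ: "ln Z = \<psi> X * ln X" unfolding Z_def using X by (simp add: ln_powr)
    have base: "a * Z\<^sup>2 + a * y \<le> 2 * a * (Z\<^sup>2 * exp y)"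
    proof -
      have "1 \<le> exp y" using y by simp
      have "1 \<le> Z\<^sup>2" using Z1 by simp
      have "Z\<^sup>2 * 1 \<le> Z\<^sup>2 * exp y" using \<open>1 \<le> exp y\<close> by (intro mult_left_mono) auto
      moreover have "1 * y \<le> Z\<^sup>2 * exp y"
        using \<open>1 \<le> Z\<^sup>2\<close> exp_ge_add_one_self[of y] y by (intro mult_mono) linarith+
      ultimately have "Z\<^sup>2 + y \<le> 2 * (Z\<^sup>2 * exp y)" by linarith
      from mult_left_mono[OF this a] show ?thesis by (simp add: algebra_simps)
    qed
    have "(a * Z\<^sup>2 + a * y) ^ j \<le> (2 * a * (Z\<^sup>2 * exp y)) ^ j"
      using base a y by (intro power_mono) auto
    also have "\<dots> = (2 * a) ^ j * (Z powr (2 * real j) * exp (real j * y))"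
    proof -
      have "(Z\<^sup>2) ^ j = Z powr (2 * real j)"
        using Z1 powr_realpow[of Z "2 * j"] by (simp add: power_mult)
      then show ?thesis by (simp add: power_mult_distrib exp_of_nat_mult)
    qed
    finally have 1: "(a * Z\<^sup>2 + a * y) ^ j \<le> (2 * a) ^ j * (Z powr (2 * real j) * exp (real j * y))" .
    have "Z powr (2 * real j) * Z powr K \<le> Z powr L"
      unfolding powr_add[symmetric] L_def using Z1 by (intro powr_mono) auto
    also have "Z powr L = exp (L * (\<psi> X * ln X))" using Z1 by (simp add: powr_def lnZ)
    finally have 2: "Z powr (2 * real j) * Z powr K \<le> exp (L * (\<psi> X * ln X))" .
    have "L * \<psi> X = L * y powr (- \<delta> / 2) * y powr (- (1/2) + \<delta>)"
      by (simp add: psi mult.assoc powr_add[symmetric])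
    also have "\<dots> \<le> 1/2 * y powr (- (1/2) + \<delta>)"
      using elim unfolding y_def[symmetric] by (intro mult_right_mono) auto
    finally have "L * (\<psi> X * ln X) \<le> 1/2 * y powr (- (1/2) + \<delta>) * ln X"
      using x mult_right_mono[of "L * \<psi> X" "1/2 * y powr (- (1/2) + \<delta>)" "ln X"] by (simp add: mult.assoc)
    moreover have "ln X / y powr (1/2 - \<delta>) = y powr (- (1/2) + \<delta>) * ln X"
    proof -
      have "y powr (1/2 - \<delta>) = y powr (- (- (1/2) + \<delta>))" by (simp add: algebra_simps)
      also have "\<dots> = 1 / y powr (- (1/2) + \<delta>)" by (rule powr_minus_divide)
      finally show ?thesis by (simp only:) simp
    qed
    ultimately have "L * (\<psi> X * ln X) - ln X / y powr (1/2 - \<delta>) \<le> - (1/2 * (y powr (- (1/2) + \<delta>) * ln X))" by linarith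
    also have "\<dots> \<le> - (1/2 * (ln X / sqrt y))"
    proof -
      have "1 / sqrt y = y powr (- (1/2))" using y by (simp add: powr_minus_divide powr_half_sqrt)
      also have "\<dots> \<le> y powr (- (1/2) + \<delta>)" using y \<delta> by (intro powr_mono) auto
      finally have "1 / sqrt y * ln X \<le> y powr (- (1/2) + \<delta>) * ln X" using x by (intro mult_right_mono) auto
      then show ?thesis by simp
    qed
    finally have 3: "L * (\<psi> X * ln X) - ln X / y powr (1/2 - \<delta>) \<le> - (1/2 * (ln X / sqrt y))" .
    have "(a * Z\<^sup>2 + a * y) ^ j * (Z powr K * exp (- (ln X / y powr (1/2 - \<delta>))))
      \<le> ((2 * a) ^ j * (Z powr (2 * real j) * exp (real j * y))) * (Z powr K * exp (- (ln X / y powr (1/2 - \<delta>))))"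
      using 1 by (intro mult_right_mono) auto
    also have "\<dots> = (2 * a) ^ j * (exp (real j * y) * ((Z powr (2 * real j) * Z powr K) * exp (- (ln X / y powr (1/2 - \<delta>)))))"
      by (simp add: mult_ac)
    also have "\<dots> \<le> (2 * a) ^ j * (exp (real j * y) * (exp (L * (\<psi> X * ln X)) * exp (- (ln X / y powr (1/2 - \<delta>)))))"
      using 2 a by (intro mult_left_mono mult_right_mono) auto
    also have "\<dots> = (2 * a) ^ j * (exp (real j * y) * exp (L * (\<psi> X * ln X) - ln X / y powr (1/2 - \<delta>)))"
      by (simp add: exp_add[symmetric])
    also have "\<dots> \<le> (2 * a) ^ j * (exp (real j * y) * exp (- (1/2 * (ln X / sqrt y))))"
      using 3 a by (intro mult_left_mono) auto
    also have "\<dots> = (2 * a) ^ j * exp (real j * y - 1/2 * ln X / sqrt y)" by (simp add: exp_add[symmetric])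
    finally show ?case using a y unfolding Z_def y_def[symmetric] by (simp add: abs_mult)
  qed
  have "((\<lambda>X. exp (real j * ln (ln X) - 1/2 * ln X / sqrt (ln (ln X)))) \<longlongrightarrow> 0) at_top"
  proof (rule Lim_null_comparison)
    have "((\<lambda>X::real. 4 * ln (ln X) * sqrt (ln (ln X)) / ln X) \<longlongrightarrow> 0) at_top" by real_asymp
    then have "((\<lambda>X::real. real j * (4 * ln (ln X) * sqrt (ln (ln X)) / ln X)) \<longlongrightarrow> 0) at_top"
      by (rule tendsto_mult_right_zero)
    then have "\<forall>\<^sub>F X in at_top. real j * (4 * ln (ln X) * sqrt (ln (ln X)) / ln X) < 1"
      by (rule order_tendstoD) simp
    moreover have "\<forall>\<^sub>F X::real in at_top. ln (ln X) \<ge> 1" by real_asymp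
    moreover have "\<forall>\<^sub>F X::real in at_top. ln X \<ge> 1" by real_asymp
    ultimately show "\<forall>\<^sub>F X in at_top. norm (exp (real j * ln (ln X) - 1/2 * ln X / sqrt (ln (ln X))))
        \<le> exp (- (1/4) * (ln X / sqrt (ln (ln X))))"
    proof eventually_elim
      case (elim X)
      have "0 < ln (ln X)" "0 < ln X" using elim by linarith+
      then have "0 < sqrt (ln (ln X))" "0 < ln X" by (simp_all only: real_sqrt_gt_zero)
      then have "real j * ln (ln X) \<le> ln X / (4 * sqrt (ln (ln X)))"
        using elim(1) by (simp add: pos_le_divide_eq divide_less_eq mult_ac)
      then have "real j * ln (ln X) \<le> 1/4 * ln X / sqrt (ln (ln X))" by simp
      then show ?case by simp
    qed
    show "((\<lambda>X::real. exp (- (1/4) * (ln X / sqrt (ln (ln X))))) \<longlongrightarrow> 0) at_top" by real_asymp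
  qed
  from tendsto_mult_right_zero[OF this]
  show "((\<lambda>X. (2 * a) ^ j * exp (real j * ln (ln X) - 1/2 * ln X / sqrt (ln (ln X)))) \<longlongrightarrow> 0) at_top" .
qed

section \<open>Divisibility frequencies in a reasonable sequence\<close>

locale reasonable_setting =
  jet_model "good_primes \<B>" "\<lambda>p. real (ideal_norm p)" "params (mixture_of \<B>)" "pole_order (mixture_of \<B>)" G "germ_jet \<B>" C \<alpha>
  for \<F> :: "('i, 'k::number_field) ideal_seq" and \<B> :: "('l, 'k) bernoulli" and G and C \<alpha> :: real +
  assumes ordered: "ordered_ideal_seq \<F>" and nonempty: "indices \<F> \<noteq> {}"
    and few: "few_large_primes \<F>" and approx: "moments_approx \<F> \<B>"
    and finite_bad: "finite (bad_primes \<B>)"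
    and moment: "X > 0 \<Longrightarrow> set P \<subseteq> good_primes \<B> \<Longrightarrow> algebraic_moment \<B> X P = J (ln X) (\<lambda>l. \<Prod>p\<in>set P. germ_jet \<B> p l)"
begin

abbreviation N :: "'k set \<Rightarrow> real" where "N p \<equiv> real (ideal_norm p)"

abbreviation members :: "real \<Rightarrow> 'i set" where "members X \<equiv> seq_upto \<F> X"

abbreviation freq :: "'k set \<Rightarrow> real \<Rightarrow> real" where "freq p X \<equiv> divisor_freq \<F> [p] X"

text \<open>Infinite sums over primes reduce to this finite set.\<close>

definition occurring :: "real \<Rightarrow> 'k set set" where
  "occurring X = {p\<in>primes. \<exists>i\<in>members X. ideal_dvd p (ideal_at \<F> i)}"

lemma good_subset: "good_primes \<B> \<subseteq> primes"
  by (auto simp: good_primes_def)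

lemma finite_members: "finite (members X)"
proof (cases "X > 0")
  case True
  then show ?thesis using ordered by (simp add: ordered_ideal_seq_def)
next
  case False
  then have "members X = {}" using ordered by (force simp: ordered_ideal_seq_def seq_upto_def)
  then show ?thesis by simp
qed

lemma eventually_members: "\<forall>\<^sub>F X in at_top. members X \<noteq> {}"
proof -
  obtain i where i: "i \<in> indices \<F>" using nonempty by auto
  show ?thesis using eventually_ge_at_top[of "ideal_seq.height \<F> i"]
    by eventually_elim (use i in \<open>auto simp: seq_upto_def\<close>)
qed

lemma finite_divisors: "i \<in> members X \<Longrightarrow> finite {p\<in>primes. ideal_dvd p (ideal_at \<F> i)}"
  using ordered by (intro finite_prime_divisors) (auto simp: ordered_ideal_seq_def seq_upto_def)

lemma finite_occurring: "finite (occurring X)"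
proof -
  have "occurring X = (\<Union>i\<in>members X. {p\<in>primes. ideal_dvd p (ideal_at \<F> i)})" by (auto simp: occurring_def)
  then show ?thesis using finite_members finite_divisors by auto
qed

lemma freq_bounds: "0 \<le> freq p X" "freq p X \<le> 1"
proof -
  show "0 \<le> freq p X" by (simp add: divisor_freq_def)
  have "card {i \<in> members X. \<forall>\<pp>\<in>set [p]. ideal_dvd \<pp> (ideal_at \<F> i)} \<le> card (members X)"
    by (intro card_mono finite_members) auto
  then show "freq p X \<le> 1" unfolding divisor_freq_def
    by (cases "card (members X) = 0") (simp_all only: divide_le_eq_1 of_nat_le_iff of_nat_0 div_by_0 of_nat_0_less_iff, simp_all)
qed

lemma freq_eq_0: "p \<in> primes \<Longrightarrow> p \<notin> occurring X \<Longrightarrow> freq p X = 0"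
proof -
  assume "p \<in> primes" "p \<notin> occurring X"
  then have e: "{i \<in> members X. \<forall>\<pp>\<in>set [p]. ideal_dvd \<pp> (ideal_at \<F> i)} = {}" by (auto simp: occurring_def)
  show ?thesis unfolding divisor_freq_def e by simp
qed

lemma infsum_primes_eq:
  assumes "\<And>p. p \<in> primes \<Longrightarrow> p \<notin> occurring X \<Longrightarrow> u p = (0::real)"
  shows "(\<Sum>\<^sub>\<infinity>p\<in>primes. u p) = (\<Sum>p\<in>occurring X. u p)"
proof -
  have "(\<Sum>\<^sub>\<infinity>p\<in>primes. u p) = (\<Sum>\<^sub>\<infinity>p\<in>occurring X. u p)"
    using assms by (intro infsum_cong_neutral) (auto simp: occurring_def)
  then show ?thesis by (simp add: infsum_finite finite_occurring)
qed

text \<open>Summing frequencies over a set of primes counts, on average over the members, the prime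
  divisors that lie in this set.\<close>

lemma freq_sum_le:
  assumes "\<And>i. i \<in> members X \<Longrightarrow> real (card {p\<in>primes. ideal_dvd p (ideal_at \<F> i) \<and> p \<in> Z}) \<le> K" and K: "K \<ge> 0"
  shows "(\<Sum>p\<in>occurring X \<inter> Z. freq p X) \<le> K"
proof (cases "members X = {}")
  case True
  then show ?thesis using K by (simp add: occurring_def)
next
  case False
  let ?W = "occurring X \<inter> Z"
  have fW: "finite ?W" using finite_occurring by simp
  have "(\<Sum>p\<in>?W. real (card {i\<in>members X. ideal_dvd p (ideal_at \<F> i)}))
      = (\<Sum>p\<in>?W. \<Sum>i\<in>members X. if ideal_dvd p (ideal_at \<F> i) then 1 else 0)"
    by (intro sum.cong refl) (simp add: sum.inter_filter[OF finite_members, symmetric])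
  also have "\<dots> = (\<Sum>i\<in>members X. \<Sum>p\<in>?W. if ideal_dvd p (ideal_at \<F> i) then 1 else 0)" by (rule sum.swap)
  also have "\<dots> \<le> (\<Sum>i\<in>members X. K)"
  proof (rule sum_mono)
    fix i assume i: "i \<in> members X"
    have "(\<Sum>p\<in>?W. if ideal_dvd p (ideal_at \<F> i) then 1 else 0) = real (card {p\<in>?W. ideal_dvd p (ideal_at \<F> i)})"
      using fW by (simp add: sum.inter_filter[symmetric])
    also have "\<dots> \<le> real (card {p\<in>primes. ideal_dvd p (ideal_at \<F> i) \<and> p \<in> Z})"
      using finite_divisors[OF i] by (intro of_nat_mono card_mono) (auto simp: occurring_def elim: rev_finite_subset)
    also have "\<dots> \<le> K" by (rule assms(1)[OF i])
    finally show "(\<Sum>p\<in>?W. if ideal_dvd p (ideal_at \<F> i) then 1 else 0) \<le> K" .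
  qed
  finally have "(\<Sum>p\<in>?W. real (card {i\<in>members X. ideal_dvd p (ideal_at \<F> i)})) \<le> real (card (members X)) * K" by simp
  moreover have "real (card (members X)) > 0" using False finite_members by (simp add: card_gt_0_iff)
  ultimately have "(\<Sum>p\<in>?W. real (card {i\<in>members X. ideal_dvd p (ideal_at \<F> i)})) / real (card (members X)) \<le> K"
    by (simp add: divide_le_eq mult.commute)
  then show ?thesis by (simp add: divisor_freq_def sum_divide_distrib)
qed

definition truncation :: "nat \<Rightarrow> (real \<Rightarrow> real) \<Rightarrow> (real \<Rightarrow> real) \<Rightarrow> bool" where
  "truncation n \<psi> err \<longleftrightarrow>
     (\<forall>\<^sub>F X in at_top. 0 < \<psi> X \<and> \<psi> X \<le> 1 \<and> \<psi> X * ln X \<ge> 1 \<and> 0 \<le> err X \<and>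
        (\<forall>P. set P \<subseteq> {p\<in>good_primes \<B>. N p \<le> X powr \<psi> X} \<longrightarrow> length P \<le> n \<longrightarrow>
          norm (of_real (divisor_freq \<F> P X) - J (ln X) (\<lambda>l. \<Prod>p\<in>set P. germ_jet \<B> p l)) \<le> err X)) \<and>
     ((\<lambda>X. 1 / \<psi> X / sqrt (ln (ln X))) \<longlongrightarrow> 0) at_top \<and>
     (\<forall>a\<ge>0. \<forall>j. ((\<lambda>X. (a * (X powr \<psi> X)\<^sup>2 + a * ln (ln X)) ^ j * err X) \<longlongrightarrow> 0) at_top)"

lemma truncation_bounds:
  "truncation n \<psi> err \<Longrightarrow> \<forall>\<^sub>F X in at_top. 0 < \<psi> X \<and> \<psi> X \<le> 1 \<and> \<psi> X * ln X \<ge> 1 \<and> 0 \<le> err X"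
  unfolding truncation_def by (auto elim: eventually_mono)

text \<open>For orders up to \<open>n\<close> the worst of the finitely many exponents \<open>A\<^sub>m\<close> and \<open>\<delta>\<^sub>m\<close> are used. The cap \<open>1/4\<close>
  on \<open>\<delta>\<close> keeps \<open>\<psi> \<le> 1\<close>.\<close>

lemma truncation_exists: "\<exists>\<psi> err. truncation n \<psi> err"
proof -
  obtain C0 where C0: "C0 > 0" "\<forall>m. \<exists>A>0. \<exists>\<delta>>0. \<forall>P X.
        length P = m \<and> set P \<subseteq> good_primes \<B> \<and> X \<ge> threshold \<B> \<and> seq_upto \<F> X \<noteq> {} \<longrightarrow>
        norm (of_real (divisor_freq \<F> P X) - algebraic_moment \<B> X P)
          \<le> C0 * ((\<Prod>\<pp>\<leftarrow>P. N \<pp> powr A) * exp (- (ln X / ln (ln X) powr (1/2 - \<delta>))))"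
    using approx unfolding moments_approx_def by blast
  from choice[OF C0(2)] obtain A where "\<forall>m. A m > 0 \<and> (\<exists>\<delta>>0. \<forall>P X.
        length P = m \<and> set P \<subseteq> good_primes \<B> \<and> X \<ge> threshold \<B> \<and> seq_upto \<F> X \<noteq> {} \<longrightarrow>
        norm (of_real (divisor_freq \<F> P X) - algebraic_moment \<B> X P)
          \<le> C0 * ((\<Prod>\<pp>\<leftarrow>P. N \<pp> powr A m) * exp (- (ln X / ln (ln X) powr (1/2 - \<delta>)))))" by blast
  then have A: "\<And>m. A m > 0" and "\<forall>m. \<exists>\<delta>>0. \<forall>P X.
        length P = m \<and> set P \<subseteq> good_primes \<B> \<and> X \<ge> threshold \<B> \<and> seq_upto \<F> X \<noteq> {} \<longrightarrow>
        norm (of_real (divisor_freq \<F> P X) - algebraic_moment \<B> X P)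
          \<le> C0 * ((\<Prod>\<pp>\<leftarrow>P. N \<pp> powr A m) * exp (- (ln X / ln (ln X) powr (1/2 - \<delta>))))" by blast+
  from choice[OF this(2)] obtain \<delta> where \<delta>: "\<And>m. \<delta> m > 0" and est: "\<And>P X.
        set P \<subseteq> good_primes \<B> \<Longrightarrow> X \<ge> threshold \<B> \<Longrightarrow> seq_upto \<F> X \<noteq> {} \<Longrightarrow>
        norm (of_real (divisor_freq \<F> P X) - algebraic_moment \<B> X P)
          \<le> C0 * ((\<Prod>\<pp>\<leftarrow>P. N \<pp> powr A (length P)) * exp (- (ln X / ln (ln X) powr (1/2 - \<delta> (length P)))))"
    by blast
  define d where "d = Min (insert (1/4) (\<delta> ` {..n}))"
  have d: "0 < d" "d \<le> 1/4" "\<And>m. m \<le> n \<Longrightarrow> d \<le> \<delta> m"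
  proof -
    show "0 < d" unfolding d_def using \<delta> by (subst Min_gr_iff) auto
    show "d \<le> 1/4" "\<And>m. m \<le> n \<Longrightarrow> d \<le> \<delta> m" unfolding d_def by (intro Min_le; simp)+
  qed
  define a where "a = (\<Sum>m\<le>n. A m)"
  have a: "a \<ge> 0" "\<And>m. m \<le> n \<Longrightarrow> A m \<le> a"
  proof -
    show "a \<ge> 0" unfolding a_def using A by (intro sum_nonneg) (auto intro: less_imp_le)
    show "A m \<le> a" if "m \<le> n" for m
      unfolding a_def using A that by (intro member_le_sum) (auto intro: less_imp_le)
  qed
  define \<psi> where "\<psi> = (\<lambda>X. ln (ln X) powr (- (1/2) + d / 2))"
  define err where "err = (\<lambda>X. C0 * ((X powr \<psi> X) powr (a * real n) * exp (- (ln X / ln (ln X) powr (1/2 - d)))))"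
  have "\<forall>\<^sub>F X::real in at_top. ln (ln X) \<ge> 1" by real_asymp
  moreover have "\<forall>\<^sub>F X::real in at_top. ln X / sqrt (ln (ln X)) \<ge> 1" by real_asymp
  moreover have "\<forall>\<^sub>F X in at_top. X \<ge> max 10 (threshold \<B>)" by (rule eventually_ge_at_top)
  ultimately have "\<forall>\<^sub>F X in at_top. 0 < \<psi> X \<and> \<psi> X \<le> 1 \<and> \<psi> X * ln X \<ge> 1 \<and> 0 \<le> err X \<and>
        (\<forall>P. set P \<subseteq> {p\<in>good_primes \<B>. N p \<le> X powr \<psi> X} \<longrightarrow> length P \<le> n \<longrightarrow>
          norm (of_real (divisor_freq \<F> P X) - J (ln X) (\<lambda>l. \<Prod>p\<in>set P. germ_jet \<B> p l)) \<le> err X)"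
    using eventually_members
  proof eventually_elim
    case (elim X)
    have y: "ln (ln X) \<ge> 1" and X: "X \<ge> 10" "X \<ge> threshold \<B>" using elim by auto
    have ps: "0 < \<psi> X" using y by (simp add: \<psi>_def)
    have "\<psi> X \<le> ln (ln X) powr 0" unfolding \<psi>_def using y d by (intro powr_mono) auto
    then have ps1: "\<psi> X \<le> 1" using y by (simp split: if_splits)
    have "1 / sqrt (ln (ln X)) = ln (ln X) powr (- (1/2))"
      using y by (simp add: powr_minus_divide powr_half_sqrt)
    also have "\<dots> \<le> \<psi> X" unfolding \<psi>_def using y d by (intro powr_mono) auto
    finally have "1 / sqrt (ln (ln X)) * ln X \<le> \<psi> X * ln X" using X by (intro mult_right_mono) auto
    then have pl: "\<psi> X * ln X \<ge> 1" using elim by simp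
    define Z where "Z = X powr \<psi> X"
    have Z: "Z \<ge> 1" unfolding Z_def using X ps by (intro ge_one_powr_ge_zero) auto
    have "norm (of_real (divisor_freq \<F> P X) - J (ln X) (\<lambda>l. \<Prod>p\<in>set P. germ_jet \<B> p l)) \<le> err X"
      if P: "set P \<subseteq> {p\<in>good_primes \<B>. N p \<le> Z}" "length P \<le> n" for P
    proof -
      have Pg: "set P \<subseteq> good_primes \<B>" using P by auto
      have "norm (of_real (divisor_freq \<F> P X) - J (ln X) (\<lambda>l. \<Prod>p\<in>set P. germ_jet \<B> p l)) =
        norm (of_real (divisor_freq \<F> P X) - algebraic_moment \<B> X P)" using moment[OF _ Pg, of X] X by simp
      also have "\<dots> \<le> C0 * ((\<Prod>\<pp>\<leftarrow>P. N \<pp> powr A (length P)) * exp (- (ln X / ln (ln X) powr (1/2 - \<delta> (length P)))))"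
        by (rule est[OF Pg X(2) elim(4)])
      also have "\<dots> \<le> C0 * (Z powr (a * real n) * exp (- (ln X / ln (ln X) powr (1/2 - d))))"
      proof (intro mult_left_mono mult_mono)
        have "(\<Prod>\<pp>\<leftarrow>Q. N \<pp> powr A (length P)) \<le> Z powr (a * real (length Q))" if "set Q \<subseteq> set P" for Q
          using that
        proof (induction Q)
          case (Cons p Q)
          have p: "N p \<le> Z" "N p \<ge> 2" using Cons.prems P N_ge[of p] by auto
          have "N p powr A (length P) \<le> N p powr a" using p a(2)[OF P(2)] by (intro powr_mono) auto
          also have "\<dots> \<le> Z powr a" using p a by (intro powr_mono2) auto
          finally have "N p powr A (length P) \<le> Z powr a" .
          then have "(\<Prod>\<pp>\<leftarrow>p # Q. N \<pp> powr A (length P)) \<le> Z powr a * Z powr (a * real (length Q))"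
            using Cons by (auto intro!: mult_mono prod_list_nonneg)
          then show ?case by (simp add: powr_add[symmetric] algebra_simps)
        qed (use Z in simp)
        from this[of P] have "(\<Prod>\<pp>\<leftarrow>P. N \<pp> powr A (length P)) \<le> Z powr (a * real (length P))" by simp
        also have "\<dots> \<le> Z powr (a * real n)" using Z a P by (intro powr_mono mult_left_mono) auto
        finally show "(\<Prod>\<pp>\<leftarrow>P. N \<pp> powr A (length P)) \<le> Z powr (a * real n)" .
        have "ln (ln X) powr (1/2 - \<delta> (length P)) \<le> ln (ln X) powr (1/2 - d)"
          using y d(3)[OF P(2)] by (intro powr_mono) auto
        then have "ln X / ln (ln X) powr (1/2 - d) \<le> ln X / ln (ln X) powr (1/2 - \<delta> (length P))"
          using y X by (intro divide_left_mono mult_pos_pos) (auto simp: powr_gt_zero)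
        then show "exp (- (ln X / ln (ln X) powr (1/2 - \<delta> (length P)))) \<le> exp (- (ln X / ln (ln X) powr (1/2 - d)))" by simp
      qed (use C0(1) in auto)
      finally show ?thesis by (simp add: err_def Z_def)
    qed
    then show ?case using ps ps1 pl C0(1) by (simp add: err_def Z_def)
  qed
  moreover have "((\<lambda>X. 1 / \<psi> X / sqrt (ln (ln X))) \<longlongrightarrow> 0) at_top"
  proof -
    have "((\<lambda>y. 1 / y powr (- (1/2) + d / 2) / sqrt y) \<longlongrightarrow> 0) at_top" using d by real_asymp
    from filterlim_compose[OF this filterlim_ln_ln] show ?thesis by (simp add: \<psi>_def)
  qed
  moreover have "((\<lambda>X. (c * (X powr \<psi> X)\<^sup>2 + c * ln (ln X)) ^ j * err X) \<longlongrightarrow> 0) at_top" if "c \<ge> 0" for c j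
    using tendsto_mult_right_zero[OF truncation_error_tendsto_0[OF d(1,2) that, of j "a * real n"], of C0]
    by (simp only: err_def \<psi>_def mult_ac)
  ultimately show ?thesis unfolding truncation_def by blast
qed

text \<open>Since \<open>\<psi> X \<le> 1\<close> for large \<open>X\<close>, the minimum is eventually \<open>X powr \<psi> X\<close>; it guarantees \<open>N p \<le> X\<close> for
  all \<open>X\<close>.\<close>

definition small_primes :: "(real \<Rightarrow> real) \<Rightarrow> real \<Rightarrow> 'k set set" where
  "small_primes \<psi> X = {p\<in>good_primes \<B>. N p \<le> min X (X powr \<psi> X)}"

lemma finite_small_primes: "finite (small_primes \<psi> X)"
  by (rule finite_subset[OF _ fin_le[of X]]) (auto simp: small_primes_def)

lemma card_small_primes:
  assumes "X \<ge> 1" "\<psi> X \<ge> 0"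
  shows "real (card (small_primes \<psi> X)) \<le> 2 * C * (X powr \<psi> X)\<^sup>2"
proof -
  have "real (card (small_primes \<psi> X)) \<le> real (card {p\<in>good_primes \<B>. N p \<le> X powr \<psi> X})"
    by (intro of_nat_mono card_mono fin_le) (auto simp: small_primes_def)
  also have "\<dots> \<le> 2 * C * (X powr \<psi> X)\<^sup>2"
    using assms by (intro mertens_imp_card_bound N_ge fin_le C mertens ge_one_powr_ge_zero)
  finally show ?thesis .
qed

text \<open>The three kinds of errors that occur: large primes, bounded quantities, and the accumulated moment
  errors.\<close>

lemma negligible_if_bounded:
  fixes D :: "real \<Rightarrow> 'a::real_normed_field"
  assumes tr: "truncation n \<psi> err"
    and D: "\<forall>\<^sub>F X in at_top. norm (D X) \<le> K * (1 / \<psi> X + 1 + real (card (small_primes \<psi> X)) * err X)"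
    and K: "K \<ge> 0"
  shows "((\<lambda>X. D X / of_real (sqrt (ln (ln X)))) \<longlongrightarrow> 0) at_top"
proof (rule Lim_null_comparison)
  define E where "E X = (2 * C * (X powr \<psi> X)\<^sup>2 + 2 * C * ln (ln X)) ^ 1 * err X" for X
  have "2 * C \<ge> 0" using C by simp
  then have E: "(E \<longlongrightarrow> 0) at_top" unfolding E_def using tr unfolding truncation_def by blast
  have psi: "((\<lambda>X. 1 / \<psi> X / sqrt (ln (ln X))) \<longlongrightarrow> 0) at_top" using tr unfolding truncation_def by blast
  have "((\<lambda>X. 1 / sqrt (ln (ln X))) \<longlongrightarrow> 0) at_top" by real_asymp
  note s0 = this
  have "((\<lambda>X. K * (1 / \<psi> X / sqrt (ln (ln X)) + 1 / sqrt (ln (ln X)) + E X * (1 / sqrt (ln (ln X))))) \<longlongrightarrow> K * (0 + 0 + 0 * 0)) at_top"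
    by (intro tendsto_intros psi s0 E)
  then show "((\<lambda>X. K * (1 / \<psi> X / sqrt (ln (ln X)) + 1 / sqrt (ln (ln X)) + E X * (1 / sqrt (ln (ln X))))) \<longlongrightarrow> 0) at_top"
    by (simp only: mult_zero_right add_0)
  have "\<forall>\<^sub>F X::real in at_top. ln (ln X) \<ge> 1" by real_asymp
  moreover note truncation_bounds[OF tr]
  ultimately show "\<forall>\<^sub>F X in at_top. norm (D X / of_real (sqrt (ln (ln X)))) \<le>
      K * (1 / \<psi> X / sqrt (ln (ln X)) + 1 / sqrt (ln (ln X)) + E X * (1 / sqrt (ln (ln X))))"
    using D eventually_ge_at_top[of 1]
  proof eventually_elim
    case (elim X)
    have s: "sqrt (ln (ln X)) > 0" using elim(1) by (intro real_sqrt_gt_zero) linarith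
    have "real (card (small_primes \<psi> X)) * err X \<le> E X"
    proof -
      have "0 \<le> 2 * C * ln (ln X)" using C elim(1) by (intro mult_nonneg_nonneg) linarith+
      then have "real (card (small_primes \<psi> X)) \<le> (2 * C * (X powr \<psi> X)\<^sup>2 + 2 * C * ln (ln X)) ^ 1"
        using card_small_primes[of X \<psi>] elim by simp
      then show ?thesis unfolding E_def using elim by (intro mult_right_mono) auto
    qed
    then have "norm (D X) \<le> K * (1 / \<psi> X + 1 + E X)"
      using elim K by (intro order.trans[OF elim(3)] mult_left_mono) auto
    then have "norm (D X) / sqrt (ln (ln X)) \<le> K * (1 / \<psi> X + 1 + E X) / sqrt (ln (ln X))"
      using s by (intro divide_right_mono) auto
    then show ?case using s by (simp add: norm_divide add_divide_distrib distrib_left algebra_simps)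
  qed
qed

text \<open>The finitely many bad primes are counted with the large ones, which is harmless since \<open>1 / \<psi> X \<ge> 1\<close>.\<close>

lemma large_prime_divisors:
  assumes tr: "truncation n \<psi> err"
  shows "\<exists>K>0. \<forall>\<^sub>F X in at_top. \<forall>i\<in>members X.
    real (card {p\<in>primes. ideal_dvd p (ideal_at \<F> i) \<and> p \<notin> small_primes \<psi> X}) \<le> K * (1 / \<psi> X)"
proof -
  obtain K where K: "K > 0" "\<forall>\<^sub>F X in at_top. \<forall>\<psi>. 0 < \<psi> \<and> \<psi> \<le> 1 \<longrightarrow>
        (\<forall>i\<in>seq_upto \<F> X.
           real (card {\<pp>\<in>primes. ideal_dvd \<pp> (ideal_at \<F> i) \<and> real (ideal_norm \<pp>) > X powr \<psi>})
             \<le> K * (1 / \<psi>))"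
    using few unfolding few_large_primes_def by blast
  from K(2) truncation_bounds[OF tr] have "\<forall>\<^sub>F X in at_top. \<forall>i\<in>members X.
    real (card {p\<in>primes. ideal_dvd p (ideal_at \<F> i) \<and> p \<notin> small_primes \<psi> X}) \<le> (K + real (card (bad_primes \<B>))) * (1 / \<psi> X)"
    using eventually_ge_at_top[of 1]
  proof eventually_elim
    case (elim X)
    show ?case
    proof
      fix i assume i: "i \<in> members X"
      let ?L = "{p\<in>primes. ideal_dvd p (ideal_at \<F> i) \<and> N p > X powr \<psi> X}"
      have "X powr \<psi> X \<le> X powr 1" using elim by (intro powr_mono) auto
      then have "min X (X powr \<psi> X) = X powr \<psi> X" using elim by simp
      then have "{p\<in>primes. ideal_dvd p (ideal_at \<F> i) \<and> p \<notin> small_primes \<psi> X} \<subseteq> ?L \<union> bad_primes \<B>"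
        by (auto simp: small_primes_def good_primes_def)
      then have "card {p\<in>primes. ideal_dvd p (ideal_at \<F> i) \<and> p \<notin> small_primes \<psi> X} \<le> card (?L \<union> bad_primes \<B>)"
        using finite_divisors[OF i] finite_bad by (intro card_mono) (auto elim: rev_finite_subset)
      also have "\<dots> \<le> card ?L + card (bad_primes \<B>)" by (rule card_Un_le)
      finally have "real (card {p\<in>primes. ideal_dvd p (ideal_at \<F> i) \<and> p \<notin> small_primes \<psi> X}) \<le> real (card ?L) + real (card (bad_primes \<B>)) * 1" by simp
      also have "\<dots> \<le> K * (1 / \<psi> X) + real (card (bad_primes \<B>)) * (1 / \<psi> X)"
        using elim i by (intro add_mono mult_left_mono) auto
      finally show "real (card {p\<in>primes. ideal_dvd p (ideal_at \<F> i) \<and> p \<notin> small_primes \<psi> X}) \<le> (K + real (card (bad_primes \<B>))) * (1 / \<psi> X)"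
        by (simp add: algebra_simps)
    qed
  qed
  then show ?thesis using K(1) by (intro exI[of _ "K + real (card (bad_primes \<B>))"]) auto
qed

lemma large_freq_sum:
  assumes tr: "truncation n \<psi> err"
  shows "\<exists>K>0. \<forall>\<^sub>F X in at_top. (\<Sum>p\<in>occurring X - small_primes \<psi> X. freq p X) \<le> K * (1 / \<psi> X)"
proof -
  obtain K where K: "K > 0" "\<forall>\<^sub>F X in at_top. \<forall>i\<in>members X.
    real (card {p\<in>primes. ideal_dvd p (ideal_at \<F> i) \<and> p \<notin> small_primes \<psi> X}) \<le> K * (1 / \<psi> X)"
    using large_prime_divisors[OF tr] by blast
  from K(2) truncation_bounds[OF tr] have "\<forall>\<^sub>F X in at_top. (\<Sum>p\<in>occurring X - small_primes \<psi> X. freq p X) \<le> K * (1 / \<psi> X)"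
  proof eventually_elim
    case (elim X)
    then show ?case unfolding Diff_eq using K(1) by (intro freq_sum_le) auto
  qed
  then show ?thesis using K(1) by blast
qed

lemma sum_occurring_split:
  fixes u :: "'k set \<Rightarrow> real"
  assumes "\<And>p. p \<in> primes \<Longrightarrow> p \<notin> occurring X \<Longrightarrow> u p = 0"
  shows "(\<Sum>p\<in>occurring X. u p) = (\<Sum>p\<in>small_primes \<psi> X. u p) + (\<Sum>p\<in>occurring X - small_primes \<psi> X. u p)"
proof -
  have "(\<Sum>p\<in>occurring X. u p) = (\<Sum>p\<in>occurring X \<union> small_primes \<psi> X. u p)"
    using assms good_subset finite_occurring finite_small_primes
    by (intro sum.mono_neutral_left) (auto simp: small_primes_def)
  also have "\<dots> = (\<Sum>p\<in>small_primes \<psi> X \<union> (occurring X - small_primes \<psi> X). u p)"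
    by (intro sum.cong) auto
  also have "\<dots> = (\<Sum>p\<in>small_primes \<psi> X. u p) + (\<Sum>p\<in>occurring X - small_primes \<psi> X. u p)"
    using finite_occurring finite_small_primes by (intro sum.union_disjoint) auto
  finally show ?thesis .
qed

lemma freq_estimate:
  assumes l: "l \<in> heavy" and n: "n \<ge> 1" and tr: "truncation n \<psi> err"
  shows "\<exists>K>0. \<forall>\<^sub>F X in at_top. \<forall>p\<in>small_primes \<psi> X.
    norm (of_real (freq p X) - f p l) \<le> err X + K * (N p powr (- 1 - \<alpha>) + ln (N p) / (N p * ln X))"
proof -
  obtain K where K: "K > 0" "\<forall>\<^sub>F x in at_top. \<forall>p\<in>good_primes \<B>. ln (N p) \<le> x \<longrightarrow>
    norm (J x (germ_jet \<B> p) - f p l) \<le> K * (N p powr (- 1 - \<alpha>) + ln (N p) / (N p * x))"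
    using expectation_single[OF l] by blast
  have "\<forall>\<^sub>F X in at_top. \<forall>P. set P \<subseteq> {p\<in>good_primes \<B>. N p \<le> X powr \<psi> X} \<longrightarrow> length P \<le> n \<longrightarrow>
          norm (of_real (divisor_freq \<F> P X) - J (ln X) (\<lambda>l. \<Prod>p\<in>set P. germ_jet \<B> p l)) \<le> err X"
    using tr unfolding truncation_def by (auto elim: eventually_mono)
  with eventually_compose_filterlim[OF K(2) ln_at_top] have "\<forall>\<^sub>F X in at_top. \<forall>p\<in>small_primes \<psi> X.
    norm (of_real (freq p X) - f p l) \<le> err X + K * (N p powr (- 1 - \<alpha>) + ln (N p) / (N p * ln X))"
  proof eventually_elim
    case (elim X)
    show ?case
    proof
      fix p assume p: "p \<in> small_primes \<psi> X"
      then have pg: "p \<in> good_primes \<B>" "N p \<le> X" "N p \<le> X powr \<psi> X" by (auto simp: small_primes_def)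
      have "ln (N p) \<le> ln X" using pg N_ge[of p] by simp
      then have 1: "norm (J (ln X) (germ_jet \<B> p) - f p l) \<le> K * (N p powr (- 1 - \<alpha>) + ln (N p) / (N p * ln X))"
        using elim pg by blast
      have 2: "norm (of_real (freq p X) - J (ln X) (germ_jet \<B> p)) \<le> err X"
        using elim(2)[rule_format, of "[p]"] pg n by simp
      show "norm (of_real (freq p X) - f p l) \<le> err X + K * (N p powr (- 1 - \<alpha>) + ln (N p) / (N p * ln X))"
        using norm_triangle_ineq[of "of_real (freq p X) - J (ln X) (germ_jet \<B> p)" "J (ln X) (germ_jet \<B> p) - f p l"] 1 2
        by simp
    qed
  qed
  then show ?thesis using K(1) by blast
qed

lemma linear_bound:
  fixes a b c p t :: real
  assumes "a \<ge> 0" "b \<ge> 0" "c \<ge> 0" "p \<ge> 0" "t \<ge> 0"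
  shows "a * t + b + c * p \<le> (a + b + c) * (p + 1 + t)"
proof -
  have "(a + b + c) * (p + 1 + t) = (a * t + b + c * p) + (a * p + a + b * p + b * t + c + c * t)"
    by (simp add: algebra_simps)
  moreover have "0 \<le> a * p" "0 \<le> b * p" "0 \<le> b * t" "0 \<le> c * t" using assms by auto
  ultimately show ?thesis using assms by linarith
qed

lemma first_moment_small:
  assumes l: "l \<in> heavy" and n: "n \<ge> 1" and tr: "truncation n \<psi> err"
    and g: "\<And>p. p \<in> primes \<Longrightarrow> \<bar>g p\<bar> \<le> B" and B: "B \<ge> 0"
  shows "((\<lambda>X. (of_real (\<Sum>\<^sub>\<infinity>p\<in>primes. g p * freq p X) - (\<Sum>p\<in>small_primes \<psi> X. of_real (g p) * f p l))
      / of_real (sqrt (ln (ln X)))) \<longlongrightarrow> 0) at_top"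
proof -
  obtain K1 where K1: "K1 > 0" "\<forall>\<^sub>F X in at_top. (\<Sum>p\<in>occurring X - small_primes \<psi> X. freq p X) \<le> K1 * (1 / \<psi> X)"
    using large_freq_sum[OF tr] by blast
  obtain K2 where K2: "K2 > 0" "\<forall>\<^sub>F X in at_top. \<forall>p\<in>small_primes \<psi> X.
    norm (of_real (freq p X) - f p l) \<le> err X + K2 * (N p powr (- 1 - \<alpha>) + ln (N p) / (N p * ln X))"
    using freq_estimate[OF l n tr] by blast
  define K where "K = B * (K1 + 2 * K2 * C + 1)"
  note ev = truncation_bounds[OF tr]
  have "\<forall>\<^sub>F X in at_top. norm (of_real (\<Sum>\<^sub>\<infinity>p\<in>primes. g p * freq p X) - (\<Sum>p\<in>small_primes \<psi> X. of_real (g p) * f p l))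
      \<le> K * (1 / \<psi> X + 1 + real (card (small_primes \<psi> X)) * err X)"
    using K1(2) K2(2) ev eventually_ge_at_top[of 10]
  proof eventually_elim
    case (elim X)
    let ?T = "small_primes \<psi> X" and ?R = "occurring X - small_primes \<psi> X"
    have split: "(\<Sum>\<^sub>\<infinity>p\<in>primes. g p * freq p X) = (\<Sum>p\<in>?T. g p * freq p X) + (\<Sum>p\<in>?R. g p * freq p X)"
    proof -
      have z: "g p * freq p X = 0" if "p \<in> primes" "p \<notin> occurring X" for p using freq_eq_0[OF that] by simp
      show ?thesis using infsum_primes_eq[of X "\<lambda>p. g p * freq p X"] sum_occurring_split[of X "\<lambda>p. g p * freq p X" \<psi>] z by simp
    qed
    have "complex_of_real (\<Sum>\<^sub>\<infinity>p\<in>primes. g p * freq p X) - (\<Sum>p\<in>?T. of_real (g p) * f p l) =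
       (\<Sum>p\<in>?T. of_real (g p) * (of_real (freq p X) - f p l)) + of_real (\<Sum>p\<in>?R. g p * freq p X)"
      unfolding split by (simp add: sum_subtractf right_diff_distrib)
    also have "norm \<dots> \<le> norm (\<Sum>p\<in>?T. of_real (g p) * (of_real (freq p X) - f p l)) + norm (of_real (\<Sum>p\<in>?R. g p * freq p X) :: complex)"
      by (rule norm_triangle_ineq)
    also have "norm (\<Sum>p\<in>?T. of_real (g p) * (of_real (freq p X) - f p l)) \<le>
       (\<Sum>p\<in>?T. B * (err X + K2 * (N p powr (- 1 - \<alpha>) + ln (N p) / (N p * ln X))))"
    proof (rule sum_norm_le)
      fix p assume p: "p \<in> ?T"
      then have "p \<in> primes" using good_subset by (auto simp: small_primes_def)
      then show "norm (of_real (g p) * (of_real (freq p X) - f p l)) \<le> B * (err X + K2 * (N p powr (- 1 - \<alpha>) + ln (N p) / (N p * ln X)))"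
        unfolding norm_mult norm_of_real using g elim(2) p B by (intro mult_mono) auto
    qed
    also have "\<dots> = B * (real (card ?T) * err X + K2 * ((\<Sum>p\<in>?T. N p powr (- 1 - \<alpha>)) + (\<Sum>p\<in>?T. ln (N p) / (N p * ln X))))"
      by (simp add: sum_distrib_left[symmetric] sum.distrib)
    also have "\<dots> \<le> B * (real (card ?T) * err X + K2 * (C + C))"
      using B K2(1) elim finite_small_primes
      by (intro mult_left_mono add_left_mono add_mono powr_sum log_sum) (auto simp: small_primes_def)
    also have "norm (of_real (\<Sum>p\<in>?R. g p * freq p X) :: complex) \<le> (\<Sum>p\<in>?R. B * freq p X)"
      unfolding norm_of_real
    proof (rule order.trans[OF sum_abs sum_mono])
      fix p assume "p \<in> ?R"
      then have "p \<in> primes" by (auto simp: occurring_def)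
      then show "\<bar>g p * freq p X\<bar> \<le> B * freq p X"
        unfolding abs_mult using g freq_bounds[of p X] B by (intro mult_mono) auto
    qed
    also have "(\<Sum>p\<in>?R. B * freq p X) \<le> B * (K1 * (1 / \<psi> X))"
      unfolding sum_distrib_left[symmetric] using elim(1) B by (intro mult_left_mono) auto
    also have "B * (real (card ?T) * err X + K2 * (C + C)) + B * (K1 * (1 / \<psi> X))
        \<le> K * (1 / \<psi> X + 1 + real (card ?T) * err X)"
    proof -
      have nn: "0 \<le> 1 / \<psi> X" "0 \<le> real (card ?T) * err X" using elim by auto
      have "1 * (real (card ?T) * err X) + 2 * K2 * C + K1 * (1 / \<psi> X)
         \<le> (1 + 2 * K2 * C + K1) * (1 / \<psi> X + 1 + real (card ?T) * err X)"
        using nn K1 K2 C by (intro linear_bound) auto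
      from mult_left_mono[OF this B] show ?thesis by (simp add: K_def algebra_simps)
    qed
    finally show ?case by simp
  qed
  then show ?thesis
    by (rule negligible_if_bounded[OF tr]) (use B K1 K2 C in \<open>auto simp: K_def intro!: mult_nonneg_nonneg add_nonneg_nonneg\<close>)
qed

text \<open>Mertens' bound on \<open>(X powr \<psi> X, X]\<close> is \<open>O (1 + ln (1 / \<psi> X))\<close>.\<close>

lemma small_primes_vs_all:
  assumes l: "l \<in> heavy" and tr: "truncation n \<psi> err"
    and g: "\<And>p. p \<in> primes \<Longrightarrow> \<bar>g p\<bar> \<le> B" and B: "B \<ge> 0"
  shows "((\<lambda>X. (prime_sum \<B> g l X - (\<Sum>p\<in>small_primes \<psi> X. of_real (g p) * f p l))
      / of_real (sqrt (ln (ln X)))) \<longlongrightarrow> 0) at_top"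
proof -
  have l\<Lambda>: "l \<in> params (mixture_of \<B>)" using l by (simp add: heavy_def)
  note ev = truncation_bounds[OF tr]
  have "\<forall>\<^sub>F X in at_top. norm (prime_sum \<B> g l X - (\<Sum>p\<in>small_primes \<psi> X. of_real (g p) * f p l))
      \<le> (B * C * (8 * C)) * (1 / \<psi> X + 1 + real (card (small_primes \<psi> X)) * err X)"
    using ev eventually_ge_at_top[of 10]
  proof eventually_elim
    case (elim X)
    \<comment> \<open>The condition \<open>\<psi> X * ln X \<ge> 1\<close> makes \<open>Z \<ge> exp 1\<close>, so that the reciprocal sums from \<open>Z\<close> on apply.\<close>
    define Z where "Z = X powr \<psi> X"
    have "Z \<le> X powr 1" unfolding Z_def using elim by (intro powr_mono) auto
    then have ZX: "Z \<le> X" using elim by simp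
    have lnZ: "ln Z = \<psi> X * ln X" unfolding Z_def using elim by (simp add: ln_powr)
    have "exp 1 \<le> Z"
    proof -
      have "exp 1 \<le> exp (ln Z)" using elim lnZ by simp
      moreover have "Z > 0" using elim by (simp add: Z_def)
      ultimately show ?thesis by simp
    qed
    then have Z2: "Z \<ge> 2" using exp_ge_add_one_self[of 1] by linarith
    let ?A = "{p\<in>good_primes \<B>. N p \<le> X}" and ?T = "small_primes \<psi> X"
    have T: "?T = {p\<in>good_primes \<B>. N p \<le> Z}" using ZX by (auto simp: small_primes_def Z_def)
    have D: "?A - ?T = {p. p \<in> good_primes \<B> \<and> Z < N p \<and> N p \<le> X}" unfolding T by auto
    have "prime_sum \<B> g l X = (\<Sum>p\<in>?A. of_real (g p) * f p l)"
      by (simp add: prime_sum_def fps_expansion_def)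
    then have "prime_sum \<B> g l X - (\<Sum>p\<in>?T. of_real (g p) * f p l) = (\<Sum>p\<in>?A - ?T. of_real (g p) * f p l)"
      using fin_le[of X] ZX by (subst sum_diff) (auto simp: T)
    also have "norm \<dots> \<le> (\<Sum>p\<in>?A - ?T. B * (C * (1 / N p)))"
    proof (rule sum_norm_le)
      fix p assume "p \<in> ?A - ?T"
      then have p: "p \<in> good_primes \<B>" by auto
      then have pp: "p \<in> primes" using good_subset by auto
      show "norm (of_real (g p) * f p l) \<le> B * (C * (1 / N p))"
        unfolding norm_mult norm_of_real using g[OF pp] f_bound[OF l\<Lambda> p] B by (intro mult_mono) auto
    qed
    also have "\<dots> = B * C * (\<Sum>p\<in>?A - ?T. 1 / N p)" by (simp add: sum_distrib_left mult.assoc)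
    also have "\<dots> \<le> B * C * (8 * C * (1 + ln (ln X / ln Z)))"
      unfolding D using B C Z2 ZX by (intro mult_left_mono mertens_imp_reciprocal_sum N_ge fin_le mertens) auto
    also have "\<dots> \<le> B * C * (8 * C * (1 / \<psi> X + 1 + real (card ?T) * err X))"
    proof (intro mult_left_mono)
      have eq: "ln X / ln Z = 1 / \<psi> X" using elim by (simp add: lnZ)
      have "ln (1 / \<psi> X) \<le> 1 / \<psi> X - 1" using elim by (intro ln_le_minus_one) auto
      moreover have "0 \<le> real (card ?T) * err X" using elim by simp
      ultimately show "1 + ln (ln X / ln Z) \<le> 1 / \<psi> X + 1 + real (card ?T) * err X"
        unfolding eq by linarith
    qed (use B C in auto)
    finally show ?case by (simp only: mult.assoc)
  qed
  then show ?thesis by (rule negligible_if_bounded[OF tr]) (use B C in auto)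
qed

lemma first_moment:
  assumes l: "l \<in> heavy" and g: "\<And>p. p \<in> primes \<Longrightarrow> \<bar>g p\<bar> \<le> B" and B: "B \<ge> 0"
  shows "((\<lambda>X. (of_real (\<Sum>\<^sub>\<infinity>p\<in>primes. g p * freq p X) - prime_sum \<B> g l X)
      / of_real (sqrt (ln (ln X)))) \<longlongrightarrow> 0) at_top"
proof -
  obtain \<psi> err where tr: "truncation 1 \<psi> err" using truncation_exists by blast
  note 1 = first_moment_small[OF l order.refl tr, of g, OF g B] and 2 = small_primes_vs_all[OF l tr, of g, OF g B]
  from tendsto_diff[OF 1 2] show ?thesis by (simp add: diff_divide_distrib)
qed

text \<open>The square of a frequency of order \<open>1 / N p\<close> has a convergent sum, and for large primes the square is at
  most the frequency itself. Hence the variance is asymptotically the mean of \<open>\<omega>\<^sup>2\<close>.\<close>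

lemma square_sum_negligible:
  assumes g: "\<And>p. p \<in> primes \<Longrightarrow> \<bar>g p\<bar> \<le> B" and B: "B \<ge> 0"
  shows "((\<lambda>X. (\<Sum>\<^sub>\<infinity>p\<in>primes. g p * (freq p X)\<^sup>2) / sqrt (ln (ln X))) \<longlongrightarrow> 0) at_top"
proof -
  obtain l where l: "l \<in> heavy" using heavy_nonempty by auto
  then have l\<Lambda>: "l \<in> params (mixture_of \<B>)" by (simp add: heavy_def)
  obtain \<psi> err where tr: "truncation 1 \<psi> err" using truncation_exists by blast
  obtain K1 where K1: "K1 > 0" "\<forall>\<^sub>F X in at_top. (\<Sum>p\<in>occurring X - small_primes \<psi> X. freq p X) \<le> K1 * (1 / \<psi> X)"
    using large_freq_sum[OF tr] by blast
  obtain K2 where K2: "K2 > 0" "\<forall>\<^sub>F X in at_top. \<forall>p\<in>small_primes \<psi> X.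
    norm (of_real (freq p X) - f p l) \<le> err X + K2 * (N p powr (- 1 - \<alpha>) + ln (N p) / (N p * ln X))"
    using freq_estimate[OF l order.refl tr] by blast
  define K where "K = B * ((1 + C) + ((1 + C) * (K2 * (C + C)) + C\<^sup>2 * C) + K1)"
  have K: "K \<ge> 0" unfolding K_def using B C K1 K2 by (intro mult_nonneg_nonneg add_nonneg_nonneg) auto
  note ev = truncation_bounds[OF tr]
  have "\<forall>\<^sub>F X in at_top. norm (\<Sum>\<^sub>\<infinity>p\<in>primes. g p * (freq p X)\<^sup>2)
      \<le> K * (1 / \<psi> X + 1 + real (card (small_primes \<psi> X)) * err X)"
    using K1(2) K2(2) ev eventually_ge_at_top[of 10]
  proof eventually_elim
    case (elim X)
    let ?T = "small_primes \<psi> X" and ?R = "occurring X - small_primes \<psi> X"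
    let ?D = "\<lambda>p. err X + K2 * (N p powr (- 1 - \<alpha>) + ln (N p) / (N p * ln X))"
    have split: "(\<Sum>\<^sub>\<infinity>p\<in>primes. g p * (freq p X)\<^sup>2) = (\<Sum>p\<in>?T. g p * (freq p X)\<^sup>2) + (\<Sum>p\<in>?R. g p * (freq p X)\<^sup>2)"
    proof -
      have z: "g p * (freq p X)\<^sup>2 = 0" if "p \<in> primes" "p \<notin> occurring X" for p using freq_eq_0[OF that] by simp
      show ?thesis using infsum_primes_eq[of X "\<lambda>p. g p * (freq p X)\<^sup>2"] sum_occurring_split[of X "\<lambda>p. g p * (freq p X)\<^sup>2" \<psi>] z by simp
    qed
    have "norm (\<Sum>p\<in>?T. g p * (freq p X)\<^sup>2) \<le> (\<Sum>p\<in>?T. B * ((1 + C) * ?D p + C\<^sup>2 * N p powr (- 2)))"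
    proof (rule sum_norm_le)
      fix p assume p: "p \<in> ?T"
      then have pg: "p \<in> good_primes \<B>" by (auto simp: small_primes_def)
      then have pp: "p \<in> primes" using good_subset by auto
      define e where "e = norm (of_real (freq p X) - f p l)"
      have e: "0 \<le> e" "e \<le> ?D p" using elim(2) p by (auto simp: e_def)
      have Np: "N p \<ge> 2" by (rule N_ge[OF pg])
      have fC: "norm (f p l) \<le> C / N p" by (rule f_bound[OF l\<Lambda> pg])
      have CN: "C / N p \<le> C" using Np C by (simp add: field_simps)
      have fr: "freq p X \<le> e + C / N p"
        using norm_triangle_ineq[of "of_real (freq p X) - f p l" "f p l"] fC freq_bounds[of p X] by (simp add: e_def)
      have "(freq p X)\<^sup>2 \<le> freq p X * (e + C / N p)"
        unfolding power2_eq_square using fr freq_bounds[of p X] by (intro mult_left_mono) auto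
      also have "\<dots> = freq p X * e + freq p X * (C / N p)" by (simp add: algebra_simps)
      also have "\<dots> \<le> 1 * e + (e + C / N p) * (C / N p)"
        using e fr freq_bounds[of p X] C Np by (intro add_mono mult_right_mono) auto
      also have "\<dots> = e + e * (C / N p) + (C / N p)\<^sup>2" by (simp add: algebra_simps power2_eq_square)
      also have "\<dots> \<le> e + e * C + (C / N p)\<^sup>2" using e CN by (intro add_mono mult_left_mono) auto
      also have "(C / N p)\<^sup>2 = C\<^sup>2 * N p powr (- 2)"
        using Np by (simp add: powr_minus powr_realpow[of "N p" 2, simplified] power_divide field_simps)
      finally have "(freq p X)\<^sup>2 \<le> (1 + C) * e + C\<^sup>2 * N p powr (- 2)" by (simp add: algebra_simps)
      also have "\<dots> \<le> (1 + C) * ?D p + C\<^sup>2 * N p powr (- 2)" using e C by (intro add_right_mono mult_left_mono) auto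
      finally have sq: "(freq p X)\<^sup>2 \<le> (1 + C) * ?D p + C\<^sup>2 * N p powr (- 2)" .
      show "norm (g p * (freq p X)\<^sup>2) \<le> B * ((1 + C) * ?D p + C\<^sup>2 * N p powr (- 2))"
        unfolding real_norm_def abs_mult using g[OF pp] sq B by (intro mult_mono) auto
    qed
    also have "\<dots> = B * ((1 + C) * (real (card ?T) * err X + K2 * ((\<Sum>p\<in>?T. N p powr (- 1 - \<alpha>)) + (\<Sum>p\<in>?T. ln (N p) / (N p * ln X)))) + C\<^sup>2 * (\<Sum>p\<in>?T. N p powr (- 2)))"
      by (simp only: sum_distrib_left[symmetric] sum.distrib sum_constant)
    also have "\<dots> \<le> B * ((1 + C) * (real (card ?T) * err X + K2 * (C + C)) + C\<^sup>2 * C)"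
      using B C K2(1) elim finite_small_primes
      by (intro mult_left_mono add_left_mono add_mono powr_sum log_sum square_sum) (auto simp: small_primes_def)
    finally have 1: "norm (\<Sum>p\<in>?T. g p * (freq p X)\<^sup>2) \<le> B * ((1 + C) * (real (card ?T) * err X + K2 * (C + C)) + C\<^sup>2 * C)" .
    have "norm (\<Sum>p\<in>?R. g p * (freq p X)\<^sup>2) \<le> (\<Sum>p\<in>?R. B * freq p X)"
    proof (rule sum_norm_le)
      fix p assume "p \<in> ?R"
      then have p: "p \<in> primes" by (auto simp: occurring_def)
      have "freq p X * freq p X \<le> freq p X * 1" using freq_bounds[of p X] by (intro mult_left_mono) auto
      then have "(freq p X)\<^sup>2 \<le> freq p X" by (simp add: power2_eq_square)
      then show "norm (g p * (freq p X)\<^sup>2) \<le> B * freq p X"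
        unfolding real_norm_def abs_mult using g[OF p] B by (intro mult_mono) auto
    qed
    also have "\<dots> \<le> B * (K1 * (1 / \<psi> X))"
      unfolding sum_distrib_left[symmetric] using elim(1) B by (intro mult_left_mono) auto
    finally have 2: "norm (\<Sum>p\<in>?R. g p * (freq p X)\<^sup>2) \<le> B * (K1 * (1 / \<psi> X))" .
    have nn: "0 \<le> 1 / \<psi> X" "0 \<le> real (card ?T) * err X" using elim by auto
    have "(1 + C) * (real (card ?T) * err X) + ((1 + C) * (K2 * (C + C)) + C\<^sup>2 * C) + K1 * (1 / \<psi> X)
       \<le> ((1 + C) + ((1 + C) * (K2 * (C + C)) + C\<^sup>2 * C) + K1) * (1 / \<psi> X + 1 + real (card ?T) * err X)"
    proof (rule linear_bound)
      show "0 \<le> (1 + C) * (K2 * (C + C)) + C\<^sup>2 * C"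
        using K2(1) C by (intro add_nonneg_nonneg mult_nonneg_nonneg) auto
    qed (use nn K1(1) C in auto)
    from mult_left_mono[OF this B] have
      "B * ((1 + C) * (real (card ?T) * err X + K2 * (C + C)) + C\<^sup>2 * C) + B * (K1 * (1 / \<psi> X))
        \<le> K * (1 / \<psi> X + 1 + real (card ?T) * err X)" by (simp add: K_def algebra_simps)
    then show ?case unfolding split
      using norm_triangle_ineq[of "\<Sum>p\<in>?T. g p * (freq p X)\<^sup>2" "\<Sum>p\<in>?R. g p * (freq p X)\<^sup>2"] 1 2 by linarith
  qed
  from negligible_if_bounded[OF tr this K] show ?thesis by simp
qed

end

section \<open>The method of moments\<close>

lemma norm_iexp_diff: "norm (iexp a - iexp b) \<le> \<bar>a - b\<bar>"
proof -
  have "iexp a - iexp b = iexp b * (iexp (a - b) - 1)"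
    by (simp add: right_diff_distrib exp_add[symmetric] algebra_simps)
  then have "norm (iexp a - iexp b) = norm (iexp (a - b) - 1)" by (simp add: norm_mult)
  also have "\<dots> \<le> \<bar>a - b\<bar>" using iexp_approx1[of "a - b" 0] by simp
  finally show ?thesis .
qed

text \<open>It suffices to control the moments up to each order \<open>n\<close> of some uniform approximation that
  may depend on \<open>n\<close>: the characteristic function is within \<open>2 \<bar>t\<bar>\<^sup>n / n!\<close> times the \<open>n\<close>-th
  absolute moment of its Taylor polynomial, and this bound tends to 0 with \<open>n\<close> because the moment
  series of the Gaussian converges.\<close>

lemma char_limit_from_moments:
  fixes I :: "real \<Rightarrow> 'i set" and Z :: "real \<Rightarrow> 'i \<Rightarrow> real"
  assumes fin: "\<And>X. finite (I X)" and ne: "\<forall>\<^sub>F X in at_top. I X \<noteq> {}"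
    and app: "\<And>n. n \<ge> 1 \<Longrightarrow> \<exists>Y \<eta>. (\<forall>\<^sub>F X in at_top. \<forall>i\<in>I X. \<bar>Z X i - Y X i\<bar> \<le> \<eta> X) \<and> (\<eta> \<longlongrightarrow> 0) at_top \<and>
       (\<forall>j\<le>n. ((\<lambda>X. of_real (1 / real (card (I X)) * (\<Sum>i\<in>I X. Y X i ^ j))) \<longlongrightarrow> gauss_moment j) at_top)"
  shows "((\<lambda>X. (\<Sum>i\<in>I X. iexp (t * Z X i)) / of_nat (card (I X))) \<longlongrightarrow> of_real (exp (- (t\<^sup>2) / 2))) at_top"
proof (rule tendstoI)
  fix e :: real assume e: "e > 0"
  define s where "s k = gauss_moment k / fact k * (\<i> * of_real t) ^ k" for k
  define L where "L = complex_of_real (exp (- (t\<^sup>2) / 2))"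
  have "(\<lambda>z::complex. exp (z\<^sup>2 / 2)) holomorphic_on ball 0 (\<bar>t\<bar> + 1)" by (intro holomorphic_intros) auto
  moreover have "\<i> * of_real t \<in> ball 0 (\<bar>t\<bar> + 1)" by (simp add: norm_mult)
  ultimately have "(\<lambda>n. (deriv ^^ n) (\<lambda>z. exp (z\<^sup>2 / 2)) 0 / fact n * (\<i> * of_real t - 0) ^ n) sums exp ((\<i> * of_real t)\<^sup>2 / 2)"
    by (rule holomorphic_power_series)
  moreover have "exp ((\<i> * of_real t)\<^sup>2 / 2) = L"
    by (simp add: L_def power_mult_distrib exp_of_real[symmetric])
  moreover have "(\<lambda>n. (deriv ^^ n) (\<lambda>z. exp (z\<^sup>2 / 2)) 0 / fact n * (\<i> * of_real t - 0) ^ n) = s"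
    by (intro ext) (simp add: s_def gauss_moment_def)
  ultimately have sums: "s sums L" by (simp only:)
  have "\<forall>\<^sub>F n in sequentially. dist (\<Sum>k<n. s k) L < e / 4"
    using sums e unfolding sums_def by (intro tendstoD) auto
  moreover have "\<forall>\<^sub>F n in sequentially. dist (s n) 0 < e / 8"
    using summable_LIMSEQ_zero[OF sums_summable[OF sums]] e by (intro tendstoD) auto
  ultimately obtain N where N: "\<And>n. n \<ge> N \<Longrightarrow> dist (\<Sum>k<n. s k) L < e / 4" "\<And>n. n \<ge> N \<Longrightarrow> norm (s n) < e / 8"
    unfolding eventually_sequentially by (metis dist_norm diff_zero le_trans nat_le_linear)
  \<comment> \<open>An even order makes the absolute moment of the remainder an ordinary moment.\<close>
  define n where "n = 2 * (N + 1)"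
  have n: "n \<ge> 1" "n \<ge> N" "even n" by (auto simp: n_def)
  obtain Y \<eta> where Y: "\<forall>\<^sub>F X in at_top. \<forall>i\<in>I X. \<bar>Z X i - Y X i\<bar> \<le> \<eta> X" and \<eta>: "(\<eta> \<longlongrightarrow> 0) at_top"
    and mom: "\<And>j. j \<le> n \<Longrightarrow> ((\<lambda>X. complex_of_real (1 / real (card (I X)) * (\<Sum>i\<in>I X. Y X i ^ j))) \<longlongrightarrow> gauss_moment j) at_top"
    using app[OF n(1)] by blast
  define E where "E j X = 1 / real (card (I X)) * (\<Sum>i\<in>I X. Y X i ^ j)" for j X
  define A where "A X = (\<Sum>k\<le>n. (\<i> * of_real t) ^ k / fact k * of_real (E k X))" for X
  have "(A \<longlongrightarrow> (\<Sum>k\<le>n. (\<i> * of_real t) ^ k / fact k * gauss_moment k)) at_top"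
    unfolding A_def E_def by (intro tendsto_intros mom) auto
  also have "(\<Sum>k\<le>n. (\<i> * of_real t) ^ k / fact k * gauss_moment k) = (\<Sum>k<Suc n. s k)"
    by (simp add: s_def lessThan_Suc_atMost mult_ac)
  finally have "\<forall>\<^sub>F X in at_top. dist (A X) (\<Sum>k<Suc n. s k) < e / 4" using e by (intro tendstoD) auto
  moreover have "\<forall>\<^sub>F X in at_top. 2 * \<bar>t\<bar> ^ n / fact n * E n X < e / 4"
  proof -
    have "((\<lambda>X. norm (2 * of_real t ^ n / fact n * complex_of_real (E n X))) \<longlongrightarrow> norm (2 * of_real t ^ n / fact n * gauss_moment n)) at_top"
      unfolding E_def by (intro tendsto_intros mom) auto
    moreover have "norm (2 * of_real t ^ n / fact n * gauss_moment n) = 2 * norm (s n)"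
      by (simp add: s_def norm_mult norm_divide norm_power)
    ultimately have "\<forall>\<^sub>F X in at_top. norm (2 * of_real t ^ n / fact n * complex_of_real (E n X)) < e / 4"
      using N(2)[OF n(2)] by (intro order_tendstoD) auto
    then show ?thesis
    proof eventually_elim
      case (elim X)
      have "E n X \<ge> 0" unfolding E_def using n(3) by (intro mult_nonneg_nonneg sum_nonneg) (auto simp: zero_le_even_power)
      then show ?case using elim by (simp add: norm_mult norm_divide norm_power)
    qed
  qed
  moreover have "\<forall>\<^sub>F X in at_top. \<bar>t\<bar> * \<eta> X < e / 4"
  proof -
    have "((\<lambda>X. \<bar>t\<bar> * \<eta> X) \<longlongrightarrow> \<bar>t\<bar> * 0) at_top" by (intro tendsto_intros \<eta>)
    then show ?thesis using e by (intro order_tendstoD) auto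
  qed
  ultimately show "\<forall>\<^sub>F X in at_top. dist ((\<Sum>i\<in>I X. iexp (t * Z X i)) / of_nat (card (I X))) (of_real (exp (- (t\<^sup>2) / 2))) < e"
    using Y ne
  proof eventually_elim
    case (elim X)
    define c where "c = real (card (I X))"
    have c: "c > 0" using elim fin by (simp add: c_def card_gt_0_iff)
    let ?\<phi> = "\<lambda>W. (\<Sum>i\<in>I X. iexp (t * W i)) / complex_of_real c"
    have avg: "norm ((\<Sum>i\<in>I X. u i) / complex_of_real c) \<le> (\<Sum>i\<in>I X. v i) / c"
      if "\<And>i. i \<in> I X \<Longrightarrow> norm (u i) \<le> v i" for u v
      using c sum_norm_le[of "I X" u v] that by (simp add: norm_divide divide_right_mono)
    have 1: "norm (?\<phi> (Z X) - ?\<phi> (Y X)) \<le> \<bar>t\<bar> * \<eta> X"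
    proof -
      have "?\<phi> (Z X) - ?\<phi> (Y X) = (\<Sum>i\<in>I X. iexp (t * Z X i) - iexp (t * Y X i)) / complex_of_real c"
        by (simp add: sum_subtractf diff_divide_distrib)
      also have "norm \<dots> \<le> (\<Sum>i\<in>I X. \<bar>t\<bar> * \<eta> X) / c"
      proof (rule avg)
        fix i assume i: "i \<in> I X"
        have "norm (iexp (t * Z X i) - iexp (t * Y X i)) \<le> \<bar>t * Z X i - t * Y X i\<bar>" by (rule norm_iexp_diff)
        also have "\<dots> = \<bar>t\<bar> * \<bar>Z X i - Y X i\<bar>" by (simp add: abs_mult[symmetric] right_diff_distrib)
        also have "\<dots> \<le> \<bar>t\<bar> * \<eta> X" using elim i by (intro mult_left_mono) auto
        finally show "norm (iexp (t * Z X i) - iexp (t * Y X i)) \<le> \<bar>t\<bar> * \<eta> X" .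
      qed
      also have "\<dots> = \<bar>t\<bar> * \<eta> X" using c by (simp add: c_def)
      finally show ?thesis .
    qed
    have 2: "norm (?\<phi> (Y X) - A X) \<le> 2 * \<bar>t\<bar> ^ n / fact n * E n X"
    proof -
      have "A X = (\<Sum>i\<in>I X. \<Sum>k\<le>n. (\<i> * (t * Y X i)) ^ k / fact k) / complex_of_real c"
      proof -
        have "A X = (\<Sum>k\<le>n. \<Sum>i\<in>I X. (\<i> * (t * Y X i)) ^ k / fact k / complex_of_real c)"
          unfolding A_def E_def c_def[symmetric]
          by (intro sum.cong refl) (simp add: sum_distrib_left sum_divide_distrib power_mult_distrib mult.assoc)
        also have "\<dots> = (\<Sum>i\<in>I X. \<Sum>k\<le>n. (\<i> * (t * Y X i)) ^ k / fact k / complex_of_real c)" by (rule sum.swap)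
        finally show ?thesis by (simp add: sum_divide_distrib)
      qed
      then have "?\<phi> (Y X) - A X = (\<Sum>i\<in>I X. iexp (t * Y X i) - (\<Sum>k\<le>n. (\<i> * (t * Y X i)) ^ k / fact k)) / complex_of_real c"
        by (simp only: sum_subtractf diff_divide_distrib)
      also have "norm \<dots> \<le> (\<Sum>i\<in>I X. 2 * \<bar>t * Y X i\<bar> ^ n / fact n) / c"
        by (rule avg) (rule iexp_approx2)
      also have "\<dots> = 2 * \<bar>t\<bar> ^ n / fact n * E n X"
        unfolding E_def c_def[symmetric] using n(3)
        by (simp add: abs_mult power_mult_distrib power_even_abs sum_distrib_left sum_divide_distrib mult.assoc)
      finally show ?thesis .
    qed
    have 3: "norm (A X - (\<Sum>k<Suc n. s k)) < e / 4" using elim(1) by (simp add: dist_norm)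
    have 4: "norm ((\<Sum>k<Suc n. s k) - L) < e / 4" using N(1)[of "Suc n"] n by (simp add: dist_norm del: sum.lessThan_Suc)
    have "?\<phi> (Z X) - L = (?\<phi> (Z X) - ?\<phi> (Y X)) + (?\<phi> (Y X) - A X) + (A X - (\<Sum>k<Suc n. s k)) + ((\<Sum>k<Suc n. s k) - L)"
      by (simp del: sum.lessThan_Suc)
    then have "norm (?\<phi> (Z X) - L) \<le> norm (?\<phi> (Z X) - ?\<phi> (Y X)) + norm (?\<phi> (Y X) - A X) + norm (A X - (\<Sum>k<Suc n. s k)) + norm ((\<Sum>k<Suc n. s k) - L)"
      using norm_triangle_ineq add_mono order.trans by (smt (verit))
    also have "\<dots> < e" using 1 2 3 4 elim by linarith
    finally show ?case by (simp add: dist_norm L_def c_def)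
  qed
qed

text \<open>Levy's continuity theorem along every sequence tending to infinity; the boundary of an interval is
  a null set for the normal law.\<close>

lemma gaussian_limit_from_char:
  fixes I :: "real \<Rightarrow> 'i set" and Z :: "real \<Rightarrow> 'i \<Rightarrow> real"
  assumes fin: "\<And>X. finite (I X)" and ne: "\<forall>\<^sub>F X in at_top. I X \<noteq> {}"
    and char: "\<And>t. ((\<lambda>X. (\<Sum>i\<in>I X. iexp (t * Z X i)) / of_nat (card (I X))) \<longlongrightarrow> of_real (exp (- (t\<^sup>2) / 2))) at_top"
    and S: "is_interval S"
  shows "((\<lambda>X. 1 / real (card (I X)) * real (card {i\<in>I X. Z X i \<in> S})) \<longlongrightarrow>
     1 / sqrt (2 * pi) * (LINT t:S|lborel. exp (- (t\<^sup>2) / 2))) at_top"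
proof -
  have Sb [measurable]: "S \<in> sets borel" by (rule real_interval_borel_measurable[OF S])
  have lim: "measure std_normal_distribution S = 1 / sqrt (2 * pi) * (LINT t:S|lborel. exp (- (t\<^sup>2) / 2))"
  proof -
    have "measure std_normal_distribution S = (\<integral>x. indicator S x \<partial>std_normal_distribution)"
      by simp
    also have "\<dots> = (\<integral>x. std_normal_density x * indicator S x \<partial>lborel)"
      by (subst integral_density) (auto simp: normal_density_nonneg)
    also have "\<dots> = (\<integral>x. 1 / sqrt (2 * pi) * (indicator S x *\<^sub>R exp (- (x\<^sup>2) / 2)) \<partial>lborel)"
      by (intro Bochner_Integration.integral_cong refl) (simp add: std_normal_density_def mult_ac)
    also have "\<dots> = 1 / sqrt (2 * pi) * (LINT t:S|lborel. exp (- (t\<^sup>2) / 2))"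
      unfolding set_lebesgue_integral_def by (rule integral_mult_right_zero)
    finally show ?thesis .
  qed
  have front: "measure std_normal_distribution (frontier S) = 0" "emeasure std_normal_distribution (frontier S) = 0"
  proof -
    have "negligible (frontier S)" using S by (intro negligible_convex_frontier) (simp add: is_interval_convex_1)
    then have "frontier S \<in> null_sets lebesgue" by (simp add: negligible_iff_null_sets)
    moreover have fb: "frontier S \<in> sets borel" by simp
    ultimately have nl: "frontier S \<in> null_sets lborel" by (auto simp: null_sets_def)
    have "AE x in lborel. x \<in> frontier S \<longrightarrow> ennreal (std_normal_density x) = 0"
      using AE_not_in[OF nl] by eventually_elim simp
    then have "frontier S \<in> null_sets std_normal_distribution"
      using fb by (subst null_sets_density_iff) auto
    then show "measure std_normal_distribution (frontier S) = 0" "emeasure std_normal_distribution (frontier S) = 0"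
      by (auto simp: null_sets_def measure_def)
  qed
  show ?thesis unfolding lim[symmetric]
  proof (rule tendsto_at_topI_sequentially)
    fix x :: "nat \<Rightarrow> real" assume x: "filterlim x at_top sequentially"
    define M where "M n = distr (measure_pmf (pmf_of_set (I (x n)))) borel (Z (x n))" for n
    have rd: "real_distribution (M n)" for n unfolding M_def by (rule prob_space.real_distribution_distr[OF measure_pmf.prob_space_axioms]) simp
    have nex: "\<forall>\<^sub>F n in sequentially. I (x n) \<noteq> {}" by (rule eventually_compose_filterlim[OF ne x])
    have "weak_conv_m M std_normal_distribution"
    proof (rule levy_continuity[OF rd real_dist_normal_dist])
      fix t
      have "(\<lambda>n. (\<Sum>i\<in>I (x n). iexp (t * Z (x n) i)) / of_nat (card (I (x n)))) \<longlonglongrightarrow> char std_normal_distribution t"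
        unfolding char_std_normal_distribution by (rule filterlim_compose[OF char x])
      then show "(\<lambda>n. char (M n) t) \<longlonglongrightarrow> char std_normal_distribution t"
      proof (rule Lim_transform_eventually)
        show "\<forall>\<^sub>F n in sequentially. (\<Sum>i\<in>I (x n). iexp (t * Z (x n) i)) / of_nat (card (I (x n))) = char (M n) t"
          using nex
        proof eventually_elim
          case (elim n)
          have "char (M n) t = (\<integral>i. iexp (t * Z (x n) i) \<partial>measure_pmf (pmf_of_set (I (x n))))"
            unfolding char_def M_def by (subst integral_distr) auto
          also have "\<dots> = (\<Sum>i\<in>I (x n). pmf (pmf_of_set (I (x n))) i *\<^sub>R iexp (t * Z (x n) i))"
            using elim fin by (intro integral_measure_pmf) auto
          also have "\<dots> = (\<Sum>i\<in>I (x n). iexp (t * Z (x n) i) / of_nat (card (I (x n))))"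
            using elim fin by (intro sum.cong refl) (simp add: scaleR_conv_of_real)
          finally show ?case by (simp add: sum_divide_distrib)
        qed
      qed
    qed
    then have "(\<lambda>n. measure (M n) S) \<longlonglongrightarrow> measure std_normal_distribution S"
      using front by (intro weak_conv_imp_continuity_set_conv rd real_dist_normal_dist) auto
    then show "(\<lambda>n. 1 / real (card (I (x n))) * real (card {i \<in> I (x n). Z (x n) i \<in> S})) \<longlonglongrightarrow> measure std_normal_distribution S"
    proof (rule Lim_transform_eventually)
      show "\<forall>\<^sub>F n in sequentially. measure (M n) S = 1 / real (card (I (x n))) * real (card {i \<in> I (x n). Z (x n) i \<in> S})"
        using nex
      proof eventually_elim
        case (elim n)
        have "measure (M n) S = measure (measure_pmf (pmf_of_set (I (x n)))) (Z (x n) -` S)"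
          unfolding M_def by (subst measure_distr) auto
        also have "\<dots> = real (card (I (x n) \<inter> Z (x n) -` S)) / real (card (I (x n)))"
          using elim fin by (rule measure_pmf_of_set)
        also have "I (x n) \<inter> Z (x n) -` S = {i \<in> I (x n). Z (x n) i \<in> S}" by auto
        finally show ?case by simp
      qed
    qed
  qed
qed

section \<open>The limit law\<close>

context reasonable_setting
begin

lemma mean_vs_prime_average:
  assumes l: "l \<in> heavy" and \<omega>: "\<And>p. p \<in> primes \<Longrightarrow> \<bar>\<omega> p\<bar> \<le> B" and B: "B \<ge> 0"
  shows "((\<lambda>X. of_real (norm_mean \<F> \<omega> X) - prime_average \<B> \<omega> l X) \<longlongrightarrow> 0) at_top"
proof -
  from tendsto_over_ln_ln[OF first_moment[OF l \<omega> B]] show ?thesis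
    by (simp add: norm_mean_def prime_average_def diff_divide_distrib)
qed

lemma variance_split:
  "norm_variance \<F> \<omega> X = norm_mean \<F> (\<lambda>p. (\<omega> p)\<^sup>2) X - 1 / ln (ln X) * (\<Sum>\<^sub>\<infinity>p\<in>primes. (\<omega> p)\<^sup>2 * (freq p X)\<^sup>2)"
proof -
  have z: "freq p X = 0" if "p \<in> primes" "p \<notin> occurring X" for p using freq_eq_0[OF that] .
  have "(\<Sum>\<^sub>\<infinity>p\<in>primes. (\<omega> p)\<^sup>2 * freq p X * (1 - freq p X)) = (\<Sum>p\<in>occurring X. (\<omega> p)\<^sup>2 * freq p X * (1 - freq p X))"
    by (rule infsum_primes_eq) (simp add: z)
  also have "\<dots> = (\<Sum>p\<in>occurring X. (\<omega> p)\<^sup>2 * freq p X) - (\<Sum>p\<in>occurring X. (\<omega> p)\<^sup>2 * (freq p X)\<^sup>2)"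
    by (simp add: sum_subtractf[symmetric] algebra_simps power2_eq_square)
  also have "(\<Sum>p\<in>occurring X. (\<omega> p)\<^sup>2 * freq p X) = (\<Sum>\<^sub>\<infinity>p\<in>primes. (\<omega> p)\<^sup>2 * freq p X)"
    by (rule infsum_primes_eq[symmetric]) (simp add: z)
  also have "(\<Sum>p\<in>occurring X. (\<omega> p)\<^sup>2 * (freq p X)\<^sup>2) = (\<Sum>\<^sub>\<infinity>p\<in>primes. (\<omega> p)\<^sup>2 * (freq p X)\<^sup>2)"
    by (rule infsum_primes_eq[symmetric]) (simp add: z)
  finally show ?thesis by (simp only: norm_variance_def norm_mean_def right_diff_distrib)
qed

lemma variance_vs_second_mean:
  assumes \<omega>: "\<And>p. p \<in> primes \<Longrightarrow> \<bar>\<omega> p\<bar> \<le> B" and B: "B \<ge> 0"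
  shows "((\<lambda>X. norm_variance \<F> \<omega> X - norm_mean \<F> (\<lambda>p. (\<omega> p)\<^sup>2) X) \<longlongrightarrow> 0) at_top"
proof -
  have B2: "\<bar>(\<omega> p)\<^sup>2\<bar> \<le> B\<^sup>2" if "p \<in> primes" for p using power_mono[OF \<omega>[OF that], of 2] by simp
  have "((\<lambda>X. (\<Sum>\<^sub>\<infinity>p\<in>primes. (\<omega> p)\<^sup>2 * (freq p X)\<^sup>2) / of_real (sqrt (ln (ln X)))) \<longlongrightarrow> 0) at_top"
    using square_sum_negligible[OF B2] by simp
  from tendsto_minus[OF tendsto_over_ln_ln[OF this]] show ?thesis unfolding variance_split by simp
qed

text \<open>All parameters of nonzero limiting weight have the same limiting average, and the limiting weights sum
  to 1, so the limit formula is this common limit.\<close>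

lemma limit_formulae:
  fixes u :: "real \<Rightarrow> real"
  assumes wl: "\<And>l. l \<in> params (mixture_of \<B>) \<Longrightarrow> weight_lim (mixture_of \<B>) l =
       fps_nth (G l) 0 / (\<Sum>l\<in>params (mixture_of \<B>). fps_nth (G l) 0)"
    and u: "\<And>l. l \<in> heavy \<Longrightarrow> ((\<lambda>X. of_real (u X) - prime_average \<B> g l X) \<longlongrightarrow> 0) at_top"
  shows "(\<exists>\<mu>. (u \<longlongrightarrow> \<mu>) at_top) \<longleftrightarrow> limit_formula_exists \<B> g"
    and "(u \<longlongrightarrow> \<mu>) at_top \<Longrightarrow> of_real \<mu> = limit_formula \<B> g"
proof -
  let ?\<T> = "mixture_of \<B>"
  have G0': "(\<Sum>l\<in>params ?\<T>. fps_nth (G l) 0) \<noteq> 0" using G0 by (simp add: fps_sum_nth)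
  have pos: "l \<in> positive_params ?\<T> \<longleftrightarrow> l \<in> heavy" for l
    using wl G0' by (auto simp: positive_params_def heavy_def)
  have avg: "(prime_average \<B> g l \<longlongrightarrow> of_real \<mu>) at_top" if "(u \<longlongrightarrow> \<mu>) at_top" "l \<in> heavy" for l \<mu>
    using tendsto_diff[OF tendsto_of_real[OF that(1)] u[OF that(2)]] by simp
  show "(\<exists>\<mu>. (u \<longlongrightarrow> \<mu>) at_top) \<longleftrightarrow> limit_formula_exists \<B> g"
  proof
    assume "\<exists>\<mu>. (u \<longlongrightarrow> \<mu>) at_top"
    then obtain \<mu> where "(u \<longlongrightarrow> \<mu>) at_top" by blast
    from avg[OF this] show "limit_formula_exists \<B> g" unfolding limit_formula_exists_def pos[symmetric] by blast
  next
    assume L: "limit_formula_exists \<B> g"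
    obtain l where l: "l \<in> heavy" using heavy_nonempty by auto
    then obtain z where z: "(prime_average \<B> g l \<longlongrightarrow> z) at_top" using L
      unfolding limit_formula_exists_def pos[symmetric] by blast
    from tendsto_add[OF u[OF l] z] have "((\<lambda>X. complex_of_real (u X)) \<longlongrightarrow> z) at_top" by simp
    from tendsto_Re[OF this] show "\<exists>\<mu>. (u \<longlongrightarrow> \<mu>) at_top" by auto
  qed
  assume lim: "(u \<longlongrightarrow> \<mu>) at_top"
  have "limit_formula \<B> g = (\<Sum>l\<in>params ?\<T>. weight_lim ?\<T> l * of_real \<mu>)"
    unfolding limit_formula_def
  proof (rule sum.cong[OF refl])
    fix l assume l: "l \<in> params ?\<T>"
    show "(if weight_lim ?\<T> l = 0 then 0 else weight_lim ?\<T> l * Lim at_top (prime_average \<B> g l)) = weight_lim ?\<T> l * of_real \<mu>"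
    proof (cases "weight_lim ?\<T> l = 0")
      case False
      then have "l \<in> heavy" using l pos[of l] by (simp add: positive_params_def)
      then have "Lim at_top (prime_average \<B> g l) = of_real \<mu>" by (intro tendsto_Lim avg[OF lim]) auto
      then show ?thesis using False by simp
    qed simp
  qed
  also have "\<dots> = (\<Sum>l\<in>params ?\<T>. weight_lim ?\<T> l) * of_real \<mu>" by (simp add: sum_distrib_right)
  also have "(\<Sum>l\<in>params ?\<T>. weight_lim ?\<T> l) = 1"
    using wl G0' by (simp add: sum_divide_distrib[symmetric])
  finally show "of_real \<mu> = limit_formula \<B> g" by simp
qed


text \<open>For every order \<open>n\<close> the sum over the truncation that belongs to \<open>n\<close> has the Gaussian moments
  up to order \<open>n\<close>, and it differs from the full sum by at most a constant times \<open>1 / \<psi> X\<close>,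
  uniformly over all members.\<close>

theorem central_limit:
  assumes add: "strongly_additive \<omega>" and \<omega>: "\<And>p. p \<in> primes \<Longrightarrow> \<bar>\<omega> p\<bar> \<le> B" and B: "B > 0"
    and V: "V > 0" and var: "(norm_variance \<F> \<omega> \<longlongrightarrow> V) at_top"
    and M: "((\<lambda>X. (M X - norm_mean \<F> \<omega> X * ln (ln X)) / sqrt (ln (ln X))) \<longlongrightarrow> 0) at_top"
    and S: "is_interval S"
  shows "((\<lambda>X. 1 / real (card (members X)) *
        real (card {i \<in> members X. (\<omega> (ideal_at \<F> i) - M X) / sqrt (V * ln (ln X)) \<in> S}))
     \<longlongrightarrow> 1 / sqrt (2 * pi) * (LINT t:S|lborel. exp (- (t\<^sup>2) / 2))) at_top"
proof (rule gaussian_limit_from_char[OF finite_members eventually_members _ S], rule char_limit_from_moments[OF finite_members eventually_members])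
  fix n :: nat assume n: "n \<ge> 1"
  obtain l where l: "l \<in> heavy" using heavy_nonempty by auto
  obtain \<psi> err where tr: "truncation n \<psi> err" using truncation_exists by blast
  have B0: "B \<ge> 0" using B by simp
  have B2: "\<bar>(\<omega> p)\<^sup>2\<bar> \<le> B\<^sup>2" if "p \<in> primes" for p using power_mono[OF \<omega>[OF that], of 2] by simp
  let ?T = "small_primes \<psi>"
  have mean: "((\<lambda>X. ((\<Sum>p\<in>?T X. of_real (\<omega> p) * f p l) - of_real (M X)) / of_real (sqrt (ln (ln X)))) \<longlongrightarrow> 0) at_top"
  proof -
    note 1 = first_moment_small[OF l n tr, of \<omega>, OF \<omega> B0]
    have "((\<lambda>X. complex_of_real ((M X - norm_mean \<F> \<omega> X * ln (ln X)) / sqrt (ln (ln X)))) \<longlongrightarrow> of_real 0) at_top"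
      by (rule tendsto_of_real[OF M])
    from tendsto_minus[OF tendsto_add[OF 1 this]]
    have "((\<lambda>X. - ((of_real (\<Sum>\<^sub>\<infinity>p\<in>primes. \<omega> p * freq p X) - (\<Sum>p\<in>?T X. of_real (\<omega> p) * f p l)) / of_real (sqrt (ln (ln X)))
       + complex_of_real ((M X - norm_mean \<F> \<omega> X * ln (ln X)) / sqrt (ln (ln X))))) \<longlongrightarrow> 0) at_top" by (simp only: of_real_0 add_0_right minus_zero)
    then show ?thesis
    proof (rule Lim_transform_eventually)
      show "\<forall>\<^sub>F X in at_top. - ((of_real (\<Sum>\<^sub>\<infinity>p\<in>primes. \<omega> p * freq p X) - (\<Sum>p\<in>?T X. of_real (\<omega> p) * f p l)) / of_real (sqrt (ln (ln X)))
         + complex_of_real ((M X - norm_mean \<F> \<omega> X * ln (ln X)) / sqrt (ln (ln X))))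
         = ((\<Sum>p\<in>?T X. of_real (\<omega> p) * f p l) - of_real (M X)) / of_real (sqrt (ln (ln X)))"
        using eventually_ln_ln_ge_1
      proof eventually_elim
        case (elim X)
        then have "norm_mean \<F> \<omega> X * ln (ln X) = (\<Sum>\<^sub>\<infinity>p\<in>primes. \<omega> p * freq p X)" by (simp add: norm_mean_def)
        then show ?case by (simp add: diff_divide_distrib)
      qed
    qed
  qed
  have var': "((\<lambda>X. (\<Sum>p\<in>?T X. of_real ((\<omega> p)\<^sup>2) * f p l) / of_real (ln (ln X))) \<longlongrightarrow> of_real V) at_top"
  proof -
    have nm: "((\<lambda>X. complex_of_real (norm_mean \<F> (\<lambda>p. (\<omega> p)\<^sup>2) X)) \<longlongrightarrow> of_real V) at_top"
      using tendsto_of_real[OF tendsto_diff[OF var variance_vs_second_mean[of \<omega> B, OF \<omega> B0]]] by simp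
    note tendsto_over_ln_ln[OF first_moment_small[OF l n tr, of "\<lambda>p. (\<omega> p)\<^sup>2" "B\<^sup>2", OF B2 zero_le_power2]]
    from tendsto_diff[OF nm this] show ?thesis by (simp add: norm_mean_def diff_divide_distrib)
  qed
  interpret tsum: truncated_sum "good_primes \<B>" N "params (mixture_of \<B>)" "pole_order (mixture_of \<B>)" G "germ_jet \<B>" C \<alpha> ?T \<omega> M B V l
  proof
    show "small_primes \<psi> X \<subseteq> {p \<in> good_primes \<B>. N p \<le> X}" for X by (auto simp: small_primes_def)
    show "\<bar>\<omega> p\<bar> \<le> B" if "p \<in> good_primes \<B>" for p using \<omega> good_subset that by blast
  qed (fact B V l mean var')+
  define D where "D X i = {p \<in> small_primes \<psi> X. ideal_dvd p (ideal_at \<F> i)}" for X i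
  define \<eta> where "\<eta> K X = B * K / sqrt V * (1 / \<psi> X / sqrt (ln (ln X)))" for K X
  have psi0: "((\<lambda>X. 1 / \<psi> X / sqrt (ln (ln X))) \<longlongrightarrow> 0) at_top" using tr unfolding truncation_def by blast
  obtain K where K: "K > 0" "\<forall>\<^sub>F X in at_top. \<forall>i\<in>members X.
    real (card {p\<in>primes. ideal_dvd p (ideal_at \<F> i) \<and> p \<notin> small_primes \<psi> X}) \<le> K * (1 / \<psi> X)"
    using large_prime_divisors[OF tr] by blast
  have close: "\<forall>\<^sub>F X in at_top. \<forall>i\<in>members X. \<bar>(\<omega> (ideal_at \<F> i) - M X) / sqrt (V * ln (ln X)) - tsum.normalized X (D X i)\<bar> \<le> \<eta> K X"
    using K(2) eventually_ln_ln_ge_1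
  proof eventually_elim
    case (elim X)
    show ?case
    proof
      fix i assume i: "i \<in> members X"
      let ?P = "{p\<in>primes. ideal_dvd p (ideal_at \<F> i)}" and ?Q = "{p\<in>primes. ideal_dvd p (ideal_at \<F> i) \<and> p \<notin> small_primes \<psi> X}"
      have "ideal_at \<F> i \<in> nonzero_ideals" using i ordered by (auto simp: ordered_ideal_seq_def seq_upto_def)
      then have "\<omega> (ideal_at \<F> i) = (\<Sum>p\<in>?P. \<omega> p)" using add by (auto simp: strongly_additive_def)
      also have "?P = D X i \<union> ?Q" using good_subset by (auto simp: D_def small_primes_def)
      also have "(\<Sum>p\<in>D X i \<union> ?Q. \<omega> p) = (\<Sum>p\<in>D X i. \<omega> p) + (\<Sum>p\<in>?Q. \<omega> p)"
        using finite_divisors[OF i] finite_small_primes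
        by (intro sum.union_disjoint) (auto simp: D_def elim: rev_finite_subset)
      finally have w: "\<omega> (ideal_at \<F> i) = (\<Sum>p\<in>D X i. \<omega> p) + (\<Sum>p\<in>?Q. \<omega> p)" .
      have "\<bar>\<Sum>p\<in>?Q. \<omega> p\<bar> \<le> (\<Sum>p\<in>?Q. B)" using \<omega> by (intro order.trans[OF sum_abs sum_mono]) auto
      also have "\<dots> = B * real (card ?Q)" by simp
      also have "\<dots> \<le> B * (K * (1 / \<psi> X))" using elim i B by (intro mult_left_mono) auto
      finally have q: "\<bar>\<Sum>p\<in>?Q. \<omega> p\<bar> \<le> B * (K * (1 / \<psi> X))" .
      have y: "ln (ln X) > 0" using elim by linarith
      have s: "sqrt (V * ln (ln X)) > 0" using V y by (intro real_sqrt_gt_zero mult_pos_pos)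
      have "(\<omega> (ideal_at \<F> i) - M X) / sqrt (V * ln (ln X)) - tsum.normalized X (D X i) = (\<Sum>p\<in>?Q. \<omega> p) / sqrt (V * ln (ln X))"
        by (simp add: w tsum.normalized_def tsum.\<sigma>_def diff_divide_distrib add_divide_distrib)
      also have "\<bar>\<dots>\<bar> \<le> B * (K * (1 / \<psi> X)) / sqrt (V * ln (ln X))"
      proof -
        have "\<bar>(\<Sum>p\<in>?Q. \<omega> p) / sqrt (V * ln (ln X))\<bar> = \<bar>\<Sum>p\<in>?Q. \<omega> p\<bar> / sqrt (V * ln (ln X))"
          using s by (simp only: abs_divide abs_of_pos)
        then show ?thesis using divide_right_mono[OF q less_imp_le[OF s]] by (simp only:)
      qed
      also have "\<dots> = \<eta> K X" by (simp add: \<eta>_def real_sqrt_mult)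
      finally show "\<bar>(\<omega> (ideal_at \<F> i) - M X) / sqrt (V * ln (ln X)) - tsum.normalized X (D X i)\<bar> \<le> \<eta> K X" .
    qed
  qed
  have \<eta>0: "(\<eta> K \<longlongrightarrow> 0) at_top" unfolding \<eta>_def by (rule tendsto_mult_right_zero[OF psi0])
  have err: "\<forall>\<^sub>F X in at_top. 0 \<le> err X \<and> (\<forall>P. set P \<subseteq> small_primes \<psi> X \<longrightarrow> length P \<le> n \<longrightarrow>
      norm (of_real (real (card {i\<in>members X. set P \<subseteq> D X i}) / real (card (members X))) - J (ln X) (\<lambda>l. \<Prod>p\<in>set P. germ_jet \<B> p l)) \<le> err X)"
  proof -
    have "\<forall>\<^sub>F X in at_top. 0 \<le> err X \<and> (\<forall>P. set P \<subseteq> {p\<in>good_primes \<B>. N p \<le> X powr \<psi> X} \<longrightarrow> length P \<le> n \<longrightarrow>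
          norm (of_real (divisor_freq \<F> P X) - J (ln X) (\<lambda>l. \<Prod>p\<in>set P. germ_jet \<B> p l)) \<le> err X)"
      using tr unfolding truncation_def by (auto elim: eventually_mono)
    then show ?thesis
    proof eventually_elim
      case (elim X)
      have fr: "divisor_freq \<F> P X = real (card {i\<in>members X. set P \<subseteq> D X i}) / real (card (members X))"
        if "set P \<subseteq> small_primes \<psi> X" for P
      proof -
        have "{i \<in> members X. \<forall>\<pp>\<in>set P. ideal_dvd \<pp> (ideal_at \<F> i)} = {i\<in>members X. set P \<subseteq> D X i}"
          using that by (auto simp: D_def)
        then show ?thesis by (simp only: divisor_freq_def)
      qed
      have sub: "small_primes \<psi> X \<subseteq> {p\<in>good_primes \<B>. N p \<le> X powr \<psi> X}" by (auto simp: small_primes_def)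
      show ?case
      proof (intro conjI allI impI)
        fix P assume P: "set P \<subseteq> small_primes \<psi> X" "length P \<le> n"
        show "norm (of_real (real (card {i\<in>members X. set P \<subseteq> D X i}) / real (card (members X))) - J (ln X) (\<lambda>l. \<Prod>p\<in>set P. germ_jet \<B> p l)) \<le> err X"
          unfolding fr[OF P(1), symmetric] using elim order.trans[OF P(1) sub] P(2) by blast
      qed (use elim in blast)
    qed
  qed
  have small: "((\<lambda>X. (real (card (small_primes \<psi> X)) * B + \<bar>M X\<bar>) ^ j * err X) \<longlongrightarrow> 0) at_top" for j
  proof (rule Lim_null_comparison)
    define a where "a = max (2 * C * B) (1 + 50 * B * C * C)"
    have a: "a \<ge> 0" "2 * C * B \<le> a" "1 + 50 * B * C * C \<le> a"
      using B C unfolding a_def by (auto intro: max.coboundedI1)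
    show "((\<lambda>X. (a * (X powr \<psi> X)\<^sup>2 + a * ln (ln X)) ^ j * err X) \<longlongrightarrow> 0) at_top"
      using tr a(1) unfolding truncation_def by blast
    from truncation_bounds[OF tr] show "\<forall>\<^sub>F X in at_top. norm ((real (card (small_primes \<psi> X)) * B + \<bar>M X\<bar>) ^ j * err X) \<le> (a * (X powr \<psi> X)\<^sup>2 + a * ln (ln X)) ^ j * err X"
      using tsum.mean_bound eventually_ge_at_top[of 10] eventually_ln_ln_ge_1
    proof eventually_elim
      case (elim X)
      have "real (card (small_primes \<psi> X)) * B \<le> 2 * C * (X powr \<psi> X)\<^sup>2 * B"
        using card_small_primes[of X \<psi>] elim B by (intro mult_right_mono) auto
      also have "\<dots> = (2 * C * B) * (X powr \<psi> X)\<^sup>2" by simp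
      also have "\<dots> \<le> a * (X powr \<psi> X)\<^sup>2" using a by (intro mult_right_mono) auto
      finally have 1: "real (card (small_primes \<psi> X)) * B \<le> a * (X powr \<psi> X)\<^sup>2" .
      have "(1 + 50 * B * C * C) * ln (ln X) \<le> a * ln (ln X)" using a elim by (intro mult_right_mono) linarith+
      then have "\<bar>M X\<bar> \<le> a * ln (ln X)" using elim by linarith
      then have "(real (card (small_primes \<psi> X)) * B + \<bar>M X\<bar>) ^ j \<le> (a * (X powr \<psi> X)\<^sup>2 + a * ln (ln X)) ^ j"
        using 1 B by (intro power_mono add_mono) auto
      moreover have "0 \<le> (real (card (small_primes \<psi> X)) * B + \<bar>M X\<bar>) ^ j" using B by (intro zero_le_power add_nonneg_nonneg) auto
      ultimately show ?case using elim by (simp add: abs_mult mult_right_mono)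
    qed
  qed
  have "((\<lambda>X. of_real (1 / real (card (members X)) * (\<Sum>i\<in>members X. tsum.normalized X (D X i) ^ j))) \<longlongrightarrow> gauss_moment j) at_top"
    if "j \<le> n" for j
    by (rule tsum.moments_transfer[OF finite_members _ err small that]) (auto simp: D_def)
  then show "\<exists>Y \<eta>. (\<forall>\<^sub>F X in at_top. \<forall>i\<in>members X. \<bar>(\<omega> (ideal_at \<F> i) - M X) / sqrt (V * ln (ln X)) - Y X i\<bar> \<le> \<eta> X) \<and> (\<eta> \<longlongrightarrow> 0) at_top \<and>
       (\<forall>j\<le>n. ((\<lambda>X. of_real (1 / real (card (members X)) * (\<Sum>i\<in>members X. Y X i ^ j))) \<longlongrightarrow> gauss_moment j) at_top)"
    using close \<eta>0 by (intro exI[of _ "\<lambda>X i. tsum.normalized X (D X i)"] exI[of _ "\<eta> K"]) auto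
qed

text \<open>The combination of prime sums with the limiting weights is the mean up to \<open>o (sqrt (ln ln X))\<close>,
  because each prime sum of nonzero weight is, and the weights sum to 1.\<close>

lemma weighted_prime_sums:
  assumes wl: "\<And>l. l \<in> params (mixture_of \<B>) \<Longrightarrow> weight_lim (mixture_of \<B>) l =
       fps_nth (G l) 0 / (\<Sum>l\<in>params (mixture_of \<B>). fps_nth (G l) 0)"
    and \<omega>: "\<And>p. p \<in> primes \<Longrightarrow> \<bar>\<omega> p\<bar> \<le> B" and B: "B \<ge> 0"
  shows "((\<lambda>X. (of_real (norm_mean \<F> \<omega> X * ln (ln X)) - (\<Sum>l\<in>params (mixture_of \<B>). weight_lim (mixture_of \<B>) l * prime_sum \<B> \<omega> l X))
      / of_real (sqrt (ln (ln X)))) \<longlongrightarrow> 0) at_top"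
proof -
  let ?\<Lambda> = "params (mixture_of \<B>)" and ?w = "weight_lim (mixture_of \<B>)"
  let ?S = "\<lambda>X. \<Sum>\<^sub>\<infinity>p\<in>primes. \<omega> p * freq p X"
  have G0': "(\<Sum>l\<in>?\<Lambda>. fps_nth (G l) 0) \<noteq> 0" using G0 by (simp add: fps_sum_nth)
  have w1: "(\<Sum>l\<in>?\<Lambda>. ?w l) = 1" using wl G0' by (simp add: sum_divide_distrib[symmetric])
  have "((\<lambda>X. \<Sum>l\<in>?\<Lambda>. ?w l * ((of_real (?S X) - prime_sum \<B> \<omega> l X) / of_real (sqrt (ln (ln X))))) \<longlongrightarrow> (\<Sum>l\<in>?\<Lambda>. 0)) at_top"
  proof (rule tendsto_sum)
    fix l assume l: "l \<in> ?\<Lambda>"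
    show "((\<lambda>X. ?w l * ((of_real (?S X) - prime_sum \<B> \<omega> l X) / of_real (sqrt (ln (ln X))))) \<longlongrightarrow> 0) at_top"
    proof (cases "fps_nth (G l) 0 = 0")
      case False
      then have "l \<in> heavy" using l by (simp add: heavy_def)
      then show ?thesis by (intro tendsto_mult_right_zero first_moment[OF _ \<omega> B])
    qed (simp add: wl[OF l])
  qed
  then have lim: "((\<lambda>X. \<Sum>l\<in>?\<Lambda>. ?w l * ((of_real (?S X) - prime_sum \<B> \<omega> l X) / of_real (sqrt (ln (ln X))))) \<longlongrightarrow> 0) at_top"
    by (simp only: sum.neutral_const)
  show ?thesis
  proof (rule Lim_transform_eventually[OF lim])
    show "\<forall>\<^sub>F X in at_top. (\<Sum>l\<in>?\<Lambda>. ?w l * ((of_real (?S X) - prime_sum \<B> \<omega> l X) / of_real (sqrt (ln (ln X))))) =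
      (of_real (norm_mean \<F> \<omega> X * ln (ln X)) - (\<Sum>l\<in>?\<Lambda>. ?w l * prime_sum \<B> \<omega> l X)) / of_real (sqrt (ln (ln X)))"
      using eventually_ln_ln_ge_1
    proof eventually_elim
      case (elim X)
      then have nm: "norm_mean \<F> \<omega> X * ln (ln X) = ?S X" by (simp add: norm_mean_def)
      have "(\<Sum>l\<in>?\<Lambda>. ?w l * ((of_real (?S X) - prime_sum \<B> \<omega> l X) / of_real (sqrt (ln (ln X)))))
        = ((\<Sum>l\<in>?\<Lambda>. ?w l) * of_real (?S X) - (\<Sum>l\<in>?\<Lambda>. ?w l * prime_sum \<B> \<omega> l X)) / of_real (sqrt (ln (ln X)))"
        by (simp only: sum_distrib_right sum_subtractf[symmetric] sum_divide_distrib) (simp add: algebra_simps)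
      then show ?case unfolding w1 nm by simp
    qed
  qed
qed

end

lemma reasonable_setting_of_reasonable:
  fixes \<F> :: "('i, 'k::number_field) ideal_seq" and \<B> :: "('l, 'k) bernoulli"
  assumes "ordered_ideal_seq \<F>" "indices \<F> \<noteq> {}" "reasonable_wrt \<F> \<B>"
  obtains G C \<alpha> where "reasonable_setting \<F> \<B> G C \<alpha>"
    "\<And>l. l \<in> params (mixture_of \<B>) \<Longrightarrow> weight_lim (mixture_of \<B>) l =
       fps_nth (G l) 0 / (\<Sum>l\<in>params (mixture_of \<B>). fps_nth (G l) 0)"
proof -
  have BP: "bernoulli_process \<B>" and WM: "well_mixed \<B>" and few: "few_large_primes \<F>" and app: "moments_approx \<F> \<B>"
    using assms(3) by (auto simp: reasonable_wrt_def)
  from jet_model_of_bernoulli[OF BP WM] obtain G C \<alpha> where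
    jm: "jet_model (good_primes \<B>) (\<lambda>p. real (ideal_norm p)) (params (mixture_of \<B>)) (pole_order (mixture_of \<B>)) G (germ_jet \<B>) C \<alpha>"
    and mom: "\<And>X P. X > 0 \<Longrightarrow> set P \<subseteq> good_primes \<B> \<Longrightarrow> algebraic_moment \<B> X P =
       jet_expectation (pole_order (mixture_of \<B>)) (params (mixture_of \<B>)) G (ln X) (\<lambda>l. \<Prod>p\<in>set P. germ_jet \<B> p l)"
    and wl: "\<And>l. l \<in> params (mixture_of \<B>) \<Longrightarrow> weight_lim (mixture_of \<B>) l =
       fps_nth (G l) 0 / (\<Sum>l\<in>params (mixture_of \<B>). fps_nth (G l) 0)"
    by blast
  have "finite (bad_primes \<B>)" using BP by (simp add: bernoulli_process_def)
  then have "reasonable_setting \<F> \<B> G C \<alpha>"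
    using jm mom assms(1,2) few app by (intro reasonable_setting.intro reasonable_setting_axioms.intro) auto
  then show ?thesis using that wl by blast
qed

theorem theorem2p4:
  fixes \<omega> :: "'k::number_field set \<Rightarrow> real"
    and \<F> :: "('i, 'k) ideal_seq"
  assumes "strongly_additive \<omega>" and "bounded_sup_norm \<omega>"
    and "ordered_ideal_seq \<F>" and "indices \<F> \<noteq> {}"
    and "reasonable \<F>"
  shows
    "(\<forall>V>0. (norm_variance \<F> \<omega> \<longlongrightarrow> V) at_top \<longrightarrow> gaussian_law \<F> \<omega> (norm_mean \<F> \<omega>) V)
     \<and> (\<forall>\<B> :: ('l, 'k) bernoulli. reasonable_wrt \<F> \<B> \<longrightarrow>
          ((\<exists>\<mu>. (norm_mean \<F> \<omega> \<longlongrightarrow> \<mu>) at_top) \<longleftrightarrow> limit_formula_exists \<B> \<omega>)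
          \<and> (\<forall>\<mu>. (norm_mean \<F> \<omega> \<longlongrightarrow> \<mu>) at_top \<longrightarrow> of_real \<mu> = limit_formula \<B> \<omega>)
          \<and> ((\<exists>V. (norm_variance \<F> \<omega> \<longlongrightarrow> V) at_top) \<longleftrightarrow> limit_formula_exists \<B> (\<lambda>\<pp>. (\<omega> \<pp>)\<^sup>2))
          \<and> (\<forall>V. (norm_variance \<F> \<omega> \<longlongrightarrow> V) at_top \<longrightarrow>
                of_real V = limit_formula \<B> (\<lambda>\<pp>. (\<omega> \<pp>)\<^sup>2)))
     \<and> (\<forall>\<B> :: ('l, 'k) bernoulli. reasonable_wrt \<F> \<B> \<longrightarrow>
          (\<forall>\<mu> V. (norm_mean \<F> \<omega> \<longlongrightarrow> \<mu>) at_top \<and> (norm_variance \<F> \<omega> \<longlongrightarrow> V) at_top \<and> V > 0 \<and>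
             (\<lambda>X. (\<Sum>l\<in>params (mixture_of \<B>). weight_lim (mixture_of \<B>) l * prime_sum \<B> \<omega> l X)
                    - of_real (\<mu> * ln (ln X)))
               \<in> o(\<lambda>X. of_real (sqrt (ln (ln X))))
             \<longrightarrow> gaussian_law \<F> \<omega> (\<lambda>_. \<mu>) V))"
proof (intro conjI)
  obtain B where B: "B > 0" "\<And>p. p \<in> primes \<Longrightarrow> \<bar>\<omega> p\<bar> \<le> B"
  proof -
    obtain b where b: "\<And>p. p \<in> primes \<Longrightarrow> \<bar>\<omega> p\<bar> \<le> b"
      using assms(2) by (auto simp: bounded_sup_norm_def bdd_above_def)
    then show ?thesis by (intro that[of "max b 1"]) (auto intro: order.trans[OF _ max.cobounded1])
  qed
  have B0: "B \<ge> 0" using B(1) by simp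
  have B2: "\<bar>(\<omega> p)\<^sup>2\<bar> \<le> B\<^sup>2" if "p \<in> primes" for p using power_mono[OF B(2)[OF that], of 2] by simp
  show "\<forall>V>0. (norm_variance \<F> \<omega> \<longlongrightarrow> V) at_top \<longrightarrow> gaussian_law \<F> \<omega> (norm_mean \<F> \<omega>) V"
  proof (intro allI impI)
    fix V :: real assume V: "V > 0" and var: "(norm_variance \<F> \<omega> \<longlongrightarrow> V) at_top"
    obtain \<B> :: "(nat, 'k) bernoulli" where rw: "reasonable_wrt \<F> \<B>" using assms(5) by (auto simp: reasonable_def)
    obtain G C \<alpha> where "reasonable_setting \<F> \<B> G C \<alpha>"
      by (rule reasonable_setting_of_reasonable[OF assms(3,4) rw])
    then interpret reasonable_setting \<F> \<B> G C \<alpha> .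
    have "((\<lambda>X. (norm_mean \<F> \<omega> X * ln (ln X) - norm_mean \<F> \<omega> X * ln (ln X)) / sqrt (ln (ln X))) \<longlongrightarrow> 0) at_top"
      by simp
    from central_limit[OF assms(1) B(2,1) V var this]
    show "gaussian_law \<F> \<omega> (norm_mean \<F> \<omega>) V" unfolding gaussian_law_def by blast
  qed
  show "\<forall>\<B> :: ('l, 'k) bernoulli. reasonable_wrt \<F> \<B> \<longrightarrow>
          ((\<exists>\<mu>. (norm_mean \<F> \<omega> \<longlongrightarrow> \<mu>) at_top) \<longleftrightarrow> limit_formula_exists \<B> \<omega>)
          \<and> (\<forall>\<mu>. (norm_mean \<F> \<omega> \<longlongrightarrow> \<mu>) at_top \<longrightarrow> of_real \<mu> = limit_formula \<B> \<omega>)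
          \<and> ((\<exists>V. (norm_variance \<F> \<omega> \<longlongrightarrow> V) at_top) \<longleftrightarrow> limit_formula_exists \<B> (\<lambda>\<pp>. (\<omega> \<pp>)\<^sup>2))
          \<and> (\<forall>V. (norm_variance \<F> \<omega> \<longlongrightarrow> V) at_top \<longrightarrow>
                of_real V = limit_formula \<B> (\<lambda>\<pp>. (\<omega> \<pp>)\<^sup>2))"
  proof (intro allI impI)
    fix \<B> :: "('l, 'k) bernoulli" assume rw: "reasonable_wrt \<F> \<B>"
    obtain G C \<alpha> where rs: "reasonable_setting \<F> \<B> G C \<alpha>"
      and wl: "\<And>l. l \<in> params (mixture_of \<B>) \<Longrightarrow> weight_lim (mixture_of \<B>) l =
         fps_nth (G l) 0 / (\<Sum>l\<in>params (mixture_of \<B>). fps_nth (G l) 0)"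
      using reasonable_setting_of_reasonable[OF assms(3,4) rw] by blast
    interpret reasonable_setting \<F> \<B> G C \<alpha> by (rule rs)
    have mean: "((\<lambda>X. of_real (norm_mean \<F> \<omega> X) - prime_average \<B> \<omega> l X) \<longlongrightarrow> 0) at_top" if "l \<in> heavy" for l
      by (rule mean_vs_prime_average[OF that B(2) B0])
    have var: "((\<lambda>X. of_real (norm_variance \<F> \<omega> X) - prime_average \<B> (\<lambda>\<pp>. (\<omega> \<pp>)\<^sup>2) l X) \<longlongrightarrow> 0) at_top" if "l \<in> heavy" for l
    proof -
      have "((\<lambda>X. complex_of_real (norm_variance \<F> \<omega> X - norm_mean \<F> (\<lambda>p. (\<omega> p)\<^sup>2) X)) \<longlongrightarrow> of_real 0) at_top"
        by (intro tendsto_of_real variance_vs_second_mean[OF B(2) B0])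
      from tendsto_add[OF this mean_vs_prime_average[OF that, of "\<lambda>\<pp>. (\<omega> \<pp>)\<^sup>2", OF B2]]
      show ?thesis by simp
    qed
    show "((\<exists>\<mu>. (norm_mean \<F> \<omega> \<longlongrightarrow> \<mu>) at_top) \<longleftrightarrow> limit_formula_exists \<B> \<omega>)
          \<and> (\<forall>\<mu>. (norm_mean \<F> \<omega> \<longlongrightarrow> \<mu>) at_top \<longrightarrow> of_real \<mu> = limit_formula \<B> \<omega>)
          \<and> ((\<exists>V. (norm_variance \<F> \<omega> \<longlongrightarrow> V) at_top) \<longleftrightarrow> limit_formula_exists \<B> (\<lambda>\<pp>. (\<omega> \<pp>)\<^sup>2))
          \<and> (\<forall>V. (norm_variance \<F> \<omega> \<longlongrightarrow> V) at_top \<longrightarrow>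
                of_real V = limit_formula \<B> (\<lambda>\<pp>. (\<omega> \<pp>)\<^sup>2))"
      using limit_formulae[OF wl mean] limit_formulae[OF wl var] by blast
  qed
  show "\<forall>\<B> :: ('l, 'k) bernoulli. reasonable_wrt \<F> \<B> \<longrightarrow>
          (\<forall>\<mu> V. (norm_mean \<F> \<omega> \<longlongrightarrow> \<mu>) at_top \<and> (norm_variance \<F> \<omega> \<longlongrightarrow> V) at_top \<and> V > 0 \<and>
             (\<lambda>X. (\<Sum>l\<in>params (mixture_of \<B>). weight_lim (mixture_of \<B>) l * prime_sum \<B> \<omega> l X)
                    - of_real (\<mu> * ln (ln X)))
               \<in> o(\<lambda>X. of_real (sqrt (ln (ln X))))
             \<longrightarrow> gaussian_law \<F> \<omega> (\<lambda>_. \<mu>) V)"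
  proof (intro allI impI, elim conjE)
    fix \<B> :: "('l, 'k) bernoulli" and \<mu> V :: real
    assume rw: "reasonable_wrt \<F> \<B>" and V: "V > 0" and var: "(norm_variance \<F> \<omega> \<longlongrightarrow> V) at_top"
      and o: "(\<lambda>X. (\<Sum>l\<in>params (mixture_of \<B>). weight_lim (mixture_of \<B>) l * prime_sum \<B> \<omega> l X)
                    - of_real (\<mu> * ln (ln X))) \<in> o(\<lambda>X. of_real (sqrt (ln (ln X))))"
    obtain G C \<alpha> where rs: "reasonable_setting \<F> \<B> G C \<alpha>"
      and wl: "\<And>l. l \<in> params (mixture_of \<B>) \<Longrightarrow> weight_lim (mixture_of \<B>) l =
         fps_nth (G l) 0 / (\<Sum>l\<in>params (mixture_of \<B>). fps_nth (G l) 0)"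
      using reasonable_setting_of_reasonable[OF assms(3,4) rw] by blast
    interpret reasonable_setting \<F> \<B> G C \<alpha> by (rule rs)
    have "((\<lambda>X. ((\<Sum>l\<in>params (mixture_of \<B>). weight_lim (mixture_of \<B>) l * prime_sum \<B> \<omega> l X)
                    - of_real (\<mu> * ln (ln X))) / of_real (sqrt (ln (ln X)))) \<longlongrightarrow> 0) at_top"
      by (rule smalloD_tendsto[OF o])
    from tendsto_minus[OF tendsto_add[OF this weighted_prime_sums[where \<omega> = \<omega> and B = B, OF wl B(2) B0]]]
    have "((\<lambda>X. complex_of_real ((\<mu> * ln (ln X) - norm_mean \<F> \<omega> X * ln (ln X)) / sqrt (ln (ln X)))) \<longlongrightarrow> 0) at_top"
      by (simp add: add_divide_distrib[symmetric] diff_divide_distrib[symmetric] minus_divide_left)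
    from tendsto_Re[OF this]
    have "((\<lambda>X. (\<mu> * ln (ln X) - norm_mean \<F> \<omega> X * ln (ln X)) / sqrt (ln (ln X))) \<longlongrightarrow> 0) at_top" by simp
    from central_limit[OF assms(1) B(2,1) V var this]
    show "gaussian_law \<F> \<omega> (\<lambda>_. \<mu>) V" unfolding gaussian_law_def by blast
  qed
qed

end
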